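(* Let $(G,g)$ be a connected Riemannian Lie group with harmonic Weyl tensor, and let $(\mathfrak{g},\langle\cdot,\cdot\rangle)$ be the associated Euclidean Lie algebra. If $\mathfrak{g}$ is one of the Lie algebras $2\mathbb{A}_2$, $\mathbb{A}_{4,6}^{\alpha,\beta}$ with $\alpha\neq 1$, $\mathbb{A}_{3,9}\oplus\mathbb{A}_1$, $\mathbb{A}_{3,7}^{\alpha}\oplus\mathbb{A}_1$ with $\alpha>0$, or $\mathbb{A}_{4,12}$, then $g$ is locally symmetric.
   Context: A Riemannian Lie group $(G,g)$ is a real Lie group $G$ with a left invariant Riemannian metric $g$; $\mathfrak{g}$ is the Lie algebra of $G$ and $\langle\cdot,\cdot\rangle$ is the inner product on $\mathfrak{g}$ induced by $g$. The pair $(\mathfrak{g},\langle\cdot,\cdot\rangle)$ is the associated Euclidean Lie algebra. Let $\nabla$ be the Levi-Civita connection of $g$, $R(x,y)=\nabla_{[x,y]}-\nabla_x\nabla_y+\nabla_y\nabla_x$, and $R(x,y,u,v)=\langle R(x,y)u,v\rangle$. The metric $g$ is locally symmetric if $\nabla R=0$. Let $n=\dim G\ge 4$ (here $n=4$), let $r(x,y)=\operatorname{tr}(u\mapsto R(x,u)y)$ be the Ricci tensor, $s=\operatorname{tr}(r)$ the scalar curvature, and $A=\frac{1}{n-2}\left(r-\frac{s\,g}{2(n-1)}\right)$. The Weyl tensor is $W=R-A\odot g$, where $(A\odot g)(x,y,u,v)=A(x,u)g(y,v)+A(y,v)g(x,u)-A(x,v)g(y,u)-A(y,u)g(x,v)$.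 The Riemannian Lie group has harmonic Weyl tensor (is a $\mathcal{C}$-space) if $\operatorname{div}W=0$, where $\operatorname{div}W$ is the divergence of $W$, i.e. $\sum_i(\nabla_{e_i}W)(e_i,x,y,z)=0$ for all $x,y,z\in\mathfrak g$ and an orthonormal basis $(e_i)$. In particular conformally flat metrics ($W=0$) are included. Real Lie algebras, up to isomorphism (given by brackets in some basis, unlisted brackets of basis elements vanish): $\mathbb{A}_1=\mathbb{R}$; $\mathbb{A}_2$ is the $2$-dimensional non-abelian Lie algebra, and $2\mathbb{A}_2=\mathbb{A}_2\oplus\mathbb{A}_2$; $\mathbb{A}_{3,7}^{\alpha}$: $[f_1,f_3]=\alpha f_1-f_2$, $[f_2,f_3]=f_1+\alpha f_2$; $\mathbb{A}_{3,9}$: $[f_1,f_2]=f_3$, $[f_2,f_3]=f_1$, $[f_3,f_1]=f_2$ (i.e. $\mathfrak{su}(2)$); $\mathbb{A}_{4,6}^{\alpha,\beta}$ ($\alpha\ne 0$, $\beta\geq 0$): $[f_1,f_4]=\alpha f_1$, $[f_2,f_4]=\beta f_2-f_3$, $[f_3,f_4]=f_2+\beta f_3$; $\mathbb{A}_{4,12}$: $[f_1,f_3]=f_1$, $[f_2,f_3]=f_2$, $[f_1,f_4]=-f_2$, $[f_2,f_4]=f_1$. Here $\oplus$ is the direct sum of Lie algebras, and "$\mathfrak{g}$ is one of" these Lie algebras means isomorphic to it, the inner product being arbitrary subject to the harmonic Weyl hypothesis. *)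

theory Defs
  imports "HOL-Analysis.Analysis" "HOL-Library.Function_Algebras"
begin

section \<open>Smooth manifolds and Lie groups\<close>

text \<open>\<open>Ck_on k S f\<close> is meant for open \<open>S\<close>: all iterated directional derivatives of order
  at most \<open>k\<close> exist (as Frechet derivatives) and are continuous on \<open>S\<close>.\<close>

fun Ck_on :: "nat \<Rightarrow> 'a::euclidean_space set \<Rightarrow> ('a \<Rightarrow> 'b::real_normed_vector) \<Rightarrow> bool" where
  "Ck_on 0 S f \<longleftrightarrow> continuous_on S f"
| "Ck_on (Suc k) S f \<longleftrightarrow> (\<forall>x\<in>S. f differentiable at x) \<and>
     (\<forall>v. Ck_on k S (\<lambda>x. frechet_derivative f (at x) v))"

definition smooth_on :: "'a::euclidean_space set \<Rightarrow> ('a \<Rightarrow> 'b::real_normed_vector) \<Rightarrow> bool" where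
  "smooth_on S f \<longleftrightarrow> (\<forall>k. Ck_on k S f)"

text \<open>A chart is a pair of its domain and its coordinate map; the coordinate map is irrelevant
  off the domain. The model space \<open>'e\<close> carries the dimension of the manifold, and the manifold
  is the whole type \<open>'g\<close>. An atlas need not be maximal.\<close>

type_synonym ('g, 'e) chart = "'g set \<times> ('g \<Rightarrow> 'e)"

definition smooth_atlas :: "('g::topological_space, 'e::euclidean_space) chart set \<Rightarrow> bool" where
  "smooth_atlas charts \<longleftrightarrow>
     (\<Union>(U, \<phi>)\<in>charts. U) = UNIV \<and>
     (\<forall>(U, \<phi>)\<in>charts. open U \<and> open (\<phi> ` U) \<and> homeomorphism U (\<phi> ` U) \<phi> (inv_into U \<phi>)) \<and>
     (\<forall>(U, \<phi>)\<in>charts. \<forall>(V, \<psi>)\<in>charts. smooth_on (\<phi> ` (U \<inter> V)) (\<psi> \<circ> inv_into U \<phi>))"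

definition product_charts ::
    "('g, 'e) chart set \<Rightarrow> ('h, 'f) chart set \<Rightarrow> ('g \<times> 'h, 'e \<times> 'f) chart set" where
  "product_charts A B = {(U \<times> V, map_prod \<phi> \<psi>) | U \<phi> V \<psi>. (U, \<phi>) \<in> A \<and> (V, \<psi>) \<in> B}"

definition smooth_map ::
    "('g::topological_space, 'e::euclidean_space) chart set \<Rightarrow>
     ('h::topological_space, 'f::euclidean_space) chart set \<Rightarrow> ('g \<Rightarrow> 'h) \<Rightarrow> bool" where
  "smooth_map A B f \<longleftrightarrow> continuous_on UNIV f \<and>
     (\<forall>(U, \<phi>)\<in>A. \<forall>(V, \<psi>)\<in>B. smooth_on (\<phi> ` (U \<inter> f -` V)) (\<psi> \<circ> f \<circ> inv_into U \<phi>))"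

definition lie_group ::
    "('g::{t2_space, second_countable_topology} \<Rightarrow> 'g \<Rightarrow> 'g) \<Rightarrow> 'g \<Rightarrow> ('g \<Rightarrow> 'g) \<Rightarrow>
     ('g, 'e::euclidean_space) chart set \<Rightarrow> bool" where
  "lie_group mul idt inver charts \<longleftrightarrow>
     group mul idt inver \<and> smooth_atlas charts \<and>
     smooth_map (product_charts charts charts) charts (\<lambda>(a, b). mul a b) \<and>
     smooth_map charts charts inver"


section \<open>Tangent vectors and vector fields\<close>

definition smooth_fun :: "('g, 'e::euclidean_space) chart set \<Rightarrow> ('g \<Rightarrow> real) \<Rightarrow> bool" where
  "smooth_fun charts f \<longleftrightarrow> (\<forall>(U, \<phi>)\<in>charts. smooth_on (\<phi> ` U) (f \<circ> inv_into U \<phi>))"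

text \<open>A tangent vector acts on smooth functions as a derivation. Its value on non-smooth functions
  is fixed to be 0, so that equality of tangent vectors is equality of functions.\<close>

type_synonym 'g tangent = "('g \<Rightarrow> real) \<Rightarrow> real"
type_synonym 'g vfield = "'g \<Rightarrow> 'g tangent"

definition coord_tangent ::
    "('g, 'e::euclidean_space) chart set \<Rightarrow> ('g, 'e) chart \<Rightarrow> 'g \<Rightarrow> 'e \<Rightarrow> 'g tangent" where
  "coord_tangent charts c p w =
     (\<lambda>f. if smooth_fun charts f
          then frechet_derivative (f \<circ> inv_into (fst c) (snd c)) (at (snd c p)) w else 0)"

definition tangent_space :: "('g, 'e::euclidean_space) chart set \<Rightarrow> 'g \<Rightarrow> 'g tangent set" where
  "tangent_space charts p = {coord_tangent charts c p w | c w. c \<in> charts \<and> p \<in> fst c}"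

definition vector_fields :: "('g, 'e::euclidean_space) chart set \<Rightarrow> 'g vfield set" where
  "vector_fields charts = {X. (\<forall>p. X p \<in> tangent_space charts p) \<and>
     (\<forall>c\<in>charts. \<exists>\<xi>. smooth_on (snd c ` fst c) \<xi> \<and>
        (\<forall>p\<in>fst c. X p = coord_tangent charts c p (\<xi> (snd c p))))}"

definition vf_apply :: "'g vfield \<Rightarrow> ('g \<Rightarrow> real) \<Rightarrow> 'g \<Rightarrow> real" where
  "vf_apply X f = (\<lambda>p. X p f)"

text \<open>Sums and differences of vector fields are the pointwise ones of
  \<^theory>\<open>HOL-Library.Function_Algebras\<close>.\<close>

definition vf_scale :: "('g \<Rightarrow> real) \<Rightarrow> 'g vfield \<Rightarrow> 'g vfield" where
  "vf_scale h X = (\<lambda>p f. h p * X p f)"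

definition vf_bracket :: "'g vfield \<Rightarrow> 'g vfield \<Rightarrow> 'g vfield" where
  "vf_bracket X Y = (\<lambda>p f. X p (vf_apply Y f) - Y p (vf_apply X f))"


section \<open>Left invariant vector fields and Riemannian metrics\<close>

definition push_forward :: "('g \<Rightarrow> 'h) \<Rightarrow> 'g tangent \<Rightarrow> 'h tangent" where
  "push_forward F u = (\<lambda>f. u (f \<circ> F))"

definition lie_algebra ::
    "('g \<Rightarrow> 'g \<Rightarrow> 'g) \<Rightarrow> ('g, 'e::euclidean_space) chart set \<Rightarrow> 'g vfield set" where
  "lie_algebra mul charts =
     {X \<in> vector_fields charts. \<forall>a p. X (mul a p) = push_forward (mul a) (X p)}"

type_synonym 'g metric = "'g \<Rightarrow> 'g tangent \<Rightarrow> 'g tangent \<Rightarrow> real"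

definition metric_apply :: "'g metric \<Rightarrow> 'g vfield \<Rightarrow> 'g vfield \<Rightarrow> 'g \<Rightarrow> real" where
  "metric_apply g X Y = (\<lambda>p. g p (X p) (Y p))"

definition riemannian_metric :: "('g, 'e::euclidean_space) chart set \<Rightarrow> 'g metric \<Rightarrow> bool" where
  "riemannian_metric charts g \<longleftrightarrow>
     (\<forall>p. \<forall>u\<in>tangent_space charts p.
        (\<forall>v\<in>tangent_space charts p. g p u v = g p v u \<and>
           (\<forall>w\<in>tangent_space charts p. \<forall>a b.
              g p (\<lambda>f. a * u f + b * v f) w = a * g p u w + b * g p v w)) \<and>
        (u \<noteq> 0 \<longrightarrow> g p u u > 0)) \<and>
     (\<forall>X\<in>vector_fields charts. \<forall>Y\<in>vector_fields charts. smooth_fun charts (metric_apply g X Y))"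

definition left_invariant_metric ::
    "('g \<Rightarrow> 'g \<Rightarrow> 'g) \<Rightarrow> ('g, 'e::euclidean_space) chart set \<Rightarrow> 'g metric \<Rightarrow> bool" where
  "left_invariant_metric mul charts g \<longleftrightarrow>
     (\<forall>a p. \<forall>u\<in>tangent_space charts p. \<forall>v\<in>tangent_space charts p.
        g (mul a p) (push_forward (mul a) u) (push_forward (mul a) v) = g p u v)"

definition riemannian_lie_group ::
    "('g::{t2_space, second_countable_topology} \<Rightarrow> 'g \<Rightarrow> 'g) \<Rightarrow> 'g \<Rightarrow> ('g \<Rightarrow> 'g) \<Rightarrow>
     ('g, 'e::euclidean_space) chart set \<Rightarrow> 'g metric \<Rightarrow> bool" where
  "riemannian_lie_group mul idt inver charts g \<longleftrightarrow>
     lie_group mul idt inver charts \<and> riemannian_metric charts g \<and>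
     left_invariant_metric mul charts g"

text \<open>Only the values of \<open>D\<close> on \<open>vector_fields charts\<close> matter, and there these properties
  determine \<open>D\<close> uniquely.\<close>

definition levi_civita ::
    "('g, 'e::euclidean_space) chart set \<Rightarrow> 'g metric \<Rightarrow>
     ('g vfield \<Rightarrow> 'g vfield \<Rightarrow> 'g vfield) \<Rightarrow> bool" where
  "levi_civita charts g D \<longleftrightarrow>
     (\<forall>X\<in>vector_fields charts. \<forall>Y\<in>vector_fields charts.
        D X Y \<in> vector_fields charts \<and>
        (\<forall>h. smooth_fun charts h \<longrightarrow>
           D (vf_scale h X) Y = vf_scale h (D X Y) \<and>
           D X (vf_scale h Y) = vf_scale (vf_apply X h) Y + vf_scale h (D X Y)) \<and>
        D X Y - D Y X = vf_bracket X Y \<and>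
        (\<forall>Z\<in>vector_fields charts.
           D (X + Y) Z = D X Z + D Y Z \<and>
           D X (Y + Z) = D X Y + D X Z \<and>
           vf_apply X (metric_apply g Y Z) =
             metric_apply g (D X Y) Z + metric_apply g Y (D X Z)))"


section \<open>Curvature\<close>

text \<open>In this section \<open>D\<close> is the Levi-Civita connection of \<open>g\<close>, and \<open>e i\<close> for \<open>i < n\<close>
  is an orthonormal basis of the Lie algebra. It is a global orthonormal frame, so it computes
  the traces at every point, and nothing below depends on the choice of the basis. The curvature
  has the sign opposite to the usual one; \<open>ricci\<close> compensates, so it is the usual Ricci
  tensor.\<close>

definition curvature ::
    "('g vfield \<Rightarrow> 'g vfield \<Rightarrow> 'g vfield) \<Rightarrow> 'g vfield \<Rightarrow> 'g vfield \<Rightarrow> 'g vfield \<Rightarrow> 'g vfield" where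
  "curvature D X Y Z = D (vf_bracket X Y) Z - D X (D Y Z) + D Y (D X Z)"

definition locally_symmetric ::
    "('g, 'e::euclidean_space) chart set \<Rightarrow> ('g vfield \<Rightarrow> 'g vfield \<Rightarrow> 'g vfield) \<Rightarrow> bool" where
  "locally_symmetric charts D \<longleftrightarrow>
     (\<forall>X\<in>vector_fields charts. \<forall>Y\<in>vector_fields charts.
      \<forall>Z\<in>vector_fields charts. \<forall>U\<in>vector_fields charts.
        D X (curvature D Y Z U) - curvature D (D X Y) Z U
          - curvature D Y (D X Z) U - curvature D Y Z (D X U) = 0)"

definition orthonormal_basis ::
    "'g vfield set \<Rightarrow> 'g \<Rightarrow> 'g metric \<Rightarrow> nat \<Rightarrow> (nat \<Rightarrow> 'g vfield) \<Rightarrow> bool" where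
  "orthonormal_basis \<gg> idt g n e \<longleftrightarrow>
     (\<forall>i<n. e i \<in> \<gg>) \<and>
     (\<forall>i<n. \<forall>j<n. metric_apply g (e i) (e j) idt = (if i = j then 1 else 0)) \<and>
     (\<forall>X\<in>\<gg>. \<exists>c. X = (\<Sum>i<n. vf_scale (\<lambda>_. c i) (e i)))"

definition ricci ::
    "'g metric \<Rightarrow> ('g vfield \<Rightarrow> 'g vfield \<Rightarrow> 'g vfield) \<Rightarrow> nat \<Rightarrow> (nat \<Rightarrow> 'g vfield) \<Rightarrow>
     'g vfield \<Rightarrow> 'g vfield \<Rightarrow> 'g \<Rightarrow> real" where
  "ricci g D n e X Y = (\<lambda>p. \<Sum>i<n. metric_apply g (curvature D X (e i) Y) (e i) p)"

definition scalar_curvature ::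
    "'g metric \<Rightarrow> ('g vfield \<Rightarrow> 'g vfield \<Rightarrow> 'g vfield) \<Rightarrow> nat \<Rightarrow> (nat \<Rightarrow> 'g vfield) \<Rightarrow>
     'g \<Rightarrow> real" where
  "scalar_curvature g D n e = (\<lambda>p. \<Sum>i<n. ricci g D n e (e i) (e i) p)"

definition schouten ::
    "'g metric \<Rightarrow> ('g vfield \<Rightarrow> 'g vfield \<Rightarrow> 'g vfield) \<Rightarrow> nat \<Rightarrow> (nat \<Rightarrow> 'g vfield) \<Rightarrow>
     'g vfield \<Rightarrow> 'g vfield \<Rightarrow> 'g \<Rightarrow> real" where
  "schouten g D n e X Y = (\<lambda>p. 1 / (real n - 2) *
     (ricci g D n e X Y p
        - scalar_curvature g D n e p * metric_apply g X Y p / (2 * (real n - 1))))"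

definition kulkarni_nomizu ::
    "('g vfield \<Rightarrow> 'g vfield \<Rightarrow> 'g \<Rightarrow> real) \<Rightarrow> ('g vfield \<Rightarrow> 'g vfield \<Rightarrow> 'g \<Rightarrow> real) \<Rightarrow>
     'g vfield \<Rightarrow> 'g vfield \<Rightarrow> 'g vfield \<Rightarrow> 'g vfield \<Rightarrow> 'g \<Rightarrow> real" where
  "kulkarni_nomizu A h X Y U V = (\<lambda>p.
     A X U p * h Y V p + A Y V p * h X U p - A X V p * h Y U p - A Y U p * h X V p)"

definition weyl ::
    "'g metric \<Rightarrow> ('g vfield \<Rightarrow> 'g vfield \<Rightarrow> 'g vfield) \<Rightarrow> nat \<Rightarrow> (nat \<Rightarrow> 'g vfield) \<Rightarrow>
     'g vfield \<Rightarrow> 'g vfield \<Rightarrow> 'g vfield \<Rightarrow> 'g vfield \<Rightarrow> 'g \<Rightarrow> real" where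
  "weyl g D n e X Y U V = (\<lambda>p.
     metric_apply g (curvature D X Y U) V p
       - kulkarni_nomizu (schouten g D n e) (metric_apply g) X Y U V p)"

definition nabla_tensor4 ::
    "('g vfield \<Rightarrow> 'g vfield \<Rightarrow> 'g vfield) \<Rightarrow>
     ('g vfield \<Rightarrow> 'g vfield \<Rightarrow> 'g vfield \<Rightarrow> 'g vfield \<Rightarrow> 'g \<Rightarrow> real) \<Rightarrow>
     'g vfield \<Rightarrow> 'g vfield \<Rightarrow> 'g vfield \<Rightarrow> 'g vfield \<Rightarrow> 'g vfield \<Rightarrow> 'g \<Rightarrow> real" where
  "nabla_tensor4 D T Z X Y U V = (\<lambda>p.
     vf_apply Z (T X Y U V) p
       - T (D Z X) Y U V p - T X (D Z Y) U V p - T X Y (D Z U) V p - T X Y U (D Z V) p)"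

definition harmonic_weyl ::
    "('g \<Rightarrow> 'g \<Rightarrow> 'g) \<Rightarrow> 'g \<Rightarrow> ('g, 'e::euclidean_space) chart set \<Rightarrow> 'g metric \<Rightarrow>
     ('g vfield \<Rightarrow> 'g vfield \<Rightarrow> 'g vfield) \<Rightarrow> bool" where
  "harmonic_weyl mul idt charts g D \<longleftrightarrow>
     (\<exists>e. orthonormal_basis (lie_algebra mul charts) idt g DIM('e) e \<and>
        (\<forall>x\<in>lie_algebra mul charts. \<forall>y\<in>lie_algebra mul charts. \<forall>z\<in>lie_algebra mul charts.
           \<forall>p. (\<Sum>i<DIM('e). nabla_tensor4 D (weyl g D DIM('e) e) (e i) (e i) x y z p) = 0))"


section \<open>The Lie algebras of the classification\<close>

text \<open>\<open>structure_bracket c\<close> is the Lie bracket on \<open>real ^ 'n\<close> obtained bilinearly from a table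
  of brackets of standard basis vectors. Each nonzero bracket is entered in one order only
  (\<open>[f\<^sub>i, f\<^sub>j] = c i j\<close>), and antisymmetry supplies the other.\<close>

definition structure_bracket ::
    "('n \<Rightarrow> 'n \<Rightarrow> real ^ 'n) \<Rightarrow> real ^ 'n \<Rightarrow> real ^ 'n \<Rightarrow> real ^ 'n::finite" where
  "structure_bracket c x y = (\<Sum>i\<in>UNIV. \<Sum>j\<in>UNIV. (x $ i * y $ j) *\<^sub>R (c i j - c j i))"

abbreviation bv :: "'n \<Rightarrow> real ^ 'n::finite" where
  "bv i \<equiv> axis i 1"

definition bracket_sum ::
    "('a \<Rightarrow> 'a \<Rightarrow> 'a) \<Rightarrow> ('b \<Rightarrow> 'b \<Rightarrow> 'b) \<Rightarrow> 'a \<times> 'b \<Rightarrow> 'a \<times> 'b \<Rightarrow> 'a \<times> 'b" where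
  "bracket_sum b1 b2 x y = (b1 (fst x) (fst y), b2 (snd x) (snd y))"

definition A1 :: "real \<Rightarrow> real \<Rightarrow> real" where
  "A1 x y = 0"

definition A2 :: "real ^ 2 \<Rightarrow> real ^ 2 \<Rightarrow> real ^ 2" where
  "A2 = structure_bracket (\<lambda>i j. if i = 1 \<and> j = 2 then bv 2 else 0)"

definition A3_7 :: "real \<Rightarrow> real ^ 3 \<Rightarrow> real ^ 3 \<Rightarrow> real ^ 3" where
  "A3_7 \<alpha> = structure_bracket (\<lambda>i j.
     if i = 1 \<and> j = 3 then \<alpha> *\<^sub>R bv 1 - bv 2
     else if i = 2 \<and> j = 3 then bv 1 + \<alpha> *\<^sub>R bv 2
     else 0)"

definition A3_9 :: "real ^ 3 \<Rightarrow> real ^ 3 \<Rightarrow> real ^ 3" where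
  "A3_9 = structure_bracket (\<lambda>i j.
     if i = 1 \<and> j = 2 then bv 3
     else if i = 2 \<and> j = 3 then bv 1
     else if i = 3 \<and> j = 1 then bv 2
     else 0)"

definition A4_6 :: "real \<Rightarrow> real \<Rightarrow> real ^ 4 \<Rightarrow> real ^ 4 \<Rightarrow> real ^ 4" where
  "A4_6 \<alpha> \<beta> = structure_bracket (\<lambda>i j.
     if i = 1 \<and> j = 4 then \<alpha> *\<^sub>R bv 1
     else if i = 2 \<and> j = 4 then \<beta> *\<^sub>R bv 2 - bv 3
     else if i = 3 \<and> j = 4 then bv 2 + \<beta> *\<^sub>R bv 3
     else 0)"

definition A4_12 :: "real ^ 4 \<Rightarrow> real ^ 4 \<Rightarrow> real ^ 4" where
  "A4_12 = structure_bracket (\<lambda>i j.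
     if i = 1 \<and> j = 3 then bv 1
     else if i = 2 \<and> j = 3 then bv 2
     else if i = 1 \<and> j = 4 then - bv 2
     else if i = 2 \<and> j = 4 then bv 1
     else 0)"

text \<open>The Lie algebra \<open>\<gg>\<close> of vector fields is isomorphic to the vector space \<open>'v\<close> with
  bracket \<open>b\<close>.\<close>

definition isomorphic_to :: "'g vfield set \<Rightarrow> ('v::real_vector \<Rightarrow> 'v \<Rightarrow> 'v) \<Rightarrow> bool" where
  "isomorphic_to \<gg> b \<longleftrightarrow> (\<exists>F. bij_betw F UNIV \<gg> \<and>
     (\<forall>x y. F (x + y) = F x + F y) \<and>
     (\<forall>a x. F (a *\<^sub>R x) = vf_scale (\<lambda>_. a) (F x)) \<and>
     (\<forall>x y. F (b x y) = vf_bracket (F x) (F y)))"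

end

theory Submission
  imports Defs
begin

text \<open>In a left invariant orthonormal frame the Levi-Civita connection, and with it every curvature
  tensor, is given by a bilinear map \<open>nab\<close> on the Lie algebra. The scalar curvature is constant,
  so \<open>div W = 0\<close> says that the Ricci tensor is a Codazzi tensor, and the Codazzi equation is
  solved for each kind of Lie algebra.

  \<^item> \<open>A4,6\<close> and \<open>A3,7 + A1\<close> have an abelian ideal of codimension 1. If \<open>A\<close> and \<open>S\<close> are the
    skew and symmetric parts of the action of the unit normal \<open>e\<close> on it, the equation gives
    \<open>[[A, S], S] = 0\<close>, hence \<open>[A, S] = 0\<close>, and then \<open>tr S \<cdot> S\<^sup>2 = |S|\<^sup>2 S\<close>. So \<open>S\<close> is a multiple of a
    projection and the space is a hyperbolic space times a flat one.
  \<^item> \<open>2A2\<close> and \<open>A4,12\<close> have a 2-dimensional abelian derived algebra on which some element acts as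
    the identity. The equation leaves the product of hyperbolic 3-space and a line, or the
    product of two hyperbolic planes.
  \<^item> On \<open>A3,9 + A1\<close> it makes the metric round on \<open>su(2)\<close>, and the space is the product of a
    3-sphere and a line.

  In each case the curvature is a combination of curvatures of constant type on the images of
  parallel orthogonal projections, so it is parallel.\<close>

section \<open>Differentiable functions and vector fields\<close>

text \<open>The obstacle is the gap between the definitions, where vector fields are derivations and
  \<open>locally_symmetric\<close> ranges over all of them, and the algebra, where only constant
  coefficients occur. Tensoriality closes it: \<open>nabla_curvature\<close> is linear over smooth
  functions in each slot, so its vanishing on one global frame is enough. That frame is the one
  inside \<open>harmonic_weyl\<close>; it spans the Lie algebra, and left invariance makes its inner
  products constant. Sending the standard basis of the model space \<open>'e\<close> to it gives an
  isometry \<open>L\<close>. By Koszul's formula \<open>D\<close> preserves the image of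
  \<open>L\<close>, and everything moves to \<open>'e\<close>.

  The inner product is arbitrary relative to the bracket table. Each algebra is therefore entered
  through data adapted to the metric (a unit normal, a basis making a diagonal vanish, a Milnor
  basis) that leave few structure constants. For the last two kinds of algebra the remaining
  parameters are then constrained by a handful of Codazzi components, polynomials that
  factor.\<close>

lemma Ck_on_cong:
  assumes "open S" "\<And>x. x \<in> S \<Longrightarrow> f x = g x" "Ck_on k S f"
  shows "Ck_on k S g"
  using assms(2,3)
proof (induction k arbitrary: f g)
  case 0
  then show ?case using continuous_on_cong[of S S f g] by simp
next
  case (Suc k)
  have g': "(g has_derivative frechet_derivative f (at x)) (at x)" if "x \<in> S" for x
  proof -
    have "(f has_derivative frechet_derivative f (at x)) (at x)"
      using Suc.prems(2) that by (simp add: frechet_derivative_works)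
    \<comment> \<open>A derivative at \<open>x\<close> depends on the values near \<open>x\<close>;
      equality on \<open>S\<close> is enough because \<open>S\<close> is open.\<close>
    then show ?thesis
      by (rule has_derivative_transform_within_open[OF _ assms(1) that])
        (simp add: Suc.prems(1))
  qed
  have "frechet_derivative g (at x) = frechet_derivative f (at x)" if "x \<in> S" for x
    using frechet_derivative_at[OF g'[OF that]] by simp
  then have "Ck_on k S (\<lambda>x. frechet_derivative g (at x) v)" for v
    using Suc.IH[of "\<lambda>x. frechet_derivative f (at x) v" "\<lambda>x. frechet_derivative g (at x) v"]
      Suc.prems(2) by simp
  moreover have "g differentiable at x" if "x \<in> S" for x
    using g'[OF that] by (auto simp: differentiable_def)
  ultimately show ?case by simp
qed

text \<open>Lets the calculus rules supply a derivative in closed form instead of the choice-based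
  \<open>frechet_derivative\<close> of the recursive definition.\<close>

lemma Ck_on_Suc_I:
  assumes "open S" "\<And>x. x \<in> S \<Longrightarrow> (f has_derivative f' x) (at x)"
    "\<And>v. Ck_on k S (\<lambda>x. f' x v)"
  shows "Ck_on (Suc k) S f"
proof -
  have "frechet_derivative f (at x) = f' x" if "x \<in> S" for x
    using frechet_derivative_at[OF assms(2)[OF that]] by simp
  then have "Ck_on k S (\<lambda>x. frechet_derivative f (at x) v)" for v
    using Ck_on_cong[OF assms(1) _ assms(3)[of v], of "\<lambda>x. frechet_derivative f (at x) v"] by simp
  then show ?thesis using assms(2) by (auto simp: differentiable_def)
qed

lemma Ck_on_Suc_deriv:
  assumes "Ck_on (Suc k) S f" "x \<in> S"
  shows "(f has_derivative frechet_derivative f (at x)) (at x)"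
  using assms by (simp add: frechet_derivative_works)

lemma Ck_on_continuous: "Ck_on k S f \<Longrightarrow> continuous_on S f"
  by (cases k) (simp_all add: continuous_at_imp_continuous_on differentiable_imp_continuous_within)

lemma Ck_on_Suc_D: "Ck_on (Suc k) S f \<Longrightarrow> Ck_on k S f"
proof (induction k arbitrary: f)
  case 0
  then show ?case using Ck_on_continuous[of "Suc 0" S f] unfolding Ck_on.simps(1) by blast
next
  case (Suc k)
  then show ?case unfolding Ck_on.simps(2) by blast
qed

lemma Ck_on_const: "open S \<Longrightarrow> Ck_on k S (\<lambda>x. c)"
proof (induction k arbitrary: c)
  case (Suc k)
  show ?case by (rule Ck_on_Suc_I[where f' = "\<lambda>x v. 0"]) (use Suc in auto)
qed simp

lemma Ck_on_add:
  "open S \<Longrightarrow> Ck_on k S f \<Longrightarrow> Ck_on k S g \<Longrightarrow> Ck_on k S (\<lambda>x. f x + g x)"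
proof (induction k arbitrary: f g)
  case (Suc k)
  show ?case
    by (rule Ck_on_Suc_I[OF Suc.prems(1) has_derivative_add[OF Ck_on_Suc_deriv[OF Suc.prems(2)]
            Ck_on_Suc_deriv[OF Suc.prems(3)]]], assumption, assumption)
      (use Suc in simp)
qed (auto intro: continuous_intros)

lemma Ck_on_sum:
  assumes "open S" "\<And>i. i \<in> I \<Longrightarrow> Ck_on k S (f i)"
  shows "Ck_on k S (\<lambda>x. \<Sum>i\<in>I. f i x)"
  using assms(2)
  by (induction I rule: infinite_finite_induct) (auto simp: Ck_on_const Ck_on_add assms(1))

lemma Ck_on_scaleR:
  "open S \<Longrightarrow> Ck_on k S f \<Longrightarrow> Ck_on k S g \<Longrightarrow> Ck_on k S (\<lambda>x. f x *\<^sub>R g x)"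
proof (induction k arbitrary: f g)
  case (Suc k)
  show ?case
  proof (rule Ck_on_Suc_I[OF Suc.prems(1) has_derivative_scaleR[OF
          Ck_on_Suc_deriv[OF Suc.prems(2)] Ck_on_Suc_deriv[OF Suc.prems(3)]]])
    fix v
    show "Ck_on k S (\<lambda>x. f x *\<^sub>R frechet_derivative g (at x) v
        + frechet_derivative f (at x) v *\<^sub>R g x)"
      using Suc.prems(2,3) by (intro Ck_on_add Suc Ck_on_Suc_D[of k S f] Ck_on_Suc_D[of k S g]) auto
  qed auto
qed (auto intro: continuous_intros)

lemma Ck_on_bounded_linear:
  assumes "bounded_linear h"
  shows "open S \<Longrightarrow> Ck_on k S f \<Longrightarrow> Ck_on k S (\<lambda>x. h (f x))"
proof (induction k arbitrary: f)
  case 0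
  then show ?case
    using bounded_linear.continuous_on[OF assms] by simp
next
  case (Suc k)
  show ?case
    by (rule Ck_on_Suc_I[OF Suc.prems(1) bounded_linear.has_derivative[OF assms
            Ck_on_Suc_deriv[OF Suc.prems(2)]]]) (use Suc in auto)
qed

lemma smooth_on_differentiable: "smooth_on S f \<Longrightarrow> x \<in> S \<Longrightarrow> f differentiable at x"
  unfolding smooth_on_def by (metis Ck_on.simps(2))

lemma smooth_on_frechet_derivative:
  "smooth_on S f \<Longrightarrow> smooth_on S (\<lambda>x. frechet_derivative f (at x) v)"
  unfolding smooth_on_def by (metis Ck_on.simps(2))

lemma smooth_on_cong:
  "open S \<Longrightarrow> smooth_on S f \<Longrightarrow> (\<And>x. x \<in> S \<Longrightarrow> f x = g x) \<Longrightarrow> smooth_on S g"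
  unfolding smooth_on_def using Ck_on_cong by blast

lemma smooth_on_const: "open S \<Longrightarrow> smooth_on S (\<lambda>x. c)"
  by (simp add: smooth_on_def Ck_on_const)

lemma smooth_on_add:
  "open S \<Longrightarrow> smooth_on S f \<Longrightarrow> smooth_on S g \<Longrightarrow> smooth_on S (\<lambda>x. f x + g x)"
  by (simp add: smooth_on_def Ck_on_add)

lemma smooth_on_scaleR:
  "open S \<Longrightarrow> smooth_on S f \<Longrightarrow> smooth_on S g \<Longrightarrow> smooth_on S (\<lambda>x. f x *\<^sub>R g x)"
  by (simp add: smooth_on_def Ck_on_scaleR)

text \<open>The recursion of \<open>Ck_on\<close> differentiates along fixed vectors only, so a
  variable direction is split into coordinates, which are smooth functions multiplying
  fixed-direction derivatives.\<close>

lemma smooth_on_directional: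
  fixes f :: "'a::euclidean_space \<Rightarrow> 'b::real_normed_vector"
  assumes "open S" "smooth_on S f" "smooth_on S \<xi>"
  shows "smooth_on S (\<lambda>x. frechet_derivative f (at x) (\<xi> x))"
proof (rule smooth_on_cong[OF assms(1)])
  show "smooth_on S (\<lambda>x. \<Sum>b\<in>Basis. (\<xi> x \<bullet> b) *\<^sub>R frechet_derivative f (at x) b)"
    using assms unfolding smooth_on_def
    by (auto intro!: Ck_on_sum Ck_on_scaleR Ck_on_bounded_linear[OF bounded_linear_inner_left]
        smooth_on_frechet_derivative[unfolded smooth_on_def, rule_format])
  fix x assume "x \<in> S"
  then have "linear (frechet_derivative f (at x))"
    using smooth_on_differentiable[OF assms(2)] linear_frechet_derivative by blast
  then have "frechet_derivative f (at x) (\<Sum>b\<in>Basis. (\<xi> x \<bullet> b) *\<^sub>R b)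
      = (\<Sum>b\<in>Basis. (\<xi> x \<bullet> b) *\<^sub>R frechet_derivative f (at x) b)"
    by (simp add: linear_sum linear_cmul)
  then show "(\<Sum>b\<in>Basis. (\<xi> x \<bullet> b) *\<^sub>R frechet_derivative f (at x) b)
      = frechet_derivative f (at x) (\<xi> x)"
    by (simp add: euclidean_representation)
qed

section \<open>Vector fields on a smooth atlas\<close>

locale smooth_manifold =
  fixes charts :: "('g::topological_space, 'e::euclidean_space) chart set"
  assumes atlas: "smooth_atlas charts"
begin

lemma chart_at: obtains c where "c \<in> charts" "p \<in> fst c"
proof -
  have "p \<in> (\<Union>(U, \<phi>)\<in>charts. U)" using atlas by (simp add: smooth_atlas_def)
  then show thesis using that by force
qed

lemma chart_open: "c \<in> charts \<Longrightarrow> open (snd c ` fst c)"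
  using atlas by (auto simp: smooth_atlas_def)

lemma smooth_fun_chart:
  "smooth_fun charts f \<Longrightarrow> c \<in> charts \<Longrightarrow> smooth_on (snd c ` fst c) (f \<circ> inv_into (fst c) (snd c))"
  by (auto simp: smooth_fun_def)

lemma smooth_fun_const: "smooth_fun charts (\<lambda>p. a)"
  using chart_open by (auto simp: smooth_fun_def o_def intro!: smooth_on_const)

lemma smooth_fun_add:
  assumes "smooth_fun charts f" "smooth_fun charts h"
  shows "smooth_fun charts (\<lambda>p. f p + h p)"
  unfolding smooth_fun_def
proof clarify
  fix U \<phi> assume c: "(U, \<phi>) \<in> charts"
  show "smooth_on (\<phi> ` U) ((\<lambda>p. f p + h p) \<circ> inv_into U \<phi>)"
    using smooth_on_add[OF chart_open[OF c] smooth_fun_chart[OF assms(1) c]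
        smooth_fun_chart[OF assms(2) c]] by (simp add: o_def)
qed

lemma smooth_fun_mult:
  assumes "smooth_fun charts f" "smooth_fun charts h"
  shows "smooth_fun charts (\<lambda>p. f p * h p)"
  unfolding smooth_fun_def
proof clarify
  fix U \<phi> assume c: "(U, \<phi>) \<in> charts"
  show "smooth_on (\<phi> ` U) ((\<lambda>p. f p * h p) \<circ> inv_into U \<phi>)"
    using smooth_on_scaleR[OF chart_open[OF c] smooth_fun_chart[OF assms(1) c]
        smooth_fun_chart[OF assms(2) c]] by (simp add: o_def)
qed

lemma coord_tangent_linear:
  assumes "c \<in> charts" "p \<in> fst c"
  shows "coord_tangent charts c p (a *\<^sub>R v + b *\<^sub>R w)
    = (\<lambda>f. a * coord_tangent charts c p v f + b * coord_tangent charts c p w f)"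
proof
  fix f
  show "coord_tangent charts c p (a *\<^sub>R v + b *\<^sub>R w) f
    = a * coord_tangent charts c p v f + b * coord_tangent charts c p w f"
  proof (cases "smooth_fun charts f")
    case True
    have "f \<circ> inv_into (fst c) (snd c) differentiable at (snd c p)"
      using smooth_on_differentiable[OF smooth_fun_chart[OF True assms(1)]] assms(2) by blast
    then have "linear (frechet_derivative (f \<circ> inv_into (fst c) (snd c)) (at (snd c p)))"
      by (rule linear_frechet_derivative)
    then show ?thesis using True by (simp add: coord_tangent_def linear_add linear_cmul)
  qed (simp add: coord_tangent_def)
qed

lemma vector_field_chart:
  assumes "X \<in> vector_fields charts" "c \<in> charts"
  obtains \<xi> where "smooth_on (snd c ` fst c) \<xi>"
    "\<And>p. p \<in> fst c \<Longrightarrow> X p = coord_tangent charts c p (\<xi> (snd c p))"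
  using assms by (auto simp: vector_fields_def)

text \<open>Every point lies in a chart, so the local coordinate expressions already place each
  \<open>X p\<close> in the tangent space.\<close>

lemma vector_field_I:
  assumes "\<And>c. c \<in> charts \<Longrightarrow> \<exists>\<xi>. smooth_on (snd c ` fst c) \<xi> \<and>
        (\<forall>p\<in>fst c. X p = coord_tangent charts c p (\<xi> (snd c p)))"
  shows "X \<in> vector_fields charts"
proof -
  have "X p \<in> tangent_space charts p" for p
  proof -
    obtain c where c: "c \<in> charts" "p \<in> fst c" by (rule chart_at)
    with assms obtain w where "X p = coord_tangent charts c p w" by blast
    then show ?thesis using c unfolding tangent_space_def by blast
  qed
  then show ?thesis using assms by (auto simp: vector_fields_def)
qed

lemma vector_field_tangent: "X \<in> vector_fields charts \<Longrightarrow> X p \<in> tangent_space charts p"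
  by (simp add: vector_fields_def)

lemma vector_field_add:
  assumes "X \<in> vector_fields charts" "Y \<in> vector_fields charts"
  shows "X + Y \<in> vector_fields charts"
proof (rule vector_field_I)
  fix c assume c: "c \<in> charts"
  obtain \<xi> where \<xi>: "smooth_on (snd c ` fst c) \<xi>"
    "\<And>p. p \<in> fst c \<Longrightarrow> X p = coord_tangent charts c p (\<xi> (snd c p))"
    using vector_field_chart[OF assms(1) c] by blast
  obtain \<eta> where \<eta>: "smooth_on (snd c ` fst c) \<eta>"
    "\<And>p. p \<in> fst c \<Longrightarrow> Y p = coord_tangent charts c p (\<eta> (snd c p))"
    using vector_field_chart[OF assms(2) c] by blast
  have "smooth_on (snd c ` fst c) (\<lambda>x. \<xi> x + \<eta> x)"
    using \<xi>(1) \<eta>(1) chart_open[OF c] by (simp add: smooth_on_add)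
  moreover have "(X + Y) p = coord_tangent charts c p (\<xi> (snd c p) + \<eta> (snd c p))"
    if "p \<in> fst c" for p
    using coord_tangent_linear[OF c that, of 1 _ 1] \<xi>(2)[OF that] \<eta>(2)[OF that]
    by (simp add: plus_fun_def)
  ultimately show "\<exists>\<xi>. smooth_on (snd c ` fst c) \<xi> \<and>
        (\<forall>p\<in>fst c. (X + Y) p = coord_tangent charts c p (\<xi> (snd c p)))"
    by blast
qed

lemma vector_field_scale:
  assumes "X \<in> vector_fields charts" "smooth_fun charts h"
  shows "vf_scale h X \<in> vector_fields charts"
proof (rule vector_field_I)
  fix c assume c: "c \<in> charts"
  obtain \<xi> where \<xi>: "smooth_on (snd c ` fst c) \<xi>"
    "\<And>p. p \<in> fst c \<Longrightarrow> X p = coord_tangent charts c p (\<xi> (snd c p))"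
    using vector_field_chart[OF assms(1) c] by blast
  define k where "k = h \<circ> inv_into (fst c) (snd c)"
  have inj: "inv_into (fst c) (snd c) (snd c p) = p" if "p \<in> fst c" for p
    using atlas c that by (force simp: smooth_atlas_def homeomorphism_def)
  have "smooth_on (snd c ` fst c) (\<lambda>x. k x *\<^sub>R \<xi> x)"
    using smooth_on_scaleR[OF chart_open[OF c] smooth_fun_chart[OF assms(2) c] \<xi>(1)]
    by (simp add: k_def)
  moreover have "vf_scale h X p = coord_tangent charts c p (k (snd c p) *\<^sub>R \<xi> (snd c p))"
    if "p \<in> fst c" for p
    using coord_tangent_linear[OF c that, of "k (snd c p)" "\<xi> (snd c p)" 0 0] \<xi>(2)[OF that]
      inj[OF that]
    by (simp add: vf_scale_def k_def)
  ultimately show "\<exists>\<xi>. smooth_on (snd c ` fst c) \<xi> \<and>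
        (\<forall>p\<in>fst c. vf_scale h X p = coord_tangent charts c p (\<xi> (snd c p)))"
    by (intro exI[of _ "\<lambda>x. k x *\<^sub>R \<xi> x"]) simp
qed

lemma vector_field_diff:
  assumes "X \<in> vector_fields charts" "Y \<in> vector_fields charts"
  shows "X - Y \<in> vector_fields charts"
proof -
  have "X - Y = X + vf_scale (\<lambda>_. -1) Y" by (simp add: fun_eq_iff vf_scale_def)
  then show ?thesis
    using vector_field_add[OF assms(1) vector_field_scale[OF assms(2) smooth_fun_const]] by metis
qed

lemma vector_field_zero: "0 \<in> vector_fields charts"
proof (rule vector_field_I)
  fix c assume c: "c \<in> charts"
  have "(0 :: 'g vfield) p = coord_tangent charts c p 0" if "p \<in> fst c" for p
    using coord_tangent_linear[OF c that, of 0 0 0 0] by (simp add: zero_fun_def)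
  then show "\<exists>\<xi>. smooth_on (snd c ` fst c) \<xi> \<and>
        (\<forall>p\<in>fst c. (0 :: 'g vfield) p = coord_tangent charts c p (\<xi> (snd c p)))"
    using smooth_on_const[OF chart_open[OF c]] by (intro exI[of _ "\<lambda>_. 0"]) simp
qed

lemma vector_field_sum:
  "(\<And>i. i \<in> I \<Longrightarrow> X i \<in> vector_fields charts) \<Longrightarrow> (\<Sum>i\<in>I. X i) \<in> vector_fields charts"
  by (induction I rule: infinite_finite_induct)
    (auto simp: vector_field_add vector_field_zero)

lemma smooth_vf_apply:
  assumes "X \<in> vector_fields charts" "smooth_fun charts f"
  shows "smooth_fun charts (vf_apply X f)"
  unfolding smooth_fun_def
proof clarify
  fix U \<phi> assume c: "(U, \<phi>) \<in> charts"
  obtain \<xi> where \<xi>: "smooth_on (\<phi> ` U) \<xi>"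
    "\<And>p. p \<in> U \<Longrightarrow> X p = coord_tangent charts (U, \<phi>) p (\<xi> (\<phi> p))"
    using vector_field_chart[OF assms(1) c] by auto
  have "smooth_on (\<phi> ` U) (\<lambda>x. frechet_derivative (f \<circ> inv_into U \<phi>) (at x) (\<xi> x))"
    using smooth_on_directional[OF chart_open[OF c]] \<xi>(1) smooth_fun_chart[OF assms(2) c] by simp
  then show "smooth_on (\<phi> ` U) (vf_apply X f \<circ> inv_into U \<phi>)"
  proof (rule smooth_on_cong[OF chart_open[OF c, simplified]])
    fix x assume x: "x \<in> \<phi> ` U"
    then have "inv_into U \<phi> x \<in> U" "\<phi> (inv_into U \<phi> x) = x"
      by (auto simp: inv_into_into f_inv_into_f)
    then show "frechet_derivative (f \<circ> inv_into U \<phi>) (at x) (\<xi> x)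
        = (vf_apply X f \<circ> inv_into U \<phi>) x"
      using \<xi>(2) assms(2) by (simp add: vf_apply_def coord_tangent_def)
  qed
qed

lemma vf_apply_const:
  assumes "X \<in> vector_fields charts"
  shows "vf_apply X (\<lambda>_. a) = (\<lambda>_. 0)"
proof
  fix p
  obtain c where c: "c \<in> charts" "p \<in> fst c" by (rule chart_at)
  obtain \<xi> where "X p = coord_tangent charts c p (\<xi> (snd c p))"
    using vector_field_chart[OF assms c(1)] c(2) by metis
  then show "vf_apply X (\<lambda>_. a) p = 0"
    by (simp add: vf_apply_def coord_tangent_def o_def frechet_derivative_const)
qed

end

lemma vfield_sum_apply: "(\<Sum>i\<in>I. X i) p f = (\<Sum>i\<in>I. X i p f)"
  for X :: "'i \<Rightarrow> 'g vfield"
  by (induction I rule: infinite_finite_induct) auto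

lemma vf_scale_zero [simp]: "vf_scale h 0 = 0"
  by (simp add: vf_scale_def zero_fun_def)

section \<open>Tensoriality of the curvature and of its covariant derivative\<close>

locale levi_civita_manifold = smooth_manifold charts
  for charts :: "('g::topological_space, 'e::euclidean_space) chart set" +
  fixes g :: "'g metric" and D :: "'g vfield \<Rightarrow> 'g vfield \<Rightarrow> 'g vfield"
  assumes metric: "riemannian_metric charts g" and levi_civita: "levi_civita charts g D"
begin

abbreviation VF where "VF \<equiv> vector_fields charts"

lemma D_in: "X \<in> VF \<Longrightarrow> Y \<in> VF \<Longrightarrow> D X Y \<in> VF"
  and bracket_eq: "X \<in> VF \<Longrightarrow> Y \<in> VF \<Longrightarrow> vf_bracket X Y = D X Y - D Y X"
  using levi_civita by (simp_all add: levi_civita_def)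

lemma D_scale_left:
  "X \<in> VF \<Longrightarrow> Y \<in> VF \<Longrightarrow> smooth_fun charts h \<Longrightarrow> D (vf_scale h X) Y = vf_scale h (D X Y)"
  and D_scale_right:
  "X \<in> VF \<Longrightarrow> Y \<in> VF \<Longrightarrow> smooth_fun charts h \<Longrightarrow>
    D X (vf_scale h Y) = vf_scale (vf_apply X h) Y + vf_scale h (D X Y)"
  and D_add_left: "X \<in> VF \<Longrightarrow> Y \<in> VF \<Longrightarrow> Z \<in> VF \<Longrightarrow> D (X + Y) Z = D X Z + D Y Z"
  and D_add_right: "X \<in> VF \<Longrightarrow> Y \<in> VF \<Longrightarrow> Z \<in> VF \<Longrightarrow> D X (Y + Z) = D X Y + D X Z"
  and metric_compatible: "X \<in> VF \<Longrightarrow> Y \<in> VF \<Longrightarrow> Z \<in> VF \<Longrightarrow>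
    vf_apply X (metric_apply g Y Z) = metric_apply g (D X Y) Z + metric_apply g Y (D X Z)"
  using levi_civita unfolding levi_civita_def by blast+

lemma D_diff_left:
  assumes "X \<in> VF" "Y \<in> VF" "Z \<in> VF"
  shows "D (X - Y) Z = D X Z - D Y Z"
  using D_add_left[OF vector_field_diff[OF assms(1,2)] assms(2,3)] by (simp add: algebra_simps)

lemma D_const_right:
  "X \<in> VF \<Longrightarrow> Y \<in> VF \<Longrightarrow> D X (vf_scale (\<lambda>_. a) Y) = vf_scale (\<lambda>_. a) (D X Y)"
  by (simp add: D_scale_right smooth_fun_const vf_apply_const) (simp add: vf_scale_def fun_eq_iff)

lemmas vf_intros = D_in vector_field_add vector_field_diff vector_field_scale smooth_vf_apply
  smooth_fun_const

text \<open>Torsion-freeness writes the bracket through \<open>D\<close>, which maps vector fields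
  to vector fields; this replaces a computation with second derivatives in coordinates.\<close>

lemma bracket_in: "X \<in> VF \<Longrightarrow> Y \<in> VF \<Longrightarrow> vf_bracket X Y \<in> VF"
  by (simp add: bracket_eq vf_intros)

abbreviation C where "C \<equiv> curvature D"

lemma curvature_in: "X \<in> VF \<Longrightarrow> Y \<in> VF \<Longrightarrow> Z \<in> VF \<Longrightarrow> C X Y Z \<in> VF"
  by (simp add: curvature_def vf_intros bracket_in)

lemma curvature_antisym: "X \<in> VF \<Longrightarrow> Y \<in> VF \<Longrightarrow> Z \<in> VF \<Longrightarrow> C Y X Z = - C X Y Z"
  by (simp add: curvature_def bracket_eq D_in D_diff_left)

lemma curvature_add1:
  "X \<in> VF \<Longrightarrow> X' \<in> VF \<Longrightarrow> Y \<in> VF \<Longrightarrow> Z \<in> VF \<Longrightarrow> C (X + X') Y Z = C X Y Z + C X' Y Z"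
  by (simp add: curvature_def bracket_eq vf_intros D_add_left D_add_right D_diff_left)

lemma curvature_add2:
  assumes "X \<in> VF" "Y \<in> VF" "Y' \<in> VF" "Z \<in> VF"
  shows "C X (Y + Y') Z = C X Y Z + C X Y' Z"
  using curvature_add1[of Y Y' X Z] curvature_antisym[of "Y + Y'" X Z]
    curvature_antisym[of Y X Z] curvature_antisym[of Y' X Z] assms
  by (simp add: vf_intros)

lemma curvature_add3:
  "X \<in> VF \<Longrightarrow> Y \<in> VF \<Longrightarrow> Z \<in> VF \<Longrightarrow> Z' \<in> VF \<Longrightarrow> C X Y (Z + Z') = C X Y Z + C X Y Z'"
  by (simp add: curvature_def bracket_in vf_intros D_add_right)

lemma curvature_scale1:
  assumes "X \<in> VF" "Y \<in> VF" "Z \<in> VF" "smooth_fun charts h"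
  shows "C (vf_scale h X) Y Z = vf_scale h (C X Y Z)"
proof -
  have "vf_bracket (vf_scale h X) Y = vf_scale h (vf_bracket X Y) - vf_scale (vf_apply Y h) X"
    using assms by (simp add: bracket_eq vf_intros D_scale_left D_scale_right)
      (simp add: fun_eq_iff vf_scale_def algebra_simps)
  then show ?thesis
    using assms
    by (simp add: curvature_def vf_intros bracket_in D_diff_left D_scale_left D_scale_right)
      (simp add: fun_eq_iff vf_scale_def algebra_simps)
qed

lemma curvature_scale2:
  assumes "X \<in> VF" "Y \<in> VF" "Z \<in> VF" "smooth_fun charts h"
  shows "C X (vf_scale h Y) Z = vf_scale h (C X Y Z)"
  using curvature_scale1[of Y X Z h] curvature_antisym[of "vf_scale h Y" X Z]
    curvature_antisym[of Y X Z] assms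
  by (simp add: vf_intros) (simp add: fun_eq_iff vf_scale_def)

lemma curvature_scale3:
  assumes "X \<in> VF" "Y \<in> VF" "Z \<in> VF" "smooth_fun charts h"
  shows "C X Y (vf_scale h Z) = vf_scale h (C X Y Z)"
proof -
  \<comment> \<open>The second derivatives of \<open>h\<close> coming from the two iterated
    \<open>D\<close> terms form exactly this commutator, which the bracket term cancels.\<close>
  have "vf_apply (vf_bracket X Y) h = (\<lambda>p. vf_apply X (vf_apply Y h) p - vf_apply Y (vf_apply X h) p)"
    by (simp add: vf_bracket_def vf_apply_def)
  then show ?thesis
    using assms
    by (simp add: curvature_def vf_intros bracket_in D_scale_right D_add_right)
      (simp add: fun_eq_iff vf_scale_def algebra_simps)
qed

text \<open>The expression inside \<open>locally_symmetric\<close>, named so that its linearity over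
  smooth functions in all four slots can be stated.\<close>

definition nabla_curvature where
  "nabla_curvature X Y Z U = D X (C Y Z U) - C (D X Y) Z U - C Y (D X Z) U - C Y Z (D X U)"

lemmas curvature_linear = curvature_add1 curvature_add2 curvature_add3
  curvature_scale1 curvature_scale2 curvature_scale3

lemma nabla_curvature_add:
  assumes "X \<in> VF" "Y \<in> VF" "Z \<in> VF" "U \<in> VF" "V \<in> VF"
  shows "nabla_curvature (X + V) Y Z U = nabla_curvature X Y Z U + nabla_curvature V Y Z U"
    and "nabla_curvature X (Y + V) Z U = nabla_curvature X Y Z U + nabla_curvature X V Z U"
    and "nabla_curvature X Y (Z + V) U = nabla_curvature X Y Z U + nabla_curvature X Y V U"
    and "nabla_curvature X Y Z (U + V) = nabla_curvature X Y Z U + nabla_curvature X Y Z V"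
  using assms by (simp_all add: nabla_curvature_def vf_intros curvature_in curvature_linear
      D_add_left D_add_right)

text \<open>In the last three slots the derivative of \<open>h\<close> arises twice with opposite
  signs: from \<open>D X\<close> of the scaled curvature and from \<open>D X\<close> of the scaled
  argument.\<close>

lemma nabla_curvature_scale:
  assumes "X \<in> VF" "Y \<in> VF" "Z \<in> VF" "U \<in> VF" "smooth_fun charts h"
  shows "nabla_curvature (vf_scale h X) Y Z U = vf_scale h (nabla_curvature X Y Z U)"
    and "nabla_curvature X (vf_scale h Y) Z U = vf_scale h (nabla_curvature X Y Z U)"
    and "nabla_curvature X Y (vf_scale h Z) U = vf_scale h (nabla_curvature X Y Z U)"
    and "nabla_curvature X Y Z (vf_scale h U) = vf_scale h (nabla_curvature X Y Z U)"
  using assms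
  by (simp_all add: nabla_curvature_def vf_intros curvature_in curvature_linear
      D_scale_left D_scale_right)
    (simp_all add: fun_eq_iff vf_scale_def algebra_simps)

end

section \<open>Global orthonormal frames\<close>

locale orthonormal_frame = levi_civita_manifold charts g D
  for charts :: "('g::topological_space, 'e::euclidean_space) chart set" and g D +
  fixes E :: "nat \<Rightarrow> 'g vfield"
  assumes frame_in: "i < DIM('e) \<Longrightarrow> E i \<in> vector_fields charts"
    and frame_orthonormal: "i < DIM('e) \<Longrightarrow> j < DIM('e) \<Longrightarrow>
      metric_apply g (E i) (E j) p = (if i = j then 1 else 0)"
begin

lemma smooth_metric_apply: "X \<in> VF \<Longrightarrow> Y \<in> VF \<Longrightarrow> smooth_fun charts (metric_apply g X Y)"
  using metric by (simp add: riemannian_metric_def)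

lemma metric_tangent_sym:
  "u \<in> tangent_space charts p \<Longrightarrow> v \<in> tangent_space charts p \<Longrightarrow> g p u v = g p v u"
  using metric unfolding riemannian_metric_def by blast

lemma metric_tangent_linear:
  "u \<in> tangent_space charts p \<Longrightarrow> v \<in> tangent_space charts p \<Longrightarrow> w \<in> tangent_space charts p \<Longrightarrow>
   g p (\<lambda>f. a * u f + b * v f) w = a * g p u w + b * g p v w"
  using metric unfolding riemannian_metric_def by blast

lemma metric_apply_sym: "X \<in> VF \<Longrightarrow> Y \<in> VF \<Longrightarrow> metric_apply g X Y = metric_apply g Y X"
  by (simp add: metric_apply_def fun_eq_iff metric_tangent_sym vector_field_tangent)

lemma metric_apply_add:
  assumes "X \<in> VF" "Y \<in> VF" "Z \<in> VF"
  shows "metric_apply g (X + Y) Z = (\<lambda>p. metric_apply g X Z p + metric_apply g Y Z p)"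
  using metric_tangent_linear[of "X p" p "Y p" "Z p" 1 1 for p] assms
  by (simp add: metric_apply_def vector_field_tangent plus_fun_def)

lemma metric_apply_scale:
  assumes "X \<in> VF" "Z \<in> VF"
  shows "metric_apply g (vf_scale h X) Z = (\<lambda>p. h p * metric_apply g X Z p)"
  using metric_tangent_linear[of "X p" p "X p" "Z p" "h p" 0 for p] assms
  by (simp add: metric_apply_def vector_field_tangent vf_scale_def)

lemma metric_apply_sum:
  assumes "\<And>i. i \<in> I \<Longrightarrow> X i \<in> VF" "Z \<in> VF"
  shows "metric_apply g (\<Sum>i\<in>I. X i) Z = (\<lambda>p. \<Sum>i\<in>I. metric_apply g (X i) Z p)"
proof -
  have "metric_apply g 0 Z = (\<lambda>p. 0)"
    using metric_apply_scale[OF vector_field_zero assms(2), of "\<lambda>_. 0"]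
    by (simp add: vf_scale_def zero_fun_def)
  then show ?thesis
    using assms by (induction I rule: infinite_finite_induct)
      (auto simp: metric_apply_add vector_field_sum)
qed

text \<open>The dimension count is made in the model space: a chart at \<open>p\<close> pulls the
  metric back to a form \<open>G\<close> on \<open>'e\<close>, for which the coordinate vectors of
  the frame are orthonormal. They are therefore independent, and being \<open>DIM('e)\<close> many
  they span.\<close>

lemma frame_expansion:
  assumes "X \<in> VF"
  shows "X = (\<Sum>i<DIM('e). vf_scale (metric_apply g X (E i)) (E i))"
proof (rule ext)
  fix p
  let ?n = "DIM('e)"
  obtain c where c: "c \<in> charts" "p \<in> fst c" by (rule chart_at)
  define T where "T = coord_tangent charts c p"
  have T_in: "T v \<in> tangent_space charts p" for v
    using c unfolding T_def tangent_space_def by blast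
  have T_lin: "T (a *\<^sub>R v + b *\<^sub>R w) = (\<lambda>f. a * T v f + b * T w f)" for a b v w
    unfolding T_def by (rule coord_tangent_linear[OF c])
  define G where "G v w = g p (T v) (T w)" for v w
  have G_lin: "G (a *\<^sub>R v + b *\<^sub>R w) z = a * G v z + b * G w z" for a b v w z
    by (simp add: G_def T_lin metric_tangent_linear T_in)
  have G_sum: "G (\<Sum>i\<in>I. a i *\<^sub>R w i) z = (\<Sum>i\<in>I. a i * G (w i) z)"
    for I and a :: "nat \<Rightarrow> real" and w z
  proof (induction I rule: infinite_finite_induct)
    case (insert i I)
    then show ?case using G_lin[of "a i" "w i" 1] by simp
  qed (use G_lin[of 0 0 0 0 z] in simp_all)
  have T_sum: "T (\<Sum>i\<in>I. a i *\<^sub>R w i) f = (\<Sum>i\<in>I. a i * T (w i) f)"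
    for I and a :: "nat \<Rightarrow> real" and w f
  proof (induction I rule: infinite_finite_induct)
    case (insert i I)
    then show ?case using T_lin[of "a i" "w i" 1] by simp
  qed (use T_lin[of 0 0 0 0] in simp_all)
  have "\<exists>v. Y p = T v" if "Y \<in> VF" for Y
    using vector_field_chart[OF that c(1)] c(2) by (metis T_def)
  then obtain v where v: "X p = T v" using assms by blast
  have "\<exists>w. \<forall>i<?n. E i p = T (w i)"
    using \<open>\<And>Y. Y \<in> VF \<Longrightarrow> \<exists>v. Y p = T v\<close> frame_in by (intro choice_iff'[THEN iffD1]) blast
  then obtain w where w: "\<And>i. i < ?n \<Longrightarrow> E i p = T (w i)" by blast
  have on: "G (w i) (w j) = (if i = j then 1 else 0)" if "i < ?n" "j < ?n" for i j
    using frame_orthonormal[OF that, of p] w that by (simp add: metric_apply_def G_def)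
  have coeff: "G (\<Sum>i<?n. a i *\<^sub>R w i) (w j) = a j" if "j < ?n" for a j
  proof -
    have "G (\<Sum>i<?n. a i *\<^sub>R w i) (w j) = (\<Sum>i<?n. if i = j then a i else 0)"
      unfolding G_sum by (rule sum.cong) (use on that in auto)
    then show ?thesis using that by simp
  qed
  have inj: "inj_on w {..<?n}"
  proof (rule inj_onI)
    fix i j assume "i \<in> {..<?n}" "j \<in> {..<?n}" "w i = w j"
    then show "i = j" using on[of i i] on[of i j] by (auto split: if_splits)
  qed
  have "independent (w ` {..<?n})"
    unfolding real_vector.independent_explicit_finite_subsets
  proof clarify
    fix A u y assume A: "A \<subseteq> w ` {..<?n}" "(\<Sum>y\<in>A. u y *\<^sub>R y) = 0" "y \<in> A"
    then obtain j where j: "j < ?n" "y = w j" by auto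
    have "(\<Sum>i<?n. (if w i \<in> A then u (w i) else 0) *\<^sub>R w i)
        = (\<Sum>y\<in>w ` {..<?n}. (if y \<in> A then u y else 0) *\<^sub>R y)"
      by (simp add: sum.reindex[OF inj])
    also have "\<dots> = (\<Sum>y\<in>A. u y *\<^sub>R y)"
      by (rule sum.mono_neutral_cong_right) (use A(1) in auto)
    finally have "(if w j \<in> A then u (w j) else 0) = G 0 (w j)"
      using coeff[OF j(1), of "\<lambda>i. if w i \<in> A then u (w i) else 0"] A(2) by simp
    then show "u y = 0" using A(3) j(2) G_lin[of 0 0 0 0 "w j"] by simp
  qed
  then have "UNIV \<subseteq> span (w ` {..<?n})"
    by (intro card_ge_dim_independent) (auto simp: card_image[OF inj])
  then have "v \<in> span (w ` {..<?n})" by blast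
  then obtain u where "v = (\<Sum>y\<in>w ` {..<?n}. u y *\<^sub>R y)"
    unfolding span_finite[OF finite_imageI[OF finite_lessThan]] by blast
  then have v': "v = (\<Sum>i<?n. u (w i) *\<^sub>R w i)"
    by (simp add: sum.reindex[OF inj])
  have a: "metric_apply g X (E i) p = u (w i)" if "i < ?n" for i
    using coeff[OF that, of "\<lambda>i. u (w i)"] v v' w[OF that] by (simp add: metric_apply_def G_def)
  show "X p = (\<Sum>i<?n. vf_scale (metric_apply g X (E i)) (E i)) p"
  proof
    fix f
    show "X p f = (\<Sum>i<?n. vf_scale (metric_apply g X (E i)) (E i)) p f"
      unfolding vfield_sum_apply v v' T_sum vf_scale_def
      by (rule sum.cong) (use a w v v' in auto)
  qed
qed

text \<open>The coefficients of the frame expansion are smooth functions, not constants, so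
  \<open>P\<close> must be stable under function multiples; this is where tensoriality
  enters.\<close>

lemma frame_induct:
  assumes "X \<in> VF"
    and base: "\<And>i. i < DIM('e) \<Longrightarrow> P (E i)"
    and add: "\<And>X Y. X \<in> VF \<Longrightarrow> Y \<in> VF \<Longrightarrow> P X \<Longrightarrow> P Y \<Longrightarrow> P (X + Y)"
    and scale: "\<And>X h. X \<in> VF \<Longrightarrow> smooth_fun charts h \<Longrightarrow> P X \<Longrightarrow> P (vf_scale h X)"
  shows "P X"
proof -
  \<comment> \<open>A Euclidean space has positive dimension, so \<open>E 0\<close> is a frame field
    and its zero multiple gives \<open>P 0\<close>.\<close>
  have "P (vf_scale (\<lambda>_. 0) (E 0))"
    by (intro scale base frame_in smooth_fun_const) auto
  then have P0: "P 0" by (simp add: vf_scale_def zero_fun_def)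
  have "P (\<Sum>i\<in>I. vf_scale (metric_apply g X (E i)) (E i))"
    if "I \<subseteq> {..<DIM('e)}" for I
    using finite_subset[OF that finite_lessThan] that
  proof (induction I rule: finite_induct)
    case (insert i I)
    then show ?case
      using assms(1) by (auto intro!: add scale base vector_field_scale vector_field_sum
          frame_in smooth_metric_apply simp del: plus_fun_apply)
  qed (simp add: P0)
  then show ?thesis using frame_expansion[OF assms(1)] by (metis order_refl)
qed

lemma locally_symmetric_frame:
  assumes "\<And>i j k l. i < DIM('e) \<Longrightarrow> j < DIM('e) \<Longrightarrow> k < DIM('e) \<Longrightarrow> l < DIM('e) \<Longrightarrow>
    nabla_curvature (E i) (E j) (E k) (E l) = 0"
  shows "locally_symmetric charts D"
proof -
  have 1: "nabla_curvature X (E j) (E k) (E l) = 0"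
    if "X \<in> VF" "j < DIM('e)" "k < DIM('e)" "l < DIM('e)" for X j k l
    using that(1) by (rule frame_induct)
      (use that assms frame_in in \<open>simp_all add: nabla_curvature_add nabla_curvature_scale
        del: plus_fun_apply zero_fun_apply\<close>)
  have 2: "nabla_curvature X Y (E k) (E l) = 0"
    if "X \<in> VF" "Y \<in> VF" "k < DIM('e)" "l < DIM('e)" for X Y k l
    using that(2) by (rule frame_induct)
      (use that 1 frame_in in \<open>simp_all add: nabla_curvature_add nabla_curvature_scale
        del: plus_fun_apply zero_fun_apply\<close>)
  have 3: "nabla_curvature X Y Z (E l) = 0"
    if "X \<in> VF" "Y \<in> VF" "Z \<in> VF" "l < DIM('e)" for X Y Z l
    using that(3) by (rule frame_induct)
      (use that 2 frame_in in \<open>simp_all add: nabla_curvature_add nabla_curvature_scale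
        del: plus_fun_apply zero_fun_apply\<close>)
  have "nabla_curvature X Y Z U = 0"
    if "X \<in> VF" "Y \<in> VF" "Z \<in> VF" "U \<in> VF" for X Y Z U
    using that(4) by (rule frame_induct)
      (use that 3 frame_in in \<open>simp_all add: nabla_curvature_add nabla_curvature_scale
        del: plus_fun_apply zero_fun_apply\<close>)
  then show ?thesis by (simp add: locally_symmetric_def nabla_curvature_def)
qed

end

section \<open>Left invariant connections as bilinear maps\<close>

definition orthonormal_family :: "nat \<Rightarrow> (nat \<Rightarrow> 'e::euclidean_space) \<Rightarrow> bool" where
  "orthonormal_family n u \<longleftrightarrow> (\<forall>i<n. \<forall>j<n. u i \<bullet> u j = (if i = j then 1 else 0))"

lemma orthonormal_expansion:
  fixes u :: "nat \<Rightarrow> 'e::euclidean_space"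
  assumes "orthonormal_family DIM('e) u"
  shows "x = (\<Sum>i<DIM('e). (x \<bullet> u i) *\<^sub>R u i)"
proof -
  let ?I = "{..<DIM('e)}"
  have on: "u i \<bullet> u j = (if i = j then 1 else 0)" if "i \<in> ?I" "j \<in> ?I" for i j
    using assms that by (simp add: orthonormal_family_def)
  have inj: "inj_on u ?I" by (rule inj_onI) (metis on zero_neq_one)
  have "pairwise orthogonal (u ` ?I)" "0 \<notin> u ` ?I"
    using on by (fastforce simp: pairwise_def orthogonal_def)+
  then have "independent (u ` ?I)" by (rule pairwise_orthogonal_independent)
  then have span: "UNIV \<subseteq> span (u ` ?I)"
    by (intro card_ge_dim_independent) (auto simp: card_image[OF inj])
  define y where "y = x - (\<Sum>i\<in>?I. (x \<bullet> u i) *\<^sub>R u i)"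
  have "y \<bullet> u j = 0" if "j \<in> ?I" for j
  proof -
    have "(\<Sum>i\<in>?I. (x \<bullet> u i) * (u i \<bullet> u j)) = (\<Sum>i\<in>?I. if i = j then x \<bullet> u i else 0)"
      by (rule sum.cong) (use on that in auto)
    then show ?thesis using that by (simp add: y_def inner_diff_left inner_sum_left)
  qed
  then have "orthogonal y y"
    by (intro orthogonal_to_span[of y "u ` ?I"]) (use span in \<open>auto simp: orthogonal_def\<close>)
  then show ?thesis by (simp add: y_def orthogonal_self)
qed

text \<open>Permits evaluating \<open>ric\<close>, which is a sum over \<open>Basis\<close>, in a
  basis adapted to the Lie algebra.\<close>

lemma trace_orthonormal:
  fixes f :: "'e::euclidean_space \<Rightarrow> 'e \<Rightarrow> real"
  assumes f: "bilinear f" and u: "orthonormal_family DIM('e) u"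
  shows "(\<Sum>b\<in>Basis. f b b) = (\<Sum>i<DIM('e). f (u i) (u i))"
proof -
  let ?I = "{..<DIM('e)}"
  have "f b b = (\<Sum>i\<in>?I. \<Sum>j\<in>?I. (b \<bullet> u i) * (b \<bullet> u j) * f (u i) (u j))" for b
    by (subst (1 2) orthonormal_expansion[OF u, of b])
      (simp add: bilinear_sum[OF f] sum.cartesian_product bilinear_lmul[OF f] bilinear_rmul[OF f]
        mult.assoc mult.left_commute)
  then have "(\<Sum>b\<in>Basis. f b b)
      = (\<Sum>b\<in>Basis. \<Sum>i\<in>?I. \<Sum>j\<in>?I. (u i \<bullet> b) * (u j \<bullet> b) * f (u i) (u j))"
    by (simp add: inner_commute)
  also have "\<dots> = (\<Sum>i\<in>?I. \<Sum>j\<in>?I. \<Sum>b\<in>Basis. (u i \<bullet> b) * (u j \<bullet> b) * f (u i) (u j))"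
    by (subst sum.swap, rule sum.cong[OF refl], subst sum.swap) (rule refl)
  also have "\<dots> = (\<Sum>i\<in>?I. \<Sum>j\<in>?I. (u i \<bullet> u j) * f (u i) (u j))"
    by (simp add: euclidean_inner[of "u i" "u j" for i j] sum_distrib_right)
  also have "\<dots> = (\<Sum>i\<in>?I. \<Sum>j\<in>?I. if i = j then f (u i) (u j) else 0)"
    using u by (intro sum.cong) (auto simp: orthonormal_family_def)
  finally show ?thesis by simp
qed

text \<open>A trace is invariant under the infinitesimal rotation \<open>A\<close>. With
  \<open>A = nab w\<close> this says that a metric connection commutes with contraction.\<close>

lemma trace_skew:
  fixes f :: "'e::euclidean_space \<Rightarrow> 'e \<Rightarrow> real"
  assumes f: "bilinear f" and A: "\<And>x y. A x \<bullet> y = - (x \<bullet> A y)"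
  shows "(\<Sum>b\<in>Basis. f (A b) b + f b (A b)) = 0"
proof -
  have expand: "A b = (\<Sum>c\<in>Basis. (A b \<bullet> c) *\<^sub>R c)" for b
    by (simp add: euclidean_representation)
  have 1: "f (A b) b = (\<Sum>c\<in>Basis. (A b \<bullet> c) * f c b)" for b
  proof -
    have lin: "linear (\<lambda>x. f x b)" using f by (simp add: bilinear_def)
    show ?thesis
      by (subst expand) (simp add: linear_sum[OF lin] linear_cmul[OF lin])
  qed
  have 2: "f b (A b) = (\<Sum>c\<in>Basis. (A b \<bullet> c) * f b c)" for b
    by (subst expand)
      (use f in \<open>simp add: bilinear_def linear_sum linear_cmul\<close>)
  have "(\<Sum>b\<in>Basis. f b (A b)) = (\<Sum>c\<in>Basis. \<Sum>b\<in>Basis. (A b \<bullet> c) * f b c)"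
    unfolding 2 by (rule sum.swap)
  also have "\<dots> = (\<Sum>c\<in>Basis. \<Sum>b\<in>Basis. - ((A c \<bullet> b) * f b c))"
    by (intro sum.cong refl) (metis A inner_commute minus_mult_left)
  finally show ?thesis by (simp add: sum.distrib 1 sum_negf)
qed

lemma sum_Basis_inner:
  fixes f :: "'e::euclidean_space \<Rightarrow> real"
  assumes "linear f"
  shows "(\<Sum>b\<in>Basis. f b * (b \<bullet> x)) = f x"
proof -
  have "f x = f (\<Sum>b\<in>Basis. (x \<bullet> b) *\<^sub>R b)" by (simp add: euclidean_representation)
  also have "\<dots> = (\<Sum>b\<in>Basis. f b * (b \<bullet> x))"
    using assms by (simp add: linear_sum linear_cmul inner_commute mult.commute)
  finally show ?thesis by simp
qed

text \<open>Torsion-freeness is built in: the connection is the only datum, and the Lie bracket is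
  derived from it.\<close>

definition bracket_of :: "('e::real_vector \<Rightarrow> 'e \<Rightarrow> 'e) \<Rightarrow> 'e \<Rightarrow> 'e \<Rightarrow> 'e" where
  "bracket_of nab x y = nab x y - nab y x"

definition curv :: "('e::real_vector \<Rightarrow> 'e \<Rightarrow> 'e) \<Rightarrow> 'e \<Rightarrow> 'e \<Rightarrow> 'e \<Rightarrow> 'e" where
  "curv nab x y z = nab (bracket_of nab x y) z - nab x (nab y z) + nab y (nab x z)"

definition nabla_curv :: "('e::real_vector \<Rightarrow> 'e \<Rightarrow> 'e) \<Rightarrow> 'e \<Rightarrow> 'e \<Rightarrow> 'e \<Rightarrow> 'e \<Rightarrow> 'e" where
  "nabla_curv nab w x y z = nab w (curv nab x y z) - curv nab (nab w x) y z
     - curv nab x (nab w y) z - curv nab x y (nab w z)"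

definition ric :: "('e::euclidean_space \<Rightarrow> 'e \<Rightarrow> 'e) \<Rightarrow> 'e \<Rightarrow> 'e \<Rightarrow> real" where
  "ric nab x y = (\<Sum>b\<in>Basis. curv nab x b y \<bullet> b)"

text \<open>Left invariant tensors have constant components, so the term differentiating
  \<open>ric nab x y\<close> along \<open>w\<close> is absent; the same holds for
  \<open>nabla_form4\<close>.\<close>

definition nabla_ric :: "('e::euclidean_space \<Rightarrow> 'e \<Rightarrow> 'e) \<Rightarrow> 'e \<Rightarrow> 'e \<Rightarrow> 'e \<Rightarrow> real" where
  "nabla_ric nab w x y = - ric nab (nab w x) y - ric nab x (nab w y)"

definition schouten_form :: "('e::euclidean_space \<Rightarrow> 'e \<Rightarrow> 'e) \<Rightarrow> 'e \<Rightarrow> 'e \<Rightarrow> real" where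
  "schouten_form nab x y = 1 / (real DIM('e) - 2) *
     (ric nab x y - (\<Sum>b\<in>Basis. ric nab b b) * (x \<bullet> y) / (2 * (real DIM('e) - 1)))"

definition weyl_form :: "('e::euclidean_space \<Rightarrow> 'e \<Rightarrow> 'e) \<Rightarrow> 'e \<Rightarrow> 'e \<Rightarrow> 'e \<Rightarrow> 'e \<Rightarrow> real" where
  "weyl_form nab x y u v = curv nab x y u \<bullet> v -
     (schouten_form nab x u * (y \<bullet> v) + schouten_form nab y v * (x \<bullet> u)
      - schouten_form nab x v * (y \<bullet> u) - schouten_form nab y u * (x \<bullet> v))"

definition nabla_form4 ::
    "('e::euclidean_space \<Rightarrow> 'e \<Rightarrow> 'e) \<Rightarrow> ('e \<Rightarrow> 'e \<Rightarrow> 'e \<Rightarrow> 'e \<Rightarrow> real) \<Rightarrow>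
     'e \<Rightarrow> 'e \<Rightarrow> 'e \<Rightarrow> 'e \<Rightarrow> 'e \<Rightarrow> real" where
  "nabla_form4 nab T w x y u v = - T (nab w x) y u v - T x (nab w y) u v
     - T x y (nab w u) v - T x y u (nab w v)"

text \<open>A metric Lie algebra presented by its Levi-Civita connection: skewness is compatibility
  with the inner product, and \<open>jacobi\<close> is what the Bianchi identities rest on.\<close>

locale euclidean_lie_algebra =
  fixes nab :: "'e::euclidean_space \<Rightarrow> 'e \<Rightarrow> 'e"
  assumes nab_bilinear: "bilinear nab"
    and nab_skew: "nab x y \<bullet> z = - (y \<bullet> nab x z)"
    and jacobi: "bracket_of nab (bracket_of nab x y) z + bracket_of nab (bracket_of nab y z) x
      + bracket_of nab (bracket_of nab z x) y = 0"
begin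

abbreviation br where "br \<equiv> bracket_of nab"
abbreviation R where "R \<equiv> curv nab"
abbreviation r where "r \<equiv> ric nab"
abbreviation NR where "NR \<equiv> nabla_curv nab"
abbreviation Nr where "Nr \<equiv> nabla_ric nab"

lemmas nab_simps =
  bilinear_ladd[OF nab_bilinear] bilinear_radd[OF nab_bilinear]
  bilinear_lsub[OF nab_bilinear] bilinear_rsub[OF nab_bilinear]
  bilinear_lneg[OF nab_bilinear] bilinear_rneg[OF nab_bilinear]
  bilinear_lmul[OF nab_bilinear] bilinear_rmul[OF nab_bilinear]
  bilinear_lzero[OF nab_bilinear] bilinear_rzero[OF nab_bilinear]

lemma br_simps:
  "br (x + y) z = br x z + br y z" "br x (y + z) = br x y + br x z"
  "br (x - y) z = br x z - br y z" "br x (y - z) = br x y - br x z"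
  "br (- x) z = - br x z" "br x (- z) = - br x z"
  "br (a *\<^sub>R x) z = a *\<^sub>R br x z" "br x (a *\<^sub>R z) = a *\<^sub>R br x z"
  "br 0 x = 0" "br x 0 = 0"
  by (simp_all add: bracket_of_def nab_simps algebra_simps)

lemma br_antisym: "br y x = - br x y"
  by (simp add: bracket_of_def)

lemma br_self [simp]: "br x x = 0"
  by (simp add: bracket_of_def)

lemma koszul:
  "2 * (nab x y \<bullet> z) = br x y \<bullet> z - br y z \<bullet> x + br z x \<bullet> y"
  using nab_skew[of x y z] nab_skew[of y x z] nab_skew[of z x y]
  by (simp add: bracket_of_def inner_diff_left inner_diff_right inner_commute)

lemma R_simps:
  "R (x + x') y z = R x y z + R x' y z" "R x (y + y') z = R x y z + R x y' z"
  "R x y (z + z') = R x y z + R x y z'"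
  "R (x - x') y z = R x y z - R x' y z" "R x (y - y') z = R x y z - R x y' z"
  "R x y (z - z') = R x y z - R x y z'"
  "R (a *\<^sub>R x) y z = a *\<^sub>R R x y z" "R x (a *\<^sub>R y) z = a *\<^sub>R R x y z"
  "R x y (a *\<^sub>R z) = a *\<^sub>R R x y z"
  by (simp_all add: curv_def br_simps nab_simps algebra_simps)

lemma R_antisym: "R y x z = - R x y z"
  by (simp add: curv_def bracket_of_def nab_simps algebra_simps)

lemma R_skew: "R x y z \<bullet> u = - (R x y u \<bullet> z)"
proof -
  have "nab x (nab y z) \<bullet> u = nab y (nab x u) \<bullet> z" for x y z u
    using nab_skew[of x "nab y z" u] nab_skew[of y z "nab x u"] by (simp add: inner_commute)
  then show ?thesis
    using nab_skew[of "br x y" z u]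
    by (simp add: curv_def inner_diff_left inner_add_left inner_diff_right inner_add_right
        inner_commute)
qed

lemma R_bianchi: "R x y z + R y z x + R z x y = 0"
  using jacobi[of x y z]
  by (simp add: curv_def bracket_of_def nab_simps algebra_simps)

text \<open>The classical octahedron argument: four instances of the first Bianchi identity,
  combined with the two antisymmetries, leave the claim.\<close>

lemma R_pair: "R x y z \<bullet> u = R z u x \<bullet> y"
proof -
  have b: "R x y z \<bullet> u + R y z x \<bullet> u + R z x y \<bullet> u = 0" for x y z u
    using arg_cong[OF R_bianchi[of x y z], of "\<lambda>v. v \<bullet> u"] by (simp add: inner_add_left)
  have a: "R y x z \<bullet> u = - (R x y z \<bullet> u)" for x y z u
    by (simp add: R_antisym[of y x])
  show ?thesis
    using b[of y z x u] b[of z x u y] b[of x u y z] b[of u y z x]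
      a[of x y u z] a[of x z u y] a[of x z y u] a[of y u x z]
      a[of y u z x] a[of z u x y] R_skew[of x u z y] R_skew[of x y u z]
      R_skew[of x z u y] R_skew[of y u z x] R_skew[of y z u x] R_skew[of z u y x]
    by linarith
qed

text \<open>Once the brackets are written through \<open>nab\<close>, everything cancels formally
  except \<open>nab\<close> applied to the cyclic Jacobi sum.\<close>

lemma NR_bianchi: "NR x y z u + NR y z x u + NR z x y u = 0"
proof -
  have "nab (br (br x y) z + br (br y z) x + br (br z x) y) u = 0"
    by (simp add: jacobi nab_simps)
  then show ?thesis
    by (simp add: nabla_curv_def curv_def bracket_of_def nab_simps algebra_simps)
qed

lemma NR_antisym: "NR w y x z = - NR w x y z"
  by (simp add: nabla_curv_def R_antisym[of y x] R_antisym[of "nab w y" x]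
      R_antisym[of y "nab w x"] nab_simps)

lemma NR_eq: "NR w x y z \<bullet> u = - (R x y z \<bullet> nab w u) - R (nab w x) y z \<bullet> u
    - R x (nab w y) z \<bullet> u - R x y (nab w z) \<bullet> u"
  by (simp add: nabla_curv_def inner_diff_left nab_skew)

lemma NR_skew: "NR w x y z \<bullet> u = - (NR w x y u \<bullet> z)"
  unfolding NR_eq
  using R_skew[of x y "nab w u" z] R_skew[of "nab w x" y z u] R_skew[of x "nab w y" z u]
    R_skew[of x y "nab w z" u] by linarith

lemma NR_pair: "NR w x y z \<bullet> u = NR w z u x \<bullet> y"
  unfolding NR_eq
  using R_pair[of x y z "nab w u"] R_pair[of "nab w x" y z u] R_pair[of x "nab w y" z u]
    R_pair[of x y "nab w z" u] by linarith

lemma R_bilinear_inner: "bilinear (\<lambda>b c. R x b y \<bullet> c)"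
  by (auto simp: bilinear_def inner_add_left inner_add_right R_simps intro!: linearI)

lemma r_trace: "orthonormal_family DIM('e) u \<Longrightarrow> r x y = (\<Sum>i<DIM('e). R x (u i) y \<bullet> u i)"
  unfolding ric_def by (rule trace_orthonormal[OF R_bilinear_inner])

lemma r_sym: "r x y = r y x"
  unfolding ric_def by (intro sum.cong refl R_pair)

lemma r_simps: "r (x + x') y = r x y + r x' y" "r x (y + y') = r x y + r x y'"
  "r (x - x') y = r x y - r x' y" "r x (y - y') = r x y - r x y'"
  "r (a *\<^sub>R x) y = a * r x y" "r x (a *\<^sub>R y) = a * r x y"
  by (simp_all add: ric_def R_simps inner_simps sum.distrib sum_subtractf sum_distrib_left)

lemma r_minus: "r (- x) y = - r x y" "r x (- y) = - r x y"
  using r_simps(5)[of "-1"] r_simps(6)[of _ "-1"] by auto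

lemma r_bilinear: "bilinear r"
  by (auto simp: bilinear_def r_simps intro!: linearI)

lemma Nr_sym: "Nr w x y = Nr w y x"
  unfolding nabla_ric_def using r_sym by (metis add.commute diff_conv_add_uminus)

lemma Nr_linear: "linear (\<lambda>w. Nr w x y)"
  by (auto simp: nabla_ric_def nab_simps r_simps algebra_simps intro!: linearI)

lemma NR_trace: "(\<Sum>b\<in>Basis. NR w x b y \<bullet> b) = Nr w x y"
proof -
  have "(\<Sum>b\<in>Basis. R x (nab w b) y \<bullet> b + R x b y \<bullet> nab w b) = 0"
    by (rule trace_skew[OF R_bilinear_inner]) (rule nab_skew)
  then show ?thesis
    by (simp add: NR_eq nabla_ric_def ric_def sum.distrib sum_subtractf sum_negf)
qed

text \<open>The contracted second Bianchi identity: pair symmetry moves the direction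
  \<open>b\<close> into the cyclic sum, and the other two terms are traces as in
  \<open>NR_trace\<close>.\<close>

lemma div_R: "(\<Sum>b\<in>Basis. NR b b x y \<bullet> z) = Nr y z x - Nr z y x"
proof -
  have "NR b b x y \<bullet> z = NR y z b x \<bullet> b - NR z y b x \<bullet> b" for b
  proof -
    have "NR b y z b \<bullet> x + NR y z b b \<bullet> x + NR z b y b \<bullet> x = 0"
      using arg_cong[OF NR_bianchi[of b y z b], of "\<lambda>v. v \<bullet> x"] by (simp add: inner_add_left)
    then show ?thesis
      using NR_pair[of b b x y z] NR_skew[of y z b b x] NR_skew[of z b y b x]
        arg_cong[OF NR_antisym[of z y b x], of "\<lambda>v. v \<bullet> b"] by simp
  qed
  then show ?thesis by (simp add: sum_subtractf NR_trace)
qed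

lemma trace_Nr: "(\<Sum>b\<in>Basis. Nr w b b) = 0"
proof -
  have "(\<Sum>b\<in>Basis. r (nab w b) b + r b (nab w b)) = 0"
    by (rule trace_skew[OF r_bilinear]) (rule nab_skew)
  then show ?thesis by (simp add: nabla_ric_def sum.distrib sum_subtractf sum_negf)
qed

text \<open>The trace of the second Bianchi identity gives \<open>div r = ds / 2\<close>, and \<open>s\<close> is constant.\<close>

lemma div_r: "(\<Sum>b\<in>Basis. Nr b b y) = 0"
proof -
  have "(\<Sum>x\<in>Basis. \<Sum>b\<in>Basis. NR b b x y \<bullet> x) = (\<Sum>b\<in>Basis. Nr b b y)"
    by (subst sum.swap) (simp add: NR_trace)
  moreover have "(\<Sum>x\<in>Basis. \<Sum>b\<in>Basis. NR b b x y \<bullet> x) = (\<Sum>x\<in>Basis. Nr y x x - Nr x y x)"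
    by (simp add: div_R)
  ultimately show ?thesis
    by (simp add: sum_subtractf trace_Nr Nr_sym[of _ y])
qed

text \<open>By \<open>div_R\<close> the divergence of the curvature is the antisymmetrised
  derivative of \<open>r\<close>. The Schouten form is \<open>k\<close> times \<open>r\<close> up to
  a constant multiple of the parallel inner product, so its term in the Weyl divergence is
  \<open>k\<close> times the same expression, leaving the factor \<open>1 - k\<close>.\<close>

lemma codazzi:
  assumes "3 < DIM('e)"
    and harmonic: "\<And>x y z. (\<Sum>b\<in>Basis. nabla_form4 nab (weyl_form nab) b b x y z) = 0"
  shows "Nr y x z = Nr z x y"
proof -
  define k where "k = 1 / (real DIM('e) - 2)"
  define A where "A = schouten_form nab"
  define NA where "NA w x y = - A (nab w x) y - A x (nab w y)" for w x y
  have NA: "NA w x y = k * Nr w x y" for w x y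
  proof -
    have "nab w x \<bullet> y = - (x \<bullet> nab w y)" by (rule nab_skew)
    then show ?thesis
      by (simp add: NA_def A_def schouten_form_def nabla_ric_def k_def algebra_simps)
  qed
  have W: "nabla_form4 nab (weyl_form nab) w x y u v = NR w x y u \<bullet> v -
      (NA w x u * (y \<bullet> v) + NA w y v * (x \<bullet> u) - NA w x v * (y \<bullet> u) - NA w y u * (x \<bullet> v))"
    for w x y u v
    unfolding nabla_form4_def weyl_form_def A_def[symmetric] NR_eq NA_def
    by (simp add: nab_skew algebra_simps)
  have "linear (\<lambda>w. NA w x y)" for x y
    unfolding NA
    by (intro linearI) (simp_all add: linear_add[OF Nr_linear] linear_cmul[OF Nr_linear] algebra_simps)
  note tr = sum_Basis_inner[OF this]
  have d: "(\<Sum>b\<in>Basis. NA b b y) = 0" for y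
    by (simp add: NA sum_distrib_left[symmetric] div_r)
  have "0 = (Nr y z x - Nr z y x) - (NA y x z - NA z x y)"
    using harmonic[of x y z]
    by (simp add: W sum_subtractf sum.distrib div_R tr sum_distrib_right[symmetric] d)
  then have "(1 - k) * (Nr y x z - Nr z x y) = 0"
    using Nr_sym[of y z x] Nr_sym[of z y x] by (simp add: NA algebra_simps)
  \<comment> \<open>Here \<open>1 - k = (n - 3) / (n - 2)\<close> with
    \<open>n = DIM('e)\<close>.\<close>
  moreover have "k \<noteq> 1" using assms(1) by (simp add: k_def)
  ultimately show ?thesis by simp
qed

text \<open>Maps commuting with the connection are parallel, and so is every factor of the curvature
  formula. In the sign convention of \<open>curv\<close>, \<open>\<kappa> k\<close> is the sectional
  curvature on the image of \<open>P k\<close> when these maps are projections onto orthogonal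
  subspaces.\<close>

lemma parallel_curvature:
  assumes "finite K"
    and R: "\<And>x y z. R x y z = (\<Sum>k\<in>K. \<kappa> k *\<^sub>R ((P k x \<bullet> z) *\<^sub>R P k y - (P k y \<bullet> z) *\<^sub>R P k x))"
    and P: "\<And>k x y. k \<in> K \<Longrightarrow> P k (nab x y) = nab x (P k y)"
  shows "NR w x y z = 0"
proof -
  have "nab w (R x y z) = (\<Sum>k\<in>K. \<kappa> k *\<^sub>R ((P k x \<bullet> z) *\<^sub>R nab w (P k y)
      - (P k y \<bullet> z) *\<^sub>R nab w (P k x)))"
    using nab_bilinear unfolding R
    by (simp add: bilinear_def linear_sum linear_cmul linear_diff)
  then show ?thesis
    unfolding nabla_curv_def R
    by (simp add: sum_subtractf[symmetric] P nab_skew algebra_simps cong: sum.cong)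
qed

end

section \<open>Almost abelian Lie algebras\<close>

text \<open>The form in which cyclicity of the trace is used for the commutator of \<open>A\<close>
  and \<open>S\<close> below.\<close>

lemma trace_selfadjoint:
  fixes P Q :: "'e::euclidean_space \<Rightarrow> 'e"
  assumes P: "\<And>x y. P x \<bullet> y = x \<bullet> P y" and Q: "linear Q"
  shows "(\<Sum>b\<in>Basis. Q (P b) \<bullet> b) = (\<Sum>b\<in>Basis. Q b \<bullet> P b)"
proof -
  have "Q (P b) \<bullet> b = (\<Sum>c\<in>Basis. (Q c \<bullet> b) * (P c \<bullet> b))" for b
  proof -
    have "Q (P b) = Q (\<Sum>c\<in>Basis. (P b \<bullet> c) *\<^sub>R c)" by (simp add: euclidean_representation)
    also have "\<dots> = (\<Sum>c\<in>Basis. (P b \<bullet> c) *\<^sub>R Q c)"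
      by (simp add: linear_sum[OF Q] linear_cmul[OF Q])
    finally show ?thesis
      by (simp add: inner_sum_left, intro sum.cong refl) (metis P inner_commute mult.commute)
  qed
  then have "(\<Sum>b\<in>Basis. Q (P b) \<bullet> b) = (\<Sum>c\<in>Basis. \<Sum>b\<in>Basis. (Q c \<bullet> b) * (P c \<bullet> b))"
    by (simp only: sum.swap[of "\<lambda>b c. (Q c \<bullet> b) * (P c \<bullet> b)" Basis Basis])
  then show ?thesis by (simp add: euclidean_inner[of "Q c" "P c" for c])
qed

lemma linear_eq_0_if_trace:
  fixes B :: "'e::euclidean_space \<Rightarrow> 'e"
  assumes "linear B" "(\<Sum>b\<in>Basis. B b \<bullet> B b) = 0"
  shows "B x = 0"
proof -
  have "B b = 0" if "b \<in> Basis" for b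
    using assms(2) that by (subst (asm) sum_nonneg_eq_0_iff) auto
  then have "B (\<Sum>b\<in>Basis. (x \<bullet> b) *\<^sub>R b) = 0"
    using assms(1) by (simp add: linear_sum linear_cmul)
  then show ?thesis by (simp add: euclidean_representation)
qed

context euclidean_lie_algebra
begin

text \<open>Uniqueness of the Levi-Civita connection. Explicit connections \<open>N\<close> are
  later guessed from the geometry and verified through this.\<close>

lemma koszul_unique:
  assumes skew: "\<And>x y z. N x y \<bullet> z = - (y \<bullet> N x z)"
    and torsion: "\<And>x y. br x y = N x y - N y x"
  shows "nab x y = N x y"
proof -
  have "2 * (N x y \<bullet> z) = 2 * (nab x y \<bullet> z)" for z
    unfolding koszul torsion using skew[of x y z] skew[of y x z] skew[of z x y]
    by (simp add: inner_diff_left inner_diff_right inner_commute)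
  then have "(nab x y - N x y) \<bullet> z = 0" for z by (simp add: inner_diff_left)
  then have "nab x y - N x y = 0" by (metis inner_eq_zero_iff)
  then show ?thesis by simp
qed

lemma almost_abelian_parallel:
  fixes e :: 'e
  assumes e: "e \<bullet> e = 1"
    and abelian: "\<And>v w. v \<bullet> e = 0 \<Longrightarrow> w \<bullet> e = 0 \<Longrightarrow> br v w = 0"
    and ideal: "\<And>v. v \<bullet> e = 0 \<Longrightarrow> br e v \<bullet> e = 0"
    and codazzi: "\<And>x y z. Nr x y z = Nr y x z"
  shows "NR w x y z = 0"
proof -
  define A where "A x = nab e x" for x
  define S where "S x = - nab x e" for x
  have A_lin: "linear A" and S_lin: "linear S"
    by (auto simp: A_def S_def nab_simps intro!: linearI)
  note lin = linear_add[OF A_lin] linear_diff[OF A_lin] linear_cmul[OF A_lin] linear_neg[OF A_lin]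
    linear_add[OF S_lin] linear_diff[OF S_lin] linear_cmul[OF S_lin] linear_neg[OF S_lin]
    linear_0[OF A_lin] linear_0[OF S_lin]
  have dec: "\<exists>x'. x = (x \<bullet> e) *\<^sub>R e + x' \<and> x' \<bullet> e = 0" for x
    by (rule exI[of _ "x - (x \<bullet> e) *\<^sub>R e"]) (simp add: inner_diff_left e)
  have ee: "nab e e = 0"
  proof -
    have "nab e e \<bullet> z = 0" for z
    proof -
      obtain z' where z: "z = (z \<bullet> e) *\<^sub>R e + z'" "z' \<bullet> e = 0" using dec by blast
      have "nab e e \<bullet> e = 0" using nab_skew[of e e e] by (simp add: inner_commute)
      moreover have "nab e e \<bullet> z' = 0"
        using koszul[of e e z'] ideal[OF z(2)] br_antisym[of z' e] by simp
      ultimately show ?thesis by (subst z(1)) (simp add: inner_add_right)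
    qed
    then show ?thesis using inner_eq_zero_iff by blast
  qed
  have Ae: "A e = 0" and Se: "S e = 0" by (simp_all add: A_def S_def ee)
  have A_skew: "A x \<bullet> y = - (x \<bullet> A y)" for x y unfolding A_def by (rule nab_skew)
  have Axe: "A x \<bullet> e = 0" for x by (simp add: A_skew Ae)
  have Sxe: "S x \<bullet> e = 0" for x using nab_skew[of x e e] by (simp add: S_def inner_commute)
  have S_nab: "nab v w \<bullet> e = S v \<bullet> w" for v w
    using nab_skew[of v w e] by (simp add: S_def inner_commute)
  have S_sym: "S x \<bullet> y = x \<bullet> S y" for x y
  proof -
    obtain x' where x: "x = (x \<bullet> e) *\<^sub>R e + x'" "x' \<bullet> e = 0" using dec by blast
    obtain y' where y: "y = (y \<bullet> e) *\<^sub>R e + y'" "y' \<bullet> e = 0" using dec by blast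
    have "S x' \<bullet> y' = S y' \<bullet> x'"
      unfolding S_nab[symmetric] using abelian[OF x(2) y(2)] by (simp add: bracket_of_def)
    moreover have "S x = S x'" by (subst x(1)) (simp add: lin Se)
    moreover have "S y = S y'" by (subst y(1)) (simp add: lin Se)
    moreover have "S x' \<bullet> y = S x' \<bullet> y'" by (subst y(1)) (simp add: inner_add_right Sxe)
    moreover have "S y' \<bullet> x = S y' \<bullet> x'" by (subst x(1)) (simp add: inner_add_right Sxe)
    ultimately show ?thesis by (metis inner_commute)
  qed
  have S_com: "S x \<bullet> y = S y \<bullet> x" for x y by (metis S_sym inner_commute)
  \<comment> \<open>By Koszul's formula, abelianness makes the derivative of two vectors orthogonal
    to \<open>e\<close> purely normal; all other terms come from \<open>A\<close> and
    \<open>S\<close>.\<close>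
  have nab: "nab x y = (x \<bullet> e) *\<^sub>R A y + (S x \<bullet> y) *\<^sub>R e - (y \<bullet> e) *\<^sub>R S x" for x y
  proof -
    obtain x' where x: "x = (x \<bullet> e) *\<^sub>R e + x'" "x' \<bullet> e = 0" using dec by blast
    obtain y' where y: "y = (y \<bullet> e) *\<^sub>R e + y'" "y' \<bullet> e = 0" using dec by blast
    have "nab x' y' = (S x' \<bullet> y') *\<^sub>R e"
    proof -
      have "(nab x' y' - (S x' \<bullet> y') *\<^sub>R e) \<bullet> z = 0" for z
      proof -
        obtain z' where z: "z = (z \<bullet> e) *\<^sub>R e + z'" "z' \<bullet> e = 0" using dec by blast
        have "nab x' y' \<bullet> z' = 0"
          using koszul[of x' y' z'] abelian x(2) y(2) z(2) by simp
        then show ?thesis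
          using z(2) S_nab[of x' y'] by (subst z(1))
            (simp add: inner_add_left inner_add_right inner_diff_left inner_diff_right e inner_commute)
      qed
      then have "nab x' y' - (S x' \<bullet> y') *\<^sub>R e = 0" using inner_eq_zero_iff by blast
      then show ?thesis by simp
    qed
    moreover have "nab x y = (x \<bullet> e) *\<^sub>R A y + nab x' y"
      by (subst x(1)) (simp add: nab_simps A_def)
    moreover have "nab x' y = (y \<bullet> e) *\<^sub>R nab x' e + nab x' y'"
      by (subst y(1)) (simp add: nab_simps)
    moreover have "S x = S x'" by (subst x(1)) (simp add: lin Se)
    moreover have "S x' \<bullet> y = S x' \<bullet> y'" by (subst y(1)) (simp add: inner_add_right Sxe)
    ultimately show ?thesis by (simp add: S_def algebra_simps)
  qed
  \<comment> \<open>\<open>R e y e = - Q y\<close>, so \<open>- q\<close> is the Ricci curvature of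
    \<open>e\<close>; \<open>\<rho>\<close> is the Ricci operator on the ideal and \<open>B\<close>
    the commutator of \<open>A\<close> and \<open>S\<close>.\<close>
  define Q where "Q x = S (S x) + S (A x) - A (S x)" for x
  define t where "t = (\<Sum>b\<in>Basis. S b \<bullet> b)"
  define q where "q = (\<Sum>b\<in>Basis. Q b \<bullet> b)"
  define B where "B x = A (S x) - S (A x)" for x
  define \<rho> where "\<rho> x = B x - t *\<^sub>R S x" for x
  have Q_lin: "linear Q" and B_lin: "linear B"
    by (auto simp: Q_def B_def lin algebra_simps intro!: linearI)
  have Q_B: "Q x = S (S x) - B x" for x by (simp add: Q_def B_def)
  have eS: "e \<bullet> S x = 0" and eA: "e \<bullet> A x = 0" for x
    using Sxe[of x] Axe[of x] by (simp_all add: inner_commute)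
  have SA: "S x \<bullet> A y = - (A (S x) \<bullet> y)" for x y by (simp add: A_skew)
  have B_sym: "B x \<bullet> y = x \<bullet> B y" for x y
  proof -
    have "A (S x) \<bullet> y = - (x \<bullet> S (A y))" by (simp add: A_skew S_sym)
    moreover have "S (A x) \<bullet> y = - (x \<bullet> A (S y))" by (simp add: A_skew S_sym)
    ultimately show ?thesis by (simp add: B_def inner_diff_left inner_diff_right)
  qed
  have R: "R x y z = (x \<bullet> e) *\<^sub>R ((Q y \<bullet> z) *\<^sub>R e - (z \<bullet> e) *\<^sub>R Q y)
      - (y \<bullet> e) *\<^sub>R ((Q x \<bullet> z) *\<^sub>R e - (z \<bullet> e) *\<^sub>R Q x)
      + ((S y \<bullet> z) *\<^sub>R S x - (S x \<bullet> z) *\<^sub>R S y)" for x y z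
  proof -
    have br: "br x y = (x \<bullet> e) *\<^sub>R (A y + S y) - (y \<bullet> e) *\<^sub>R (A x + S x)" for x y
      by (simp add: bracket_of_def nab S_com[of y x] algebra_simps)
    have SS: "S (S x) \<bullet> y = S (S y) \<bullet> x" for x y by (metis S_sym inner_commute)
    have 1: "nab (br x y) z = (S (br x y) \<bullet> z) *\<^sub>R e - (z \<bullet> e) *\<^sub>R S (br x y)"
      by (subst nab) (simp add: br inner_add_left inner_diff_left Axe Sxe)
    have 2: "nab x (nab y z) = (x \<bullet> e) *\<^sub>R ((y \<bullet> e) *\<^sub>R A (A z) - (z \<bullet> e) *\<^sub>R A (S y))
      - ((y \<bullet> e) * (A (S x) \<bullet> z) + (z \<bullet> e) * (S (S x) \<bullet> y)) *\<^sub>R e - (S y \<bullet> z) *\<^sub>R S x" for x y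
    proof -
      have "S x \<bullet> nab y z = - ((y \<bullet> e) * (A (S x) \<bullet> z) + (z \<bullet> e) * (S (S x) \<bullet> y))"
        by (simp add: nab inner_add_right inner_diff_right SA Sxe S_sym[of "S x" y])
      moreover have "A (nab y z) = (y \<bullet> e) *\<^sub>R A (A z) - (z \<bullet> e) *\<^sub>R A (S y)"
        by (simp add: nab lin Ae)
      ultimately show ?thesis
        by (subst nab) (simp only: S_nab, simp add: algebra_simps)
    qed
    show ?thesis
    proof -
      have "(curv nab x y z - ((x \<bullet> e) *\<^sub>R ((Q y \<bullet> z) *\<^sub>R e - (z \<bullet> e) *\<^sub>R Q y)
      - (y \<bullet> e) *\<^sub>R ((Q x \<bullet> z) *\<^sub>R e - (z \<bullet> e) *\<^sub>R Q x)
      + ((S y \<bullet> z) *\<^sub>R S x - (S x \<bullet> z) *\<^sub>R S y))) \<bullet> v = 0" for v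
        unfolding curv_def 1 2[of x y] 2[of y x] unfolding br Q_def
        by (simp only: lin inner_add_left inner_diff_left inner_minus_left inner_scaleR_left)
          (simp add: SS[of x y] algebra_simps)
      then show ?thesis using inner_eq_zero_iff by (metis eq_iff_diff_eq_0)
    qed
  qed
  have r: "r x y = \<rho> x \<bullet> y - q * (x \<bullet> e) * (y \<bullet> e)" for x y
  proof -
    have *: "r x y = (\<Sum>b\<in>Basis. (x \<bullet> e) * ((Q b \<bullet> y) * (b \<bullet> e)) - (x \<bullet> e) * (y \<bullet> e) * (Q b \<bullet> b)
        - (Q x \<bullet> y) * ((b \<bullet> e) * (b \<bullet> e)) + (y \<bullet> e) * ((b \<bullet> Q x) * (b \<bullet> e))
        + (S b \<bullet> y) * (b \<bullet> S x) - (S x \<bullet> y) * (S b \<bullet> b))"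
      unfolding ric_def R
      by (intro sum.cong refl)
        (simp add: inner_add_left inner_diff_left inner_commute algebra_simps)
    have "r x y = (x \<bullet> e) * (\<Sum>b\<in>Basis. (Q b \<bullet> y) * (b \<bullet> e)) - (x \<bullet> e) * (y \<bullet> e) * q
        - (Q x \<bullet> y) * (\<Sum>b\<in>Basis. (b \<bullet> e) * (b \<bullet> e))
        + (y \<bullet> e) * (\<Sum>b\<in>Basis. (b \<bullet> Q x) * (b \<bullet> e))
        + (\<Sum>b\<in>Basis. (S b \<bullet> y) * (b \<bullet> S x)) - (S x \<bullet> y) * t"
      unfolding * q_def t_def by (simp only: sum.distrib sum_subtractf sum_distrib_left)
    moreover have "(\<Sum>b\<in>Basis. (Q b \<bullet> y) * (b \<bullet> e)) = 0"
      by (subst sum_Basis_inner)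
        (auto simp: linear_add[OF Q_lin] linear_cmul[OF Q_lin] inner_add_left Q_def[of e] lin Ae Se
          intro!: linearI)
    moreover have "(\<Sum>b\<in>Basis. (b \<bullet> e) * (b \<bullet> e)) = 1"
      using sum_Basis_inner[OF bounded_linear.linear[OF bounded_linear_inner_left], of e e] by (simp add: e)
    moreover have "(\<Sum>b\<in>Basis. (b \<bullet> Q x) * (b \<bullet> e)) = 0"
      using sum_Basis_inner[OF bounded_linear.linear[OF bounded_linear_inner_left], of "Q x" e]
      by (simp add: Q_def inner_add_right inner_diff_right eS eA)
    moreover have "(\<Sum>b\<in>Basis. (S b \<bullet> y) * (b \<bullet> S x)) = S (S x) \<bullet> y"
      by (subst sum_Basis_inner) (auto simp: lin inner_add_left intro!: linearI)
    ultimately show ?thesis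
      by (simp add: \<rho>_def Q_B inner_diff_left)
  qed
  have \<rho>_lin: "linear \<rho>"
    by (auto simp: \<rho>_def lin linear_add[OF B_lin] linear_cmul[OF B_lin] algebra_simps intro!: linearI)
  have \<rho>e: "\<rho> e = 0" by (simp add: \<rho>_def B_def Ae Se lin linear_0[OF A_lin] linear_0[OF S_lin])
  have \<rho>_sym: "\<rho> x \<bullet> y = x \<bullet> \<rho> y" for x y
    by (simp add: \<rho>_def inner_diff_left inner_diff_right B_sym S_sym)
  have cod: "A (\<rho> x) - \<rho> (A x) = \<rho> (S x) + q *\<^sub>R S x" for x
  proof -
    have 1: "Nr e x y = A (\<rho> x) \<bullet> y - \<rho> (A x) \<bullet> y" for x y
      unfolding nabla_ric_def A_def[symmetric] r
      by (simp add: Axe) (simp add: A_skew)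
    have 2: "Nr x e y = \<rho> (S x) \<bullet> y + q * (S x \<bullet> y)" for y
    proof -
      have "r e (nab x y) = - q * (S x \<bullet> y)" by (simp add: r \<rho>e e S_nab)
      moreover have "nab x e = - S x" by (simp add: S_def)
      ultimately show ?thesis
        by (simp add: nabla_ric_def r_minus) (simp add: r Sxe)
    qed
    have "(A (\<rho> x) - \<rho> (A x) - (\<rho> (S x) + q *\<^sub>R S x)) \<bullet> y = 0" for y
      using codazzi[of e x y] by (simp add: 1 2 inner_add_left inner_diff_left)
    then have "A (\<rho> x) - \<rho> (A x) - (\<rho> (S x) + q *\<^sub>R S x) = 0"
      using inner_eq_zero_iff by blast
    then show ?thesis by simp
  qed
  \<comment> \<open>The left side of \<open>cod\<close> is symmetric, being the commutator of a skew
    and a symmetric map. So the composite of \<open>\<rho>\<close> and \<open>S\<close> on the right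
    equals its transpose.\<close>
  have "\<rho> (S x) = S (\<rho> x)" for x
  proof -
    have "(\<rho> (S x) - S (\<rho> x)) \<bullet> y = 0" for y
    proof -
      have "\<rho> (S x) \<bullet> y = A (\<rho> x) \<bullet> y - \<rho> (A x) \<bullet> y - q * (S x \<bullet> y)" for x y
        using arg_cong[OF cod[of x], of "\<lambda>v. v \<bullet> y"] by (simp add: inner_add_left inner_diff_left)
      moreover have "A (\<rho> x) \<bullet> y = - (\<rho> (A y) \<bullet> x)" for x y
        unfolding A_skew[of "\<rho> x"] \<rho>_sym[of x] by (simp add: inner_commute)
      moreover have "S (\<rho> x) \<bullet> y = \<rho> (S y) \<bullet> x"
        unfolding S_sym[of "\<rho> x"] \<rho>_sym[of x] by (simp add: inner_commute)
      ultimately show ?thesis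
        using S_com[of x y] by (simp add: inner_diff_left)
    qed
    then have "\<rho> (S x) - S (\<rho> x) = 0" using inner_eq_zero_iff by blast
    then show ?thesis by simp
  qed
  then have BS: "B (S x) = S (B x)" for x
    by (simp add: \<rho>_def lin)
  text \<open>\<open>B = [A, S]\<close> is symmetric and commutes with \<open>S\<close>, so \<open>|B|\<^sup>2 = tr ([A, S] B) = tr (A [S, B]) = 0\<close>.\<close>
  have "(\<Sum>b\<in>Basis. B b \<bullet> B b) = 0"
  proof -
    have "(\<Sum>b\<in>Basis. S (A b) \<bullet> B b) = (\<Sum>b\<in>Basis. S (A (B b)) \<bullet> b)"
      by (rule trace_selfadjoint[symmetric]) (auto simp: B_sym lin intro!: linearI)
    moreover have "(\<Sum>b\<in>Basis. S (B (A b)) \<bullet> b + S (B b) \<bullet> A b) = 0"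
      by (rule trace_skew[of "\<lambda>x y. S (B x) \<bullet> y"])
        (auto simp: A_skew lin linear_add[OF B_lin] linear_cmul[OF B_lin] bilinear_def
          inner_add_left inner_add_right intro!: linearI)
    moreover have "S (B (A b)) \<bullet> b = S (A b) \<bullet> B b" for b
      by (simp add: BS[symmetric] B_sym)
    moreover have "S (B b) \<bullet> A b = S (A b) \<bullet> B b" for b
      by (metis S_sym inner_commute)
    moreover have "B b \<bullet> B b = - (S (A (B b)) \<bullet> b) - S (A b) \<bullet> B b" for b
    proof -
      have "S (A (B b)) \<bullet> b = - (A (S b) \<bullet> B b)" by (metis S_sym A_skew inner_commute)
      then show ?thesis by (subst (1) B_def) (simp add: inner_diff_left)
    qed
    ultimately show ?thesis
      by (simp add: sum.distrib sum_subtractf sum_negf sum_distrib_left[symmetric])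
  qed
  then have B0: "B x = 0" for x by (rule linear_eq_0_if_trace[OF B_lin])
  then have AS: "A (S x) = S (A x)" for x using B_def[of x] by simp
  \<comment> \<open>With \<open>B = 0\<close> the map \<open>\<rho>\<close> is \<open>- t\<close>
    times \<open>S\<close> and commutes with \<open>A\<close>, so the left side of
    \<open>cod\<close> vanishes.\<close>
  have tS: "t *\<^sub>R S (S x) = q *\<^sub>R S x" for x
    using cod[of x] by (simp add: \<rho>_def B0 lin AS)
  have q: "q = (\<Sum>b\<in>Basis. S b \<bullet> S b)"
    by (simp add: q_def Q_B B0 S_sym)
  have S0: "S x = 0" if "q = 0" for x
    using linear_eq_0_if_trace[OF S_lin] that q by simp
  \<comment> \<open>The eigenvalue of \<open>S\<close> on its image, read off from
    \<open>tS\<close>. Division by zero gives \<open>l = 0\<close> when \<open>t = 0\<close>, which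
    happens only for \<open>S = 0\<close>.\<close>
  define l where "l = q / t"
  have l: "S (S x) = l *\<^sub>R S x \<and> (l = 0 \<longrightarrow> S x = 0)" for x
  proof (cases "q = 0")
    case True
    then show ?thesis by (simp add: S0 linear_0[OF S_lin])
  next
    case False
    have "t \<noteq> 0"
    proof
      assume "t = 0"
      then have "S x = 0" for x using tS[of x] False by simp
      then show False using q False by simp
    qed
    moreover have "S (S x) = (1 / t) *\<^sub>R (t *\<^sub>R S (S x))" using \<open>t \<noteq> 0\<close> by simp
    ultimately show ?thesis using False by (simp only: tS) (simp add: l_def)
  qed
  \<comment> \<open>\<open>S\<close> divided by \<open>l\<close> projects onto the image of
    \<open>S\<close>, and adding the line of \<open>e\<close> gives the hyperbolic factor. For
    \<open>l = 0\<close> the value \<open>1 / 0 = 0\<close> leaves the projection onto that line,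
    with curvature 0.\<close>
  show ?thesis
  proof (rule parallel_curvature[of "{0::nat}" "\<lambda>_. - l\<^sup>2"
        "\<lambda>_ x. (1 / l) *\<^sub>R S x + (x \<bullet> e) *\<^sub>R e"])
    fix x y z
    have Q: "Q x = l *\<^sub>R S x" for x by (simp add: Q_B B0 l)
    show "R x y z = (\<Sum>k\<in>{0::nat}. - l\<^sup>2 *\<^sub>R
        ((((1 / l) *\<^sub>R S x + (x \<bullet> e) *\<^sub>R e) \<bullet> z) *\<^sub>R ((1 / l) *\<^sub>R S y + (y \<bullet> e) *\<^sub>R e) -
         (((1 / l) *\<^sub>R S y + (y \<bullet> e) *\<^sub>R e) \<bullet> z) *\<^sub>R ((1 / l) *\<^sub>R S x + (x \<bullet> e) *\<^sub>R e)))"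
    proof (cases "l = 0")
      case True
      then show ?thesis using l by (simp add: R Q)
    next
      case False
      then show ?thesis
        by (simp add: R Q inner_add_left inner_commute algebra_simps power2_eq_square)
    qed
  next
    fix k x y
    show "(1 / l) *\<^sub>R S (nab x y) + (nab x y \<bullet> e) *\<^sub>R e
        = nab x ((1 / l) *\<^sub>R S y + (y \<bullet> e) *\<^sub>R e)"
    proof (cases "l = 0")
      case True
      then have "S x = 0" for x using l by blast
      then show ?thesis by (simp add: True nab Ae lin linear_0[OF A_lin] linear_0[OF S_lin] inner_add_left Axe)
    next
      case False
      have "S x \<bullet> S y = l * (S x \<bullet> y)" using l[of x] S_sym[of "S x" y] by simp
      then show ?thesis using False
        by (simp add: nab lin Ae Se AS l inner_add_left inner_add_right inner_diff_left Axe Sxe e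
            algebra_simps)
    qed
  qed simp
qed

end

section \<open>The Codazzi equation in terms of structure constants\<close>

text \<open>Koszul's formula in an orthonormal basis \<open>u\<close>, where \<open>c i j k\<close>
  is the component of \<open>br (u i) (u j)\<close> along \<open>u k\<close>. As functions of a
  table \<open>c\<close>, this and the next two definitions evaluate to polynomials.\<close>

definition christoffel :: "(nat \<Rightarrow> nat \<Rightarrow> nat \<Rightarrow> real) \<Rightarrow> nat \<Rightarrow> nat \<Rightarrow> nat \<Rightarrow> real" where
  "christoffel c i j k = (c i j k - c j k i + c k i j) / 2"

text \<open>The trace of \<open>R (u i) (u k) (u j)\<close> against \<open>u k\<close>; skewness
  turns each iterated derivative into a product of two Christoffel coefficients.\<close>

definition ricci_of :: "nat \<Rightarrow> (nat \<Rightarrow> nat \<Rightarrow> nat \<Rightarrow> real) \<Rightarrow> nat \<Rightarrow> nat \<Rightarrow> real" where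
  "ricci_of n c i j = (\<Sum>k<n. \<Sum>m<n. c i k m * christoffel c m j k
     + christoffel c k j m * christoffel c i k m - christoffel c i j m * christoffel c k k m)"

text \<open>The components of \<open>Nr (u i) (u j) (u k) - Nr (u j) (u i) (u k)\<close>.\<close>

definition codazzi_of :: "nat \<Rightarrow> (nat \<Rightarrow> nat \<Rightarrow> nat \<Rightarrow> real) \<Rightarrow> nat \<Rightarrow> nat \<Rightarrow> nat \<Rightarrow> real" where
  "codazzi_of n c i j k = (\<Sum>m<n.
     christoffel c j i m * ricci_of n c m k + christoffel c j k m * ricci_of n c i m
     - christoffel c i j m * ricci_of n c m k - christoffel c i k m * ricci_of n c j m)"

lemma sum_lessThan_4: "(\<Sum>m<4. f m) = f 0 + f 1 + f 2 + f (3::nat)"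
  by (simp add: eval_nat_numeral lessThan_Suc add_ac)

lemma all_less_4: "(\<forall>i<4. P i) \<longleftrightarrow> P 0 \<and> P 1 \<and> P 2 \<and> P (3::nat)"
  by (auto simp: eval_nat_numeral less_Suc_eq)

lemma inner_orthonormal:
  fixes u :: "nat \<Rightarrow> 'e::euclidean_space"
  assumes "orthonormal_family DIM('e) u"
  shows "x \<bullet> y = (\<Sum>m<DIM('e). (x \<bullet> u m) * (y \<bullet> u m))"
  by (subst orthonormal_expansion[OF assms, of x])
    (simp add: inner_sum_left, simp add: inner_commute)

context euclidean_lie_algebra
begin

lemma codazzi_structure_constants:
  assumes u: "orthonormal_family DIM('e) u"
    and c: "\<And>i j k. i < DIM('e) \<Longrightarrow> j < DIM('e) \<Longrightarrow> k < DIM('e) \<Longrightarrow> br (u i) (u j) \<bullet> u k = c i j k"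
    and codazzi: "\<And>x y z. Nr x y z = Nr y x z"
    and ijk: "i < DIM('e)" "j < DIM('e)" "k < DIM('e)"
  shows "codazzi_of DIM('e) c i j k = 0"
proof -
  let ?n = "DIM('e)"
  have G: "nab (u i) (u j) \<bullet> u k = christoffel c i j k" if "i < ?n" "j < ?n" "k < ?n" for i j k
    using koszul[of "u i" "u j" "u k"] that by (simp add: c christoffel_def)
  have expand: "x = (\<Sum>m<?n. (x \<bullet> u m) *\<^sub>R u m)" for x by (rule orthonormal_expansion[OF u])
  have nab_lin: "linear (\<lambda>x. nab x y)" for y using nab_bilinear by (simp add: bilinear_def)
  have r_lin: "linear (\<lambda>x. r x y)" "linear (r y)" for y using r_bilinear by (simp_all add: bilinear_def)
  have ric: "r (u i) (u j) = ricci_of ?n c i j" if ij: "i < ?n" "j < ?n" for i j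
  proof -
    have "R (u i) (u k) (u j) \<bullet> u k = (\<Sum>m<?n. c i k m * christoffel c m j k
     + christoffel c k j m * christoffel c i k m - christoffel c i j m * christoffel c k k m)"
      if k: "k < ?n" for k
    proof -
      have "nab (br (u i) (u k)) (u j) \<bullet> u k = (\<Sum>m<?n. c i k m * christoffel c m j k)"
        by (subst expand[of "br (u i) (u k)"])
          (simp add: linear_sum[OF nab_lin] linear_cmul[OF nab_lin] inner_sum_left ij k c G)
      moreover have "nab (u i) (nab (u k) (u j)) \<bullet> u k
          = - (\<Sum>m<?n. christoffel c k j m * christoffel c i k m)"
        unfolding nab_skew[of "u i" "nab (u k) (u j)"]
        by (subst inner_orthonormal[OF u]) (simp add: ij k G)
      moreover have "nab (u k) (nab (u i) (u j)) \<bullet> u k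
          = - (\<Sum>m<?n. christoffel c i j m * christoffel c k k m)"
        unfolding nab_skew[of "u k" "nab (u i) (u j)"]
        by (subst inner_orthonormal[OF u]) (simp add: ij k G)
      ultimately show ?thesis
        by (simp add: curv_def inner_add_left inner_diff_left sum.distrib sum_subtractf)
    qed
    then show ?thesis by (simp add: r_trace[OF u] ricci_of_def)
  qed
  have r1: "r (nab (u i) (u j)) (u k) = (\<Sum>m<?n. christoffel c i j m * ricci_of ?n c m k)"
    if "i < ?n" "j < ?n" "k < ?n" for i j k
    by (subst expand[of "nab (u i) (u j)"])
      (simp add: linear_sum[OF r_lin(1)] linear_cmul[OF r_lin(1)] that G ric)
  have r2: "r (u k) (nab (u i) (u j)) = (\<Sum>m<?n. christoffel c i j m * ricci_of ?n c k m)"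
    if "i < ?n" "j < ?n" "k < ?n" for i j k
    by (subst expand[of "nab (u i) (u j)"])
      (simp add: linear_sum[OF r_lin(2)] linear_cmul[OF r_lin(2)] that G ric)
  show ?thesis
    using codazzi[of "u i" "u j" "u k"] ijk
    by (simp add: nabla_ric_def r1 r2 codazzi_of_def sum.distrib sum_subtractf)
qed

end

section \<open>The algebras 2A2 and A4,12\<close>

text \<open>Structure constants in an orthonormal basis \<open>u\<close> whose first two vectors span the derived
  algebra: \<open>u 3\<close> acts on it with trace 0, which in a suitable basis means with zero diagonal, and
  \<open>u 2\<close> acts by \<open>a\<close> times the identity plus \<open>b\<close> times the action of \<open>u 3\<close>.\<close>

definition solvable_const :: "real \<Rightarrow> real \<Rightarrow> real \<Rightarrow> real \<Rightarrow> real \<Rightarrow> real \<Rightarrow> nat \<Rightarrow> nat \<Rightarrow> nat \<Rightarrow> real" where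
  "solvable_const a b p q s t i j k =
    (let f = (\<lambda>i j. if i = 2 \<and> j = 0 then [a, b * q, 0, 0] ! k
      else if i = 2 \<and> j = 1 then [b * p, a, 0, 0] ! k
      else if i = 3 \<and> j = 0 then [0, q, 0, 0] ! k
      else if i = 3 \<and> j = 1 then [p, 0, 0, 0] ! k
      else if i = 2 \<and> j = (3::nat) then [s, t, 0, 0] ! k else 0)
     in f i j - f j i)"

text \<open>Tabulated once, so that the Codazzi components, cubic in the structure constants, come
  from rewriting with quadratic entries.\<close>

lemma solvable_const_ricci:
  shows
  "ricci_of 4 (solvable_const a b p q s t) 0 0 = - (2 * a^2) + 1 / 2 * b^2 * p^2 - 1 / 2 * b^2 * q^2 + 1 / 2 * p^2 - 1 / 2 * q^2 + 1 / 2 *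
      s^2"
  and "ricci_of 4 (solvable_const a b p q s t) 0 1 = - (a * b * p) - a * b * q + 1 / 2 * s * t"
  and "ricci_of 4 (solvable_const a b p q s t) 1 0 = - (a * b * p) - a * b * q + 1 / 2 * s * t"
  and "ricci_of 4 (solvable_const a b p q s t) 0 2 = 1 / 2 * q * t"
  and "ricci_of 4 (solvable_const a b p q s t) 2 0 = 1 / 2 * q * t"
  and "ricci_of 4 (solvable_const a b p q s t) 0 3 = - (3 / 2 * a * s) - 1 / 2 * b * q * t"
  and "ricci_of 4 (solvable_const a b p q s t) 3 0 = - (3 / 2 * a * s) - 1 / 2 * b * q * t"
  and "ricci_of 4 (solvable_const a b p q s t) 1 1 = - (2 * a^2) - 1 / 2 * b^2 * p^2 + 1 / 2 * b^2 * q^2 - 1 / 2 * p^2 + 1 / 2 * q^2 + 1 / 2 *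
      t^2"
  and "ricci_of 4 (solvable_const a b p q s t) 1 2 = 1 / 2 * p * s"
  and "ricci_of 4 (solvable_const a b p q s t) 2 1 = 1 / 2 * p * s"
  and "ricci_of 4 (solvable_const a b p q s t) 1 3 = - (3 / 2 * a * t) - 1 / 2 * b * p * s"
  and "ricci_of 4 (solvable_const a b p q s t) 3 1 = - (3 / 2 * a * t) - 1 / 2 * b * p * s"
  and "ricci_of 4 (solvable_const a b p q s t) 2 2 = - (2 * a^2) - b^2 * p * q - 1 / 2 * b^2 * p^2 - 1 / 2 * b^2 * q^2 - 1 / 2 * s^2 - 1 / 2 *
      t^2"
  and "ricci_of 4 (solvable_const a b p q s t) 2 3 = - (b * p * q) - 1 / 2 * b * p^2 - 1 / 2 * b * q^2"
  and "ricci_of 4 (solvable_const a b p q s t) 3 2 = - (b * p * q) - 1 / 2 * b * p^2 - 1 / 2 * b * q^2"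
  and "ricci_of 4 (solvable_const a b p q s t) 3 3 = - (p * q) - 1 / 2 * p^2 - 1 / 2 * q^2 - 1 / 2 * s^2 - 1 / 2 * t^2"
  by (simp_all add: ricci_of_def christoffel_def solvable_const_def Let_def sum_lessThan_4 del: One_nat_def)
    (simp_all add: field_simps power2_eq_square)

text \<open>These two components remove the bracket of \<open>u 2\<close> and \<open>u 3\<close>:
  the first makes \<open>(p + q) * s * t\<close> zero, and the second is then
  \<open>9 / 4 * a\<close> times \<open>s^2 + t^2\<close>.\<close>

lemma solvable_const_codazzi:
  shows
  "codazzi_of 4 (solvable_const a b p q s t) 2 3 2 = - (3 / 4 * p * s * t) - 3 / 4 * q * s * t"
  and "codazzi_of 4 (solvable_const a b p q s t) 2 3 3 = 9 / 4 * a * s^2 + 9 / 4 * a * t^2 + 3 / 4 * b * p * s * t + 3 / 4 * b * q * s * t"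
  by (simp_all add: codazzi_of_def solvable_const_ricci christoffel_def solvable_const_def Let_def sum_lessThan_4 del: One_nat_def)
    (simp_all add: field_simps power2_eq_square power3_eq_cube)

lemma solvable_const0_ricci:
  shows
  "ricci_of 4 (solvable_const a b p q 0 0) 0 0 = - (2 * a^2) + 1 / 2 * b^2 * p^2 - 1 / 2 * b^2 * q^2 + 1 / 2 * p^2 - 1 / 2 * q^2"
  and "ricci_of 4 (solvable_const a b p q 0 0) 0 1 = - (a * b * p) - a * b * q"
  and "ricci_of 4 (solvable_const a b p q 0 0) 1 0 = - (a * b * p) - a * b * q"
  and "ricci_of 4 (solvable_const a b p q 0 0) 0 2 = 0"
  and "ricci_of 4 (solvable_const a b p q 0 0) 2 0 = 0"
  and "ricci_of 4 (solvable_const a b p q 0 0) 0 3 = 0"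
  and "ricci_of 4 (solvable_const a b p q 0 0) 3 0 = 0"
  and "ricci_of 4 (solvable_const a b p q 0 0) 1 1 = - (2 * a^2) - 1 / 2 * b^2 * p^2 + 1 / 2 * b^2 * q^2 - 1 / 2 * p^2 + 1 / 2 * q^2"
  and "ricci_of 4 (solvable_const a b p q 0 0) 1 2 = 0"
  and "ricci_of 4 (solvable_const a b p q 0 0) 2 1 = 0"
  and "ricci_of 4 (solvable_const a b p q 0 0) 1 3 = 0"
  and "ricci_of 4 (solvable_const a b p q 0 0) 3 1 = 0"
  and "ricci_of 4 (solvable_const a b p q 0 0) 2 2 = - (2 * a^2) - b^2 * p * q - 1 / 2 * b^2 * p^2 - 1 / 2 * b^2 * q^2"
  and "ricci_of 4 (solvable_const a b p q 0 0) 2 3 = - (b * p * q) - 1 / 2 * b * p^2 - 1 / 2 * b * q^2"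
  and "ricci_of 4 (solvable_const a b p q 0 0) 3 2 = - (b * p * q) - 1 / 2 * b * p^2 - 1 / 2 * b * q^2"
  and "ricci_of 4 (solvable_const a b p q 0 0) 3 3 = - (p * q) - 1 / 2 * p^2 - 1 / 2 * q^2"
  by (simp_all add: ricci_of_def christoffel_def solvable_const_def Let_def sum_lessThan_4 del: One_nat_def)
    (simp_all add: field_simps power2_eq_square)

text \<open>The first component is half of \<open>(b^2 + 1) * (q - p) * (q + p)^2\<close>, so
  \<open>q = - p\<close> or \<open>q = p\<close>. In the latter case with \<open>p\<close> nonzero,
  the second one determines \<open>a^2\<close> from \<open>b\<close> and \<open>p\<close>.\<close>

lemma solvable_const0_codazzi:
  shows
  "codazzi_of 4 (solvable_const a b p q 0 0) 0 1 3 = 1 / 2 * b^2 * p * q^2 - 1 / 2 * b^2 * p^2 * q - 1 / 2 * b^2 * p^3 + 1 / 2 * b^2 * q^3 + 1 /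
      2 * p * q^2 - 1 / 2 * p^2 * q - 1 / 2 * p^3 + 1 / 2 * q^3"
  and "codazzi_of 4 (solvable_const a b p q 0 0) 0 3 1 = - (a^2 * p) - a^2 * q + 1 / 2 * b^2 * p * q^2 + 1 / 2 * b^2 * p^3 + b^2 * q^3 + 1 / 2 * p *
      q^2 + 1 / 2 * p^3 + q^3"
  by (simp_all add: codazzi_of_def solvable_const0_ricci christoffel_def solvable_const_def Let_def sum_lessThan_4 del: One_nat_def)
    (simp_all add: field_simps power2_eq_square power3_eq_cube)

context euclidean_lie_algebra
begin

lemma br_orthonormal:
  assumes "orthonormal_family DIM('e) u"
  shows "br x y = (\<Sum>i<DIM('e). \<Sum>j<DIM('e). ((x \<bullet> u i) * (y \<bullet> u j)) *\<^sub>R br (u i) (u j))"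
proof -
  have "bilinear br" by (auto simp: bilinear_def br_simps intro!: linearI)
  then show ?thesis
    by (subst (1) orthonormal_expansion[OF assms, of x], subst (1) orthonormal_expansion[OF assms, of y])
      (simp add: bilinear_sum sum.cartesian_product bilinear_lmul bilinear_rmul)
qed

text \<open>The pairs \<open>u 0, u 2\<close> and \<open>u 1, u 3\<close> span commuting algebras
  with curvatures \<open>- k^2\<close> and \<open>- l^2\<close>: hyperbolic planes, flat if the
  constant is zero. \<open>N\<close> is the product connection.\<close>

lemma hyperbolic_plane_product_parallel:
  assumes dim: "DIM('e) = 4" and u: "orthonormal_family 4 u"
    and br: "br (u 2) (u 0) = k *\<^sub>R u 0" "br (u 3) (u 1) = l *\<^sub>R u 1" "br (u 0) (u 1) = 0"
      "br (u 2) (u 1) = 0" "br (u 3) (u 0) = 0" "br (u 2) (u 3) = 0"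
  shows "NR w x y z = 0"
proof -
  define N where "N x y = (k * (x \<bullet> u 0)) *\<^sub>R ((y \<bullet> u 0) *\<^sub>R u 2 - (y \<bullet> u 2) *\<^sub>R u 0)
    + (l * (x \<bullet> u 1)) *\<^sub>R ((y \<bullet> u 1) *\<^sub>R u 3 - (y \<bullet> u 3) *\<^sub>R u 1)" for x y
  have on: "u i \<bullet> u j = (if i = j then 1 else 0)" if "i < 4" "j < 4" for i j
    using u that by (simp add: orthonormal_family_def)
  have br': "br (u 0) (u 2) = - (k *\<^sub>R u 0)" "br (u 1) (u 3) = - (l *\<^sub>R u 1)" "br (u 1) (u 0) = 0"
      "br (u 1) (u 2) = 0" "br (u 0) (u 3) = 0" "br (u 3) (u 2) = 0"
    using br br_antisym[of "u 0" "u 2"] br_antisym[of "u 1" "u 3"] br_antisym[of "u 1" "u 0"]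
      br_antisym[of "u 1" "u 2"] br_antisym[of "u 0" "u 3"] br_antisym[of "u 3" "u 2"] by simp_all
  have nab: "nab x y = N x y" for x y
  proof (rule koszul_unique)
    show "br x y = N x y - N y x" for x y
      by (subst br_orthonormal, use u dim in simp,
          simp only: dim sum_lessThan_4 br br', simp add: N_def algebra_simps del: One_nat_def)
    show "N x y \<bullet> z = - (y \<bullet> N x z)" for x y z
      by (simp add: N_def inner_add_left inner_add_right inner_diff_left inner_diff_right
          inner_commute algebra_simps)
  qed
  show ?thesis
  proof (rule parallel_curvature[of "{0, 1::nat}" "\<lambda>i. if i = 0 then - k\<^sup>2 else - l\<^sup>2"
        "\<lambda>i x. if i = 0 then (x \<bullet> u 0) *\<^sub>R u 0 + (x \<bullet> u 2) *\<^sub>R u 2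
          else (x \<bullet> u 1) *\<^sub>R u 1 + (x \<bullet> u 3) *\<^sub>R u 3"])
  qed (simp_all add: nab N_def curv_def bracket_of_def on inner_add_left inner_diff_left
      inner_commute power2_eq_square algebra_simps del: One_nat_def)
qed

lemma solvable_parallel:
  assumes dim: "DIM('e) = 4" and u: "orthonormal_family 4 u" and a: "a \<noteq> 0"
    and br: "br (u 2) (u 0) = a *\<^sub>R u 0 + (b * q) *\<^sub>R u 1"
      "br (u 2) (u 1) = (b * p) *\<^sub>R u 0 + a *\<^sub>R u 1"
      "br (u 3) (u 0) = q *\<^sub>R u 1" "br (u 3) (u 1) = p *\<^sub>R u 0"
      "br (u 2) (u 3) = s *\<^sub>R u 0 + t *\<^sub>R u 1" "br (u 0) (u 1) = 0"
    and codazzi: "\<And>x y z. Nr x y z = Nr y x z"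
  shows "NR w x y z = 0"
proof -
  have on: "u i \<bullet> u j = (if i = j then 1 else 0)" if "i < 4" "j < 4" for i j
    using u that by (simp add: orthonormal_family_def)
  have u': "orthonormal_family DIM('e) u" using u dim by simp
  have br': "br (u 0) (u 2) = - (a *\<^sub>R u 0 + (b * q) *\<^sub>R u 1)"
      "br (u 1) (u 2) = - ((b * p) *\<^sub>R u 0 + a *\<^sub>R u 1)"
      "br (u 0) (u 3) = - (q *\<^sub>R u 1)" "br (u 1) (u 3) = - (p *\<^sub>R u 0)"
      "br (u 3) (u 2) = - (s *\<^sub>R u 0 + t *\<^sub>R u 1)" "br (u 1) (u 0) = 0"
    using br br_antisym[of "u 0" "u 2"] br_antisym[of "u 1" "u 2"] br_antisym[of "u 0" "u 3"]
      br_antisym[of "u 1" "u 3"] br_antisym[of "u 3" "u 2"] br_antisym[of "u 1" "u 0"] by simp_all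
  have "\<forall>i<4. \<forall>j<4. \<forall>k<4. br (u i) (u j) \<bullet> u k = solvable_const a b p q s t i j k"
    unfolding all_less_4
    by (simp add: br br' on inner_add_left inner_diff_left solvable_const_def Let_def
        del: One_nat_def)
  then have c: "codazzi_of 4 (solvable_const a b p q s t) i j k = 0" if "i < 4" "j < 4" "k < 4" for i j k
    using codazzi_structure_constants[OF u' _ codazzi, of "solvable_const a b p q s t" i j k] that
    by (simp add: dim)
  have pq: "(p + q) * (s * t) = 0"
    using c[of 2 3 2] by (simp add: solvable_const_codazzi algebra_simps)
  have "9 / 4 * a * (s\<^sup>2 + t\<^sup>2) + 3 / 4 * b * ((p + q) * (s * t)) = 0"
    using c[of 2 3 3] by (simp add: solvable_const_codazzi algebra_simps add_divide_distrib)
  from this[unfolded pq] have "s\<^sup>2 + t\<^sup>2 = 0" using a by (simp del: sum_power2_eq_zero_iff)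
  then have st: "s = 0" "t = 0" by (simp_all add: sum_power2_eq_zero_iff)
  note c0 = c[unfolded st] and br0 = br[unfolded st] br'[unfolded st]
  have "(b\<^sup>2 + 1) * ((q - p) * (q + p)\<^sup>2) = 0"
    using c0[of 0 1 3]
    by (simp add: solvable_const0_codazzi algebra_simps add_divide_distrib power2_eq_square power3_eq_cube
        del: One_nat_def)
  then have "(q - p) * (q + p)\<^sup>2 = 0"
    by (metis add_cancel_left_left le_add_same_cancel2 mult_eq_0_iff not_one_le_zero zero_le_power2)
  then have "q = - p \<or> q = p \<and> p \<noteq> 0" by (auto simp: add_eq_0_iff)
  then consider "q = - p" | "q = p" "p \<noteq> 0" by blast
  then show ?thesis
  proof cases
    case 1
    \<comment> \<open>For \<open>q = - p\<close> the action of \<open>u 3\<close> is an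
      infinitesimal rotation and contributes only the first, skew term. The second is the connection
      of hyperbolic 3-space of curvature \<open>- a^2\<close> on
      \<open>u 0, u 1, u 2\<close>.\<close>
    define N where "N x y = ((x \<bullet> u 2) * b * q + (x \<bullet> u 3) * q) *\<^sub>R
        ((y \<bullet> u 0) *\<^sub>R u 1 - (y \<bullet> u 1) *\<^sub>R u 0)
      + a *\<^sub>R (((x \<bullet> u 0) * (y \<bullet> u 0) + (x \<bullet> u 1) * (y \<bullet> u 1)) *\<^sub>R u 2
         - (y \<bullet> u 2) *\<^sub>R ((x \<bullet> u 0) *\<^sub>R u 0 + (x \<bullet> u 1) *\<^sub>R u 1))" for x y
    have nab: "nab x y = N x y" for x y
    proof (rule koszul_unique)
      show "br x y = N x y - N y x" for x y
        by (subst br_orthonormal[OF u'], simp only: dim sum_lessThan_4 br0,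
            simp add: 1 N_def algebra_simps del: One_nat_def)
      show "N x y \<bullet> z = - (y \<bullet> N x z)" for x y z
        by (simp add: N_def inner_add_left inner_add_right inner_diff_left inner_diff_right
            inner_commute algebra_simps)
    qed
    show ?thesis
      by (rule parallel_curvature[of "{0::nat}" "\<lambda>_. - a\<^sup>2"
          "\<lambda>_ x. (x \<bullet> u 0) *\<^sub>R u 0 + (x \<bullet> u 1) *\<^sub>R u 1 + (x \<bullet> u 2) *\<^sub>R u 2"])
        (simp_all add: nab N_def curv_def bracket_of_def on inner_add_left inner_diff_left
          inner_commute power2_eq_square algebra_simps del: One_nat_def)
  next
    case 2
    have "p * (a\<^sup>2 - (1 + b\<^sup>2) * p\<^sup>2) = 0"
      using c0[of 0 3 1]
      by (simp add: 2 solvable_const0_codazzi algebra_simps add_divide_distrib power2_eq_square power3_eq_cube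
          del: One_nat_def)
    then have "a\<^sup>2 = (1 + b\<^sup>2) * p\<^sup>2" using 2 by simp
    then have ab: "(a + b * p) * (a - b * p) = p * p"
      by (simp add: algebra_simps power2_eq_square)
    \<comment> \<open>\<open>u 0 + u 1\<close> and \<open>u 0 - u 1\<close> are joint eigenvectors
      of the actions of \<open>u 2\<close> and \<open>u 3\<close>, with weights
      \<open>(a + b * p, p)\<close> and \<open>(a - b * p, - p)\<close>. By \<open>ab\<close> the
      two weight vectors are orthogonal; normalised by their lengths \<open>k\<close> and
      \<open>l\<close> they become \<open>v 2\<close> and \<open>v 3\<close>.\<close>
    define k where "k = sqrt ((a + b * p)\<^sup>2 + p\<^sup>2)"
    define l where "l = sqrt ((a - b * p)\<^sup>2 + p\<^sup>2)"
    define h :: real where "h = 1 / sqrt 2"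
    have kl: "k \<noteq> 0" "l \<noteq> 0" using 2(2) by (simp_all add: k_def l_def sum_power2_eq_zero_iff)
    have k: "(a + b * p) * (a + b * p) + p * p = k * k" and l: "(a - b * p) * (a - b * p) + p * p = l * l"
      by (simp_all add: k_def l_def power2_eq_square)
    have h: "2 * (h * h) = 1" by (simp add: h_def)
    define v where "v i = (if i = 0 then h *\<^sub>R (u 0 + u 1) else if i = 1 then h *\<^sub>R (u 0 - u 1)
      else if i = 2 then (1 / k) *\<^sub>R ((a + b * p) *\<^sub>R u 2 + p *\<^sub>R u 3)
      else (1 / l) *\<^sub>R ((a - b * p) *\<^sub>R u 2 - p *\<^sub>R u 3))" for i :: nat
    have v: "v 0 = h *\<^sub>R (u 0 + u 1)" "v 1 = h *\<^sub>R (u 0 - u 1)"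
      "v 2 = (1 / k) *\<^sub>R ((a + b * p) *\<^sub>R u 2 + p *\<^sub>R u 3)"
      "v 3 = (1 / l) *\<^sub>R ((a - b * p) *\<^sub>R u 2 - p *\<^sub>R u 3)"
      by (simp_all add: v_def)
    show ?thesis
    proof (rule hyperbolic_plane_product_parallel[OF dim, of v k l])
      have "v 0 \<bullet> v 0 = 1" "v 1 \<bullet> v 1 = 1"
        using h by (simp_all add: v on inner_add_left inner_add_right inner_diff_left
            inner_diff_right algebra_simps del: One_nat_def)
      moreover have "v 2 \<bullet> v 2 = 1"
      proof -
        have "v 2 \<bullet> v 2 = ((a + b * p) * (a + b * p) + p * p) / (k * k)"
          by (simp add: v on inner_add_left inner_add_right del: One_nat_def)
            (simp add: add_divide_distrib)
        then show ?thesis using kl by (simp add: k)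
      qed
      moreover have "v 3 \<bullet> v 3 = 1"
      proof -
        have "v 3 \<bullet> v 3 = ((a - b * p) * (a - b * p) + p * p) / (l * l)"
          by (simp add: v on inner_diff_left inner_diff_right del: One_nat_def)
            (simp add: add_divide_distrib)
        then show ?thesis using kl by (simp add: l)
      qed
      moreover have "v 2 \<bullet> v 3 = 0"
      proof -
        have "v 2 \<bullet> v 3 = ((a + b * p) * (a - b * p) - p * p) / (k * l)"
          by (simp add: v on inner_add_left inner_add_right inner_diff_left inner_diff_right
              del: One_nat_def) (simp add: diff_divide_distrib)
        then show ?thesis by (simp add: ab)
      qed
      moreover have "v 0 \<bullet> v 1 = 0" "v 0 \<bullet> v 2 = 0" "v 0 \<bullet> v 3 = 0" "v 1 \<bullet> v 2 = 0" "v 1 \<bullet> v 3 = 0"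
        by (simp_all add: v on inner_add_left inner_add_right inner_diff_left inner_diff_right
              del: One_nat_def)
      ultimately show "orthonormal_family 4 v"
        unfolding orthonormal_family_def all_less_4 by (simp add: inner_commute del: One_nat_def)
      define f where "f = u 0 + u 1"
      define f' where "f' = u 0 - u 1"
      have e: "br (u 2) f = (a + b * p) *\<^sub>R f" "br (u 3) f = p *\<^sub>R f"
        "br (u 2) f' = (a - b * p) *\<^sub>R f'" "br (u 3) f' = (- p) *\<^sub>R f'"
        by (simp_all add: f_def f'_def br_simps br0 2 algebra_simps del: One_nat_def)
      note v_br = v[folded f_def f'_def] e br_simps(1,3,7,8) scaleR_scaleR scaleR_right_distrib scaleR_right_diff_distrib
        scaleR_left_distrib[symmetric] scaleR_left_diff_distrib[symmetric]
      have "br (v 2) (v 0) = (h / k * ((a + b * p) * (a + b * p) + p * p)) *\<^sub>R f"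
        by (simp only: v_br) (simp add: algebra_simps add_divide_distrib)
      then show "br (v 2) (v 0) = k *\<^sub>R v 0" using kl by (simp add: k v_br(1,2) mult.commute del: One_nat_def)
      have "br (v 3) (v 1) = (h / l * ((a - b * p) * (a - b * p) + p * p)) *\<^sub>R f'"
        by (simp only: v_br) (simp add: algebra_simps add_divide_distrib diff_divide_distrib)
      then show "br (v 3) (v 1) = l *\<^sub>R v 1" using kl by (simp add: l v_br(1,2) mult.commute del: One_nat_def)
      have "br (v 2) (v 1) = (h / k * ((a + b * p) * (a - b * p) - p * p)) *\<^sub>R f'"
        by (simp only: v_br) (simp add: algebra_simps add_divide_distrib diff_divide_distrib)
      then show "br (v 2) (v 1) = 0" by (simp add: ab)
      have "br (v 3) (v 0) = (h / l * ((a + b * p) * (a - b * p) - p * p)) *\<^sub>R f"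
        by (simp only: v_br) (simp add: algebra_simps add_divide_distrib diff_divide_distrib)
      then show "br (v 3) (v 0) = 0" by (simp add: ab)
      show "br (v 0) (v 1) = 0" "br (v 2) (v 3) = 0"
        by (simp_all only: v br_simps br0 br_self) simp_all
    qed
  qed
qed

end

section \<open>The algebra su(2) + R\<close>

text \<open>\<open>u 1, u 2, u 3\<close> is a Milnor basis of \<open>su(2)\<close>, and \<open>u 0\<close> acts on \<open>su(2)\<close> as
  \<open>ad (x u\<^sub>1 + y u\<^sub>2 + z u\<^sub>3)\<close>, because every derivation of \<open>su(2)\<close> is inner.\<close>

definition su2_const :: "real \<Rightarrow> real \<Rightarrow> real \<Rightarrow> real \<Rightarrow> real \<Rightarrow> real \<Rightarrow> nat \<Rightarrow> nat \<Rightarrow> nat \<Rightarrow> real" where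
  "su2_const a b c x y z i j k =
    (let f = (\<lambda>i j. if i = 1 \<and> j = 2 then [0, 0, 0, c] ! k
      else if i = 2 \<and> j = 3 then [0, a, 0, 0] ! k
      else if i = 3 \<and> j = 1 then [0, 0, b, 0] ! k
      else if i = 0 \<and> j = 1 then [0, 0, z * b, - y * c] ! k
      else if i = 0 \<and> j = 2 then [0, - z * a, 0, x * c] ! k
      else if i = 0 \<and> j = (3::nat) then [0, y * a, - x * b, 0] ! k else 0)
     in f i j - f j i)"

lemma su2_const_ricci:
  shows
  "ricci_of 4 (su2_const a b c x y z) 0 0 = a * b * z^2 + a * c * y^2 - 1 / 2 * a^2 * y^2 - 1 / 2 * a^2 * z^2 + b * c * x^2 - 1 / 2 *
      b^2 * x^2 - 1 / 2 * b^2 * z^2 - 1 / 2 * c^2 * x^2 - 1 / 2 * c^2 * y^2"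
  and "ricci_of 4 (su2_const a b c x y z) 0 1 = b * c * x - 1 / 2 * b^2 * x - 1 / 2 * c^2 * x"
  and "ricci_of 4 (su2_const a b c x y z) 1 0 = b * c * x - 1 / 2 * b^2 * x - 1 / 2 * c^2 * x"
  and "ricci_of 4 (su2_const a b c x y z) 0 2 = a * c * y - 1 / 2 * a^2 * y - 1 / 2 * c^2 * y"
  and "ricci_of 4 (su2_const a b c x y z) 2 0 = a * c * y - 1 / 2 * a^2 * y - 1 / 2 * c^2 * y"
  and "ricci_of 4 (su2_const a b c x y z) 0 3 = a * b * z - 1 / 2 * a^2 * z - 1 / 2 * b^2 * z"
  and "ricci_of 4 (su2_const a b c x y z) 3 0 = a * b * z - 1 / 2 * a^2 * z - 1 / 2 * b^2 * z"
  and "ricci_of 4 (su2_const a b c x y z) 1 1 = 1 / 2 * a^2 + 1 / 2 * a^2 * y^2 + 1 / 2 * a^2 * z^2 + b * c - 1 / 2 * b^2 - 1 / 2 * b^2 *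
      z^2 - 1 / 2 * c^2 - 1 / 2 * c^2 * y^2"
  and "ricci_of 4 (su2_const a b c x y z) 1 2 = - (1 / 2 * a * b * x * y) + 1 / 2 * c^2 * x * y"
  and "ricci_of 4 (su2_const a b c x y z) 2 1 = - (1 / 2 * a * b * x * y) + 1 / 2 * c^2 * x * y"
  and "ricci_of 4 (su2_const a b c x y z) 1 3 = - (1 / 2 * a * c * x * z) + 1 / 2 * b^2 * x * z"
  and "ricci_of 4 (su2_const a b c x y z) 3 1 = - (1 / 2 * a * c * x * z) + 1 / 2 * b^2 * x * z"
  and "ricci_of 4 (su2_const a b c x y z) 2 2 = a * c - 1 / 2 * a^2 - 1 / 2 * a^2 * z^2 + 1 / 2 * b^2 + 1 / 2 * b^2 * x^2 + 1 / 2 * b^2 *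
      z^2 - 1 / 2 * c^2 - 1 / 2 * c^2 * x^2"
  and "ricci_of 4 (su2_const a b c x y z) 2 3 = 1 / 2 * a^2 * y * z - 1 / 2 * b * c * y * z"
  and "ricci_of 4 (su2_const a b c x y z) 3 2 = 1 / 2 * a^2 * y * z - 1 / 2 * b * c * y * z"
  and "ricci_of 4 (su2_const a b c x y z) 3 3 = a * b - 1 / 2 * a^2 - 1 / 2 * a^2 * y^2 - 1 / 2 * b^2 - 1 / 2 * b^2 * x^2 + 1 / 2 * c^2 + 1
      / 2 * c^2 * x^2 + 1 / 2 * c^2 * y^2"
  by (simp_all add: ricci_of_def christoffel_def su2_const_def Let_def sum_lessThan_4 del: One_nat_def)
    (simp_all add: field_simps power2_eq_square)

lemma su2_const_codazzi:
  shows
  "codazzi_of 4 (su2_const a b c x y z) 1 2 0 = - (1 / 4 * a * b * c * x^2 * z) - 1 / 4 * a * b * c * y^2 * z - 1 / 4 * a * b^2 * x^2 * z -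
      1 / 2 * a * b^2 * z - 1 / 2 * a * b^2 * z^3 + 1 / 2 * a * c^2 * x^2 * z - 1 / 4 * a * c^2 *
      y^2 * z - 1 / 4 * a^2 * b * y^2 * z - 1 / 2 * a^2 * b * z - 1 / 2 * a^2 * b * z^3 - 1 / 4 *
      a^2 * c * y^2 * z + 1 / 2 * a^3 * y^2 * z + 1 / 2 * a^3 * z + 1 / 2 * a^3 * z^3 - 1 / 4 * b
      * c^2 * x^2 * z + 1 / 2 * b * c^2 * y^2 * z - 1 / 4 * b^2 * c * x^2 * z + 1 / 2 * b^3 * x^2
      * z + 1 / 2 * b^3 * z + 1 / 2 * b^3 * z^3"
  and "codazzi_of 4 (su2_const a b c x y z) 1 2 1 = - (3 / 4 * a * b * c * x * z) + a * c^2 * x * z + 1 / 4 * a^2 * c * x * z - 1 / 4 * b * c^2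
      * x * z - 1 / 4 * b^2 * c * x * z"
  and "codazzi_of 4 (su2_const a b c x y z) 1 2 2 = - (3 / 4 * a * b * c * y * z) - 1 / 4 * a * c^2 * y * z - 1 / 4 * a^2 * c * y * z + b * c^2
      * y * z + 1 / 4 * b^2 * c * y * z"
  and "codazzi_of 4 (su2_const a b c x y z) 1 2 3 = - (1 / 2 * a * b^2) - 1 / 4 * a * b^2 * x^2 - 1 / 2 * a * b^2 * z^2 + 1 / 2 * a * c^2 + 1 /
      4 * a * c^2 * x^2 + 1 / 2 * a * c^2 * y^2 - 1 / 2 * a^2 * b - 1 / 4 * a^2 * b * y^2 - 1 / 2
      * a^2 * b * z^2 + 1 / 2 * a^3 + 1 / 2 * a^3 * y^2 + 1 / 2 * a^3 * z^2 + 1 / 2 * b * c^2 + 1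
      / 2 * b * c^2 * x^2 + 1 / 4 * b * c^2 * y^2 + 1 / 2 * b^3 + 1 / 2 * b^3 * x^2 + 1 / 2 * b^3
      * z^2 - c^3 - c^3 * x^2 - c^3 * y^2"
  and "codazzi_of 4 (su2_const a b c x y z) 1 3 0 = 1 / 4 * a * b * c * x^2 * y + 1 / 4 * a * b * c * y * z^2 - 1 / 2 * a * b^2 * x^2 * y + 1 /
      4 * a * b^2 * y * z^2 + 1 / 4 * a * c^2 * x^2 * y + 1 / 2 * a * c^2 * y + 1 / 2 * a * c^2 *
      y^3 + 1 / 4 * a^2 * b * y * z^2 + 1 / 2 * a^2 * c * y + 1 / 4 * a^2 * c * y * z^2 + 1 / 2 *
      a^2 * c * y^3 - 1 / 2 * a^3 * y - 1 / 2 * a^3 * y * z^2 - 1 / 2 * a^3 * y^3 + 1 / 4 * b *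
      c^2 * x^2 * y + 1 / 4 * b^2 * c * x^2 * y - 1 / 2 * b^2 * c * y * z^2 - 1 / 2 * c^3 * x^2 *
      y - 1 / 2 * c^3 * y - 1 / 2 * c^3 * y^3"
  and "codazzi_of 4 (su2_const a b c x y z) 1 3 1 = 3 / 4 * a * b * c * x * y - a * b^2 * x * y - 1 / 4 * a^2 * b * x * y + 1 / 4 * b * c^2 * x
      * y + 1 / 4 * b^2 * c * x * y"
  and "codazzi_of 4 (su2_const a b c x y z) 1 3 2 = - (1 / 2 * a * b^2) - 1 / 4 * a * b^2 * x^2 - 1 / 2 * a * b^2 * z^2 + 1 / 2 * a * c^2 + 1 /
      4 * a * c^2 * x^2 + 1 / 2 * a * c^2 * y^2 + 1 / 2 * a^2 * c + 1 / 2 * a^2 * c * y^2 + 1 / 4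
      * a^2 * c * z^2 - 1 / 2 * a^3 - 1 / 2 * a^3 * y^2 - 1 / 2 * a^3 * z^2 - 1 / 2 * b^2 * c - 1
      / 2 * b^2 * c * x^2 - 1 / 4 * b^2 * c * z^2 + b^3 + b^3 * x^2 + b^3 * z^2 - 1 / 2 * c^3 - 1
      / 2 * c^3 * x^2 - 1 / 2 * c^3 * y^2"
  and "codazzi_of 4 (su2_const a b c x y z) 1 3 3 = 3 / 4 * a * b * c * y * z + 1 / 4 * a * b^2 * y * z + 1 / 4 * a^2 * b * y * z - 1 / 4 * b *
      c^2 * y * z - b^2 * c * y * z"
  and "codazzi_of 4 (su2_const a b c x y z) 2 3 0 = - (1 / 4 * a * b * c * x * y^2) - 1 / 4 * a * b * c * x * z^2 - 1 / 4 * a * b^2 * x * z^2 -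
      1 / 4 * a * c^2 * x * y^2 + 1 / 2 * a^2 * b * x * y^2 - 1 / 4 * a^2 * b * x * z^2 - 1 / 4 *
      a^2 * c * x * y^2 + 1 / 2 * a^2 * c * x * z^2 - 1 / 2 * b * c^2 * x - 1 / 4 * b * c^2 * x *
      y^2 - 1 / 2 * b * c^2 * x^3 - 1 / 2 * b^2 * c * x - 1 / 4 * b^2 * c * x * z^2 - 1 / 2 * b^2
      * c * x^3 + 1 / 2 * b^3 * x + 1 / 2 * b^3 * x * z^2 + 1 / 2 * b^3 * x^3 + 1 / 2 * c^3 * x +
      1 / 2 * c^3 * x * y^2 + 1 / 2 * c^3 * x^3"
  and "codazzi_of 4 (su2_const a b c x y z) 2 3 1 = 1 / 2 * a^2 * b + 1 / 4 * a^2 * b * y^2 + 1 / 2 * a^2 * b * z^2 + 1 / 2 * a^2 * c + 1 / 2 *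
      a^2 * c * y^2 + 1 / 4 * a^2 * c * z^2 - a^3 - a^3 * y^2 - a^3 * z^2 - 1 / 2 * b * c^2 - 1 /
      2 * b * c^2 * x^2 - 1 / 4 * b * c^2 * y^2 - 1 / 2 * b^2 * c - 1 / 2 * b^2 * c * x^2 - 1 / 4
      * b^2 * c * z^2 + 1 / 2 * b^3 + 1 / 2 * b^3 * x^2 + 1 / 2 * b^3 * z^2 + 1 / 2 * c^3 + 1 / 2
      * c^3 * x^2 + 1 / 2 * c^3 * y^2"
  and "codazzi_of 4 (su2_const a b c x y z) 2 3 2 = - (3 / 4 * a * b * c * x * y) + 1 / 4 * a * b^2 * x * y - 1 / 4 * a * c^2 * x * y + a^2 * b
      * x * y - 1 / 4 * a^2 * c * x * y"
  and "codazzi_of 4 (su2_const a b c x y z) 2 3 3 = - (3 / 4 * a * b * c * x * z) - 1 / 4 * a * b^2 * x * z + 1 / 4 * a * c^2 * x * z - 1 / 4 *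
      a^2 * b * x * z + a^2 * c * x * z"
  by (simp_all add: codazzi_of_def su2_const_ricci christoffel_def su2_const_def Let_def sum_lessThan_4 del: One_nat_def)
    (simp_all add: field_simps power2_eq_square power3_eq_cube)


text \<open>The two equations are what the Codazzi equation says when two of the three coordinates of
  the vector \<open>(x, y, z)\<close> in \<open>su2_const\<close> are nonzero; \<open>su2_no_direction\<close> is the case in which all
  three are zero.\<close>

lemma su2_two_directions:
  fixes a b c :: real
  assumes "a > 0" "b > 0" "c > 0"
    and e1: "a\<^sup>2 - b\<^sup>2 - 3 * a * b + 4 * a * c - b * c = 0"
    and e2: "c\<^sup>2 - b\<^sup>2 - 3 * b * c + 4 * a * c - a * b = 0"
  shows "a = b \<and> b = c"
proof -
  \<comment> \<open>The difference of \<open>e1\<close> and \<open>e2\<close> factors.\<close>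
  have "(a - c) * (a + c - 2 * b) = 0" using e1 e2 by (simp add: power2_eq_square algebra_simps)
  then consider "c = a" | "c = 2 * b - a" by force
  then show ?thesis
  proof cases
    case 1
    have "(a - b) * (5 * a + b) = 0"
      using e1 unfolding 1 by (simp add: power2_eq_square algebra_simps)
    moreover have "5 * a + b > 0" using assms by simp
    ultimately show ?thesis using 1 by auto
  next
    case 2
    have "(a - b)\<^sup>2 = 0"
      using e1 unfolding 2 by (simp add: power2_eq_square algebra_simps)
    then show ?thesis using 2 by simp
  qed
qed

lemma su2_no_direction:
  fixes a b c :: real
  assumes "a > 0" "b > 0" "c > 0" "a \<le> b" "a \<le> c"
    and 1: "a\<^sup>2 * (2 * a - b - c) = (b + c) * (b - c)\<^sup>2"
  shows "a = b \<and> b = c"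
proof -
  \<comment> \<open>Since \<open>a\<close> is the smallest constant, the two sides of the equation
    have opposite signs, so both vanish.\<close>
  have "a\<^sup>2 * (2 * a - b - c) \<le> 0" using assms by (intro mult_nonneg_nonpos) auto
  moreover have "(b + c) * (b - c)\<^sup>2 \<ge> 0" using assms by simp
  ultimately have "(b + c) * (b - c)\<^sup>2 = 0" "a\<^sup>2 * (2 * a - b - c) = 0" using 1 by linarith+
  then show ?thesis using assms by auto
qed

text \<open>The cases count the nonzero coordinates of \<open>(x, y, z)\<close>. Two of them give
  the equations of \<open>su2_two_directions\<close>. Exactly one makes a component force the other
  two constants equal, and a second component then settles the third. With none, the equations are
  those of \<open>su(2)\<close> alone.\<close>

lemma su2_codazzi_imp_round:
  assumes pos: "a > 0" "b > 0" "c > 0"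
    and cod: "\<And>i j k. i < 4 \<Longrightarrow> j < 4 \<Longrightarrow> k < 4 \<Longrightarrow> codazzi_of 4 (su2_const a b c x y z) i j k = 0"
  shows "a = b \<and> b = c"
proof -
  have xz: ?thesis if "x \<noteq> 0" "z \<noteq> 0"
  proof -
    have "x * z * c * (a\<^sup>2 - b\<^sup>2 - 3 * a * b + 4 * a * c - b * c) = 4 * codazzi_of 4 (su2_const a b c x y z) 1 2 1"
      unfolding su2_const_codazzi by (simp add: power2_eq_square algebra_simps)
    moreover have "x * z * a * (c\<^sup>2 - b\<^sup>2 - 3 * b * c + 4 * a * c - a * b) = 4 * codazzi_of 4 (su2_const a b c x y z) 2 3 3"
      unfolding su2_const_codazzi by (simp add: power2_eq_square algebra_simps)
    ultimately show ?thesis using that pos cod by (intro su2_two_directions) auto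
  qed
  have yz: ?thesis if "y \<noteq> 0" "z \<noteq> 0"
  proof -
    have "y * z * c * (b\<^sup>2 - a\<^sup>2 - 3 * b * a + 4 * b * c - a * c) = 4 * codazzi_of 4 (su2_const a b c x y z) 1 2 2"
      unfolding su2_const_codazzi by (simp add: power2_eq_square algebra_simps)
    moreover have "y * z * b * (c\<^sup>2 - a\<^sup>2 - 3 * a * c + 4 * b * c - b * a) = - 4 * codazzi_of 4 (su2_const a b c x y z) 1 3 3"
      unfolding su2_const_codazzi by (simp add: power2_eq_square algebra_simps)
    ultimately show ?thesis using that pos cod su2_two_directions[of b a c] by auto
  qed
  have xy: ?thesis if "x \<noteq> 0" "y \<noteq> 0"
  proof -
    have "x * y * b * (a\<^sup>2 - c\<^sup>2 - 3 * a * c + 4 * a * b - c * b) = - 4 * codazzi_of 4 (su2_const a b c x y z) 1 3 1"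
      unfolding su2_const_codazzi by (simp add: power2_eq_square algebra_simps)
    moreover have "x * y * a * (b\<^sup>2 - c\<^sup>2 - 3 * c * b + 4 * a * b - a * c) = 4 * codazzi_of 4 (su2_const a b c x y z) 2 3 2"
      unfolding su2_const_codazzi by (simp add: power2_eq_square algebra_simps)
    ultimately show ?thesis using that pos cod su2_two_directions[of a c b] by auto
  qed
  have nz: "1 + t\<^sup>2 \<noteq> 0" for t :: real by (metis add_pos_nonneg less_irrefl zero_le_power2 zero_less_one)
  have x0: ?thesis if "x \<noteq> 0" "y = 0" "z = 0"
  proof -
    have "x * (1 + x\<^sup>2) * (b + c) * (b - c)\<^sup>2 = 2 * codazzi_of 4 (su2_const a b c x y z) 2 3 0"
      unfolding su2_const_codazzi using that by (simp add: power2_eq_square power3_eq_cube algebra_simps)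
    then have bc: "b = c" using that pos cod nz[of x] by auto
    have "a\<^sup>2 * (b - a) = codazzi_of 4 (su2_const a b c x y z) 2 3 1"
      unfolding su2_const_codazzi using that bc by (simp add: power2_eq_square power3_eq_cube algebra_simps)
    then show ?thesis using bc pos cod by auto
  qed
  have y0: ?thesis if "y \<noteq> 0" "x = 0" "z = 0"
  proof -
    have "y * (1 + y\<^sup>2) * (a + c) * (a - c)\<^sup>2 = - 2 * codazzi_of 4 (su2_const a b c x y z) 1 3 0"
      unfolding su2_const_codazzi using that by (simp add: power2_eq_square power3_eq_cube algebra_simps)
    then have ac: "a = c" using that pos cod nz[of y] by auto
    have "b\<^sup>2 * (b - a) = codazzi_of 4 (su2_const a b c x y z) 1 3 2"
      unfolding su2_const_codazzi using that ac by (simp add: power2_eq_square power3_eq_cube algebra_simps)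
    then show ?thesis using ac pos cod by auto
  qed
  have z0: ?thesis if "z \<noteq> 0" "x = 0" "y = 0"
  proof -
    have "z * (1 + z\<^sup>2) * (a + b) * (a - b)\<^sup>2 = 2 * codazzi_of 4 (su2_const a b c x y z) 1 2 0"
      unfolding su2_const_codazzi using that by (simp add: power2_eq_square power3_eq_cube algebra_simps)
    then have ab: "a = b" using that pos cod nz[of z] by auto
    have "c\<^sup>2 * (a - c) = codazzi_of 4 (su2_const a b c x y z) 1 2 3"
      unfolding su2_const_codazzi using that ab by (simp add: power2_eq_square power3_eq_cube algebra_simps)
    then show ?thesis using ab pos cod by auto
  qed
  have ?thesis if "x = 0" "y = 0" "z = 0"
  proof -
    have a: "a\<^sup>2 * (2 * a - b - c) - (b + c) * (b - c)\<^sup>2 = - 2 * codazzi_of 4 (su2_const a b c x y z) 2 3 1"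
      unfolding su2_const_codazzi using that by (simp add: power2_eq_square power3_eq_cube algebra_simps)
    have b: "b\<^sup>2 * (2 * b - c - a) - (c + a) * (c - a)\<^sup>2 = 2 * codazzi_of 4 (su2_const a b c x y z) 1 3 2"
      unfolding su2_const_codazzi using that by (simp add: power2_eq_square power3_eq_cube algebra_simps)
    have c: "c\<^sup>2 * (2 * c - a - b) - (a + b) * (a - b)\<^sup>2 = - 2 * codazzi_of 4 (su2_const a b c x y z) 1 2 3"
      unfolding su2_const_codazzi using that by (simp add: power2_eq_square power3_eq_cube algebra_simps)
    \<comment> \<open>The three equations are cyclic permutations of one another, so the argument
      can start from the smallest constant.\<close>
    consider "a \<le> b \<and> a \<le> c" | "b \<le> c \<and> b \<le> a" | "c \<le> a \<and> c \<le> b" by linarith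
    then show ?thesis
    proof cases
      case 1
      then show ?thesis using su2_no_direction[of a b c] pos a cod[of 2 3 1] by simp
    next
      case 2
      then show ?thesis using su2_no_direction[of b c a] pos b cod[of 1 3 2] by (simp del: One_nat_def)
    next
      case 3
      then show ?thesis using su2_no_direction[of c a b] pos c cod[of 1 2 3] by (simp del: One_nat_def)
    qed
  qed
  then show ?thesis using xz yz xy x0 y0 z0 by blast
qed

context euclidean_lie_algebra
begin

lemma su2_parallel:
  assumes dim: "DIM('e) = 4" and u: "orthonormal_family 4 u" and pos: "a > 0" "b > 0" "c > 0"
    and br: "br (u 1) (u 2) = c *\<^sub>R u 3" "br (u 2) (u 3) = a *\<^sub>R u 1" "br (u 3) (u 1) = b *\<^sub>R u 2"
      "br (u 0) (u 1) = (h3 * b) *\<^sub>R u 2 - (h2 * c) *\<^sub>R u 3"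
      "br (u 0) (u 2) = (h1 * c) *\<^sub>R u 3 - (h3 * a) *\<^sub>R u 1"
      "br (u 0) (u 3) = (h2 * a) *\<^sub>R u 1 - (h1 * b) *\<^sub>R u 2"
    and codazzi: "\<And>x y z. Nr x y z = Nr y x z"
  shows "NR w x y z = 0"
proof -
  have on: "u i \<bullet> u j = (if i = j then 1 else 0)" if "i < 4" "j < 4" for i j
    using u that by (simp add: orthonormal_family_def)
  have u': "orthonormal_family DIM('e) u" using u dim by simp
  have br': "br (u 2) (u 1) = - (c *\<^sub>R u 3)" "br (u 3) (u 2) = - (a *\<^sub>R u 1)"
      "br (u 1) (u 3) = - (b *\<^sub>R u 2)"
      "br (u 1) (u 0) = (h2 * c) *\<^sub>R u 3 - (h3 * b) *\<^sub>R u 2"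
      "br (u 2) (u 0) = (h3 * a) *\<^sub>R u 1 - (h1 * c) *\<^sub>R u 3"
      "br (u 3) (u 0) = (h1 * b) *\<^sub>R u 2 - (h2 * a) *\<^sub>R u 1"
    using br br_antisym[of "u 2" "u 1"] br_antisym[of "u 3" "u 2"] br_antisym[of "u 1" "u 3"]
      br_antisym[of "u 1" "u 0"] br_antisym[of "u 2" "u 0"] br_antisym[of "u 3" "u 0"] by simp_all
  have "\<forall>i<4. \<forall>j<4. \<forall>k<4. br (u i) (u j) \<bullet> u k = su2_const a b c h1 h2 h3 i j k"
    unfolding all_less_4
    by (simp add: br br' on inner_diff_left su2_const_def Let_def del: One_nat_def)
  then have cod: "codazzi_of 4 (su2_const a b c h1 h2 h3) i j k = 0" if "i < 4" "j < 4" "k < 4" for i j k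
    using codazzi_structure_constants[OF u' _ codazzi, of "su2_const a b c h1 h2 h3" i j k] that
    by (simp add: dim)
  have abc: "a = c" "b = c" using su2_codazzi_imp_round[OF pos cod] by auto
  \<comment> \<open>The cross product of \<open>(p, q, r)\<close> with the coordinates of
    \<open>w\<close> along \<open>u 1, u 2, u 3\<close>. On \<open>su(2)\<close> the connection
    \<open>N\<close> is half the bracket, as for every bi-invariant metric; \<open>u 0\<close> adds
    its skew action.\<close>
  define X where "X p q r w = (q * (w \<bullet> u 3) - r * (w \<bullet> u 2)) *\<^sub>R u 1
    + (r * (w \<bullet> u 1) - p * (w \<bullet> u 3)) *\<^sub>R u 2
    + (p * (w \<bullet> u 2) - q * (w \<bullet> u 1)) *\<^sub>R u 3" for p q r w
  define N where "N x y = (c / 2) *\<^sub>R X (x \<bullet> u 1) (x \<bullet> u 2) (x \<bullet> u 3) y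
    + ((x \<bullet> u 0) * c) *\<^sub>R X h1 h2 h3 y" for x y
  have nab: "nab x y = N x y" for x y
  proof (rule koszul_unique)
    fix x y z
    have br_xy: "br x y = c *\<^sub>R X (x \<bullet> u 1) (x \<bullet> u 2) (x \<bullet> u 3) y
      + ((x \<bullet> u 0) * c) *\<^sub>R X h1 h2 h3 y - ((y \<bullet> u 0) * c) *\<^sub>R X h1 h2 h3 x"
      by (subst br_orthonormal[OF u'], simp only: dim sum_lessThan_4 br br' br_self abc,
          simp add: X_def algebra_simps del: One_nat_def)
    have "c *\<^sub>R X (x \<bullet> u 1) (x \<bullet> u 2) (x \<bullet> u 3) y = (c / 2) *\<^sub>R X (x \<bullet> u 1) (x \<bullet> u 2) (x \<bullet> u 3) y
      - (c / 2) *\<^sub>R X (y \<bullet> u 1) (y \<bullet> u 2) (y \<bullet> u 3) x"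
    proof -
      have "X (y \<bullet> u 1) (y \<bullet> u 2) (y \<bullet> u 3) x = - X (x \<bullet> u 1) (x \<bullet> u 2) (x \<bullet> u 3) y"
        by (simp add: X_def algebra_simps del: One_nat_def)
      then show ?thesis by (simp add: scaleR_left_distrib[symmetric])
    qed
    then show "br x y = N x y - N y x"
      by (simp add: br_xy N_def algebra_simps del: One_nat_def)
    show "N x y \<bullet> z = - (y \<bullet> N x z)"
      by (simp add: N_def X_def inner_add_left inner_add_right
          inner_commute algebra_simps del: One_nat_def)
  qed
  have X_on: "X p q r w \<bullet> u 0 = 0" "X p q r w \<bullet> u 1 = q * (w \<bullet> u 3) - r * (w \<bullet> u 2)"
    "X p q r w \<bullet> u 2 = r * (w \<bullet> u 1) - p * (w \<bullet> u 3)"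
    "X p q r w \<bullet> u 3 = p * (w \<bullet> u 2) - q * (w \<bullet> u 1)" for p q r w
    by (simp_all add: X_def on inner_add_left del: One_nat_def)
  define P where "P x = (x \<bullet> u 1) *\<^sub>R u 1 + (x \<bullet> u 2) *\<^sub>R u 2 + (x \<bullet> u 3) *\<^sub>R u 3" for x
  have zero: "v = 0" if "\<And>i. i < 4 \<Longrightarrow> v \<bullet> u i = 0" for v
    using orthonormal_expansion[OF u', of v] that by (simp add: dim)
  show ?thesis
  proof (rule parallel_curvature[of "{0::nat}" "\<lambda>_. c\<^sup>2 / 4"
        "\<lambda>_. P"])
    fix x y z k
    show "P (nab x y) = nab x (P y)"
      unfolding nab by (simp add: P_def N_def X_def on inner_add_left algebra_simps del: One_nat_def)
    have "(R x y z - (c\<^sup>2 / 4) *\<^sub>R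
      ((P x \<bullet> z) *\<^sub>R P y
      - (P y \<bullet> z) *\<^sub>R P x)) \<bullet> u i = 0"
      if "i < 4" for i
    proof -
      have z: "u i \<bullet> z = z \<bullet> u i" for i by (rule inner_commute)
      have "i = 0 \<or> i = 1 \<or> i = 2 \<or> i = 3" using that by auto
      then show ?thesis
        unfolding curv_def bracket_of_def nab N_def P_def
        by (elim disjE; hypsubst)
          (simp_all only: X_on inner_add_left inner_diff_left inner_scaleR_left z on mult_zero_right
            mult_zero_left zero_less_numeral, simp_all add: on field_simps power2_eq_square del: One_nat_def)
    qed
    then show "R x y z = (\<Sum>k\<in>{0::nat}. (c\<^sup>2 / 4) *\<^sub>R
      ((P x \<bullet> z) *\<^sub>R P y
      - (P y \<bullet> z) *\<^sub>R P x))"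
      by (subst eq_iff_diff_eq_0, intro zero) simp
  qed simp
qed

end

section \<open>The Lie algebras of the classification\<close>

lemma A4_6_apply: "A4_6 \<alpha> \<beta> x y = (x $ 1 * y $ 4 - x $ 4 * y $ 1) *\<^sub>R (\<alpha> *\<^sub>R bv 1)
    + (x $ 2 * y $ 4 - x $ 4 * y $ 2) *\<^sub>R (\<beta> *\<^sub>R bv 2 - bv 3)
    + (x $ 3 * y $ 4 - x $ 4 * y $ 3) *\<^sub>R (bv 2 + \<beta> *\<^sub>R bv 3)"
  by (simp add: A4_6_def structure_bracket_def sum_4 algebra_simps)

lemma A4_12_apply: "A4_12 x y = (x $ 1 * y $ 3 - x $ 3 * y $ 1) *\<^sub>R bv 1
    + (x $ 2 * y $ 3 - x $ 3 * y $ 2) *\<^sub>R bv 2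
    - (x $ 1 * y $ 4 - x $ 4 * y $ 1) *\<^sub>R bv 2 + (x $ 2 * y $ 4 - x $ 4 * y $ 2) *\<^sub>R bv 1"
  by (simp add: A4_12_def structure_bracket_def sum_4 algebra_simps)

lemma A3_7_apply: "A3_7 \<alpha> x y = (x $ 1 * y $ 3 - x $ 3 * y $ 1) *\<^sub>R (\<alpha> *\<^sub>R bv 1 - bv 2)
    + (x $ 2 * y $ 3 - x $ 3 * y $ 2) *\<^sub>R (bv 1 + \<alpha> *\<^sub>R bv 2)"
  by (simp add: A3_7_def structure_bracket_def sum_3 algebra_simps)

text \<open>Makes the identities of \<open>cross3\<close> available; in particular all positively
  oriented orthonormal bases of \<open>real ^ 3\<close> share the same bracket relations.\<close>

lemma A3_9_apply: "A3_9 x y = cross3 x y"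
  by (simp add: A3_9_def structure_bracket_def sum_3 cross3_def vec_eq_iff forall_3 axis_def
      algebra_simps)

lemma A2_apply: "A2 x y = (x $ 1 * y $ 2 - x $ 2 * y $ 1) *\<^sub>R bv 2"
  by (simp add: A2_def structure_bracket_def sum_2 algebra_simps)

lemma unit_orthogonal_exists:
  fixes S :: "'e::euclidean_space set"
  assumes "dim S < DIM('e)"
  obtains e where "e \<bullet> e = 1" "\<And>x. x \<in> S \<Longrightarrow> x \<bullet> e = 0"
proof -
  obtain y where y: "y \<noteq> 0" "\<And>x. x \<in> span S \<Longrightarrow> orthogonal y x"
    using orthogonal_to_subspace_exists[OF assms] by metis
  show thesis
  proof (rule that[of "y /\<^sub>R norm y"])
    show "(y /\<^sub>R norm y) \<bullet> (y /\<^sub>R norm y) = 1" using y(1) by (simp add: dot_square_norm power2_eq_square)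
    show "x \<bullet> (y /\<^sub>R norm y) = 0" if "x \<in> S" for x
      using y(2)[OF span_base[OF that]] by (simp add: orthogonal_def inner_commute)
  qed
qed

text \<open>The metric is arbitrary relative to the table \<open>b\<close>, so \<open>\<Phi>\<close>
  respects brackets but not inner products; the metric and the Codazzi equation live on
  \<open>'e\<close>.\<close>

locale euclidean_lie_algebra_model = euclidean_lie_algebra nab
  for nab :: "'e::euclidean_space \<Rightarrow> 'e \<Rightarrow> 'e" +
  fixes \<Phi> :: "'v::real_vector \<Rightarrow> 'e" and b :: "'v \<Rightarrow> 'v \<Rightarrow> 'v"
  assumes \<Phi>_linear: "linear \<Phi>" and \<Phi>_bij: "bij \<Phi>" and \<Phi>_bracket: "\<Phi> (b x y) = bracket_of nab (\<Phi> x) (\<Phi> y)"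
    and codazzi: "nabla_ric nab x' y' z' = nabla_ric nab y' x' z'"
begin

lemma \<Phi>_surj: obtains x where "v = \<Phi> x"
  using \<Phi>_bij by (metis bij_pointE)

text \<open>The kernel of \<open>l\<close> is the abelian ideal of codimension 1, and
  \<open>e\<close> is the unit normal to its image under \<open>\<Phi>\<close>.\<close>

lemma almost_abelian_model:
  fixes l :: "'v \<Rightarrow> real"
  assumes l: "linear l" and b0: "l b0 = 1"
    and abelian: "\<And>x y. l x = 0 \<Longrightarrow> l y = 0 \<Longrightarrow> b x y = 0"
    and ideal: "\<And>x y. l (b x y) = 0"
  shows "nabla_curv nab w x y z = 0"
proof -
  let ?K = "\<Phi> ` {x. l x = 0}"
  have "subspace {x. l x = 0}"
    using l by (auto simp: subspace_def linear_0 linear_add linear_cmul)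
  then have "subspace ?K" by (rule linear_subspace_image[OF \<Phi>_linear])
  moreover have "\<Phi> b0 \<notin> ?K"
    using b0 \<Phi>_bij by (auto simp: bij_def dest: injD)
  ultimately have "dim ?K \<noteq> DIM('e)"
    by (metis UNIV_I dim_eq_full span_eq_iff)
  then have "dim ?K < DIM('e)" using dim_subset_UNIV[of ?K] by linarith
  then obtain e where e: "e \<bullet> e = 1" "\<And>x. x \<in> ?K \<Longrightarrow> x \<bullet> e = 0"
    using unit_orthogonal_exists by blast
  \<comment> \<open>Both sides vanish on the kernel of \<open>l\<close> and agree at
    \<open>b0\<close>.\<close>
  have dec: "\<Phi> x \<bullet> e = l x * (\<Phi> b0 \<bullet> e)" for x
  proof -
    have "\<Phi> (x - l x *\<^sub>R b0) \<bullet> e = 0"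
      by (rule e(2), rule imageI) (simp add: linear_diff[OF l] linear_cmul[OF l] b0)
    then show ?thesis
      by (simp add: linear_diff[OF \<Phi>_linear] linear_cmul[OF \<Phi>_linear] inner_diff_left)
  qed
  obtain x0 where "e = \<Phi> x0" by (rule \<Phi>_surj)
  then have "\<Phi> b0 \<bullet> e \<noteq> 0" using e(1) dec[of x0] by auto
  then have iff: "\<Phi> x \<bullet> e = 0 \<longleftrightarrow> l x = 0" for x using dec[of x] by simp
  show ?thesis
  proof (rule almost_abelian_parallel[OF e(1) _ _ codazzi])
    fix v w assume vw: "v \<bullet> e = 0" "w \<bullet> e = 0"
    obtain x where x: "v = \<Phi> x" by (rule \<Phi>_surj)
    obtain y where y: "w = \<Phi> y" by (rule \<Phi>_surj)
    show "br v w = 0"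
      using vw abelian[of x y] by (simp add: x y iff \<Phi>_bracket[symmetric] linear_0[OF \<Phi>_linear])
  next
    fix v
    obtain x where x: "v = \<Phi> x" by (rule \<Phi>_surj)
    obtain y where y: "e = \<Phi> y" by (rule \<Phi>_surj)
    show "br e v \<bullet> e = 0"
      using iff[of "b y x"] ideal by (simp only: x y[symmetric] \<Phi>_bracket)
  qed
qed

text \<open>Orthonormal bases of the plane \<open>V\<close> and of its complement are each rotated
  once: in the complement until \<open>u3\<close> acts on \<open>V\<close> with trace 0, in
  \<open>V\<close> until that action has zero diagonal. The element \<open>d\<close>, acting as the
  identity, then expresses the action of \<open>u2\<close> through that of \<open>u3\<close>, as
  \<open>solvable_parallel\<close> requires.\<close>

lemma solvable_model:
  fixes f f' d :: 'v
  assumes dim: "DIM('e) = 4"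
    and indep: "\<And>s t. s *\<^sub>R f + t *\<^sub>R f' = 0 \<Longrightarrow> s = 0 \<and> t = 0"
    and derived: "\<And>x y. b x y \<in> span {f, f'}"
    and abelian: "b f f' = 0" and ident: "b d f = f" "b d f' = f'"
  shows "nabla_curv nab w x y z = 0"
proof -
  define V where "V = \<Phi> ` span {f, f'}"
  have V_span: "V = span {\<Phi> f, \<Phi> f'}"
    unfolding V_def by (simp add: linear_span_image[OF \<Phi>_linear, symmetric])
  have V_sub: "subspace V" by (simp add: V_span)
  have V_el: "\<exists>s t. v = s *\<^sub>R \<Phi> f + t *\<^sub>R \<Phi> f'" if "v \<in> V" for v
    using that unfolding V_span span_insert by (auto simp: span_singleton algebra_simps)
  have ind: "s = 0 \<and> t = 0" if "s *\<^sub>R \<Phi> f + t *\<^sub>R \<Phi> f' = 0" for s t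
  proof -
    have "\<Phi> (s *\<^sub>R f + t *\<^sub>R f') = \<Phi> 0"
      using that by (simp add: linear_add[OF \<Phi>_linear] linear_cmul[OF \<Phi>_linear] linear_0[OF \<Phi>_linear])
    then have "s *\<^sub>R f + t *\<^sub>R f' = 0" using \<Phi>_bij by (metis bij_pointE)
    then show ?thesis by (rule indep)
  qed
  have br_V: "br x y \<in> V" for x y
    using derived by (metis V_def \<Phi>_bracket \<Phi>_surj imageI)
  have br_ff': "br (\<Phi> f) (\<Phi> f') = 0"
    using abelian \<Phi>_bracket[of f f'] by (simp add: linear_0[OF \<Phi>_linear])
  have V_ab: "br v v' = 0" if "v \<in> V" "v' \<in> V" for v v'
    using V_el[OF that(1)] V_el[OF that(2)] br_ff' br_antisym[of "\<Phi> f'" "\<Phi> f"]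
    by (auto simp: br_simps)
  have V_id: "br (\<Phi> d) v = v" if "v \<in> V" for v
    using V_el[OF that] ident \<Phi>_bracket[of d f] \<Phi>_bracket[of d f'] by (auto simp: br_simps)
  have "\<Phi> f \<noteq> \<Phi> f'" using ind[of 1 "-1"] by auto
  moreover have "independent {\<Phi> f, \<Phi> f'}"
  proof -
    have "\<Phi> f \<notin> span {\<Phi> f'}"
    proof
      assume "\<Phi> f \<in> span {\<Phi> f'}"
      then obtain t where "\<Phi> f = t *\<^sub>R \<Phi> f'" by (auto simp: span_singleton)
      then show False using ind[of 1 "-t"] by simp
    qed
    moreover have "\<Phi> f' \<noteq> 0" using ind[of 0 1] by auto
    ultimately show ?thesis by (simp add: independent_insert)
  qed
  ultimately have dim_V: "dim V = 2"
    by (simp add: V_span dim_eq_card_independent)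
  have ex2: "\<exists>x y. x \<bullet> x = 1 \<and> y \<bullet> y = 1 \<and> x \<bullet> y = 0 \<and> x \<in> S \<and> y \<in> S"
    if S: "subspace S" "dim S = 2" for S :: "'e set"
  proof -
    obtain B where B: "B \<subseteq> S" "pairwise orthogonal B" "\<And>x. x \<in> B \<Longrightarrow> norm x = 1" "card B = dim S"
      using orthonormal_basis_subspace[OF S(1)] by metis
    then obtain x y where "B = {x, y}" "x \<noteq> y" by (metis S(2) card_2_iff)
    then show ?thesis using B
      by (intro exI[of _ x] exI[of _ y]) (auto simp: pairwise_def orthogonal_def norm_eq_1)
  qed
  obtain p0 p1 where p: "p0 \<bullet> p0 = 1" "p1 \<bullet> p1 = 1" "p0 \<bullet> p1 = 0" "p0 \<in> V" "p1 \<in> V"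
    using ex2[OF V_sub dim_V] by blast
  define V' where "V' = {y. \<forall>x\<in>V. orthogonal x y}"
  have "subspace V'" unfolding V'_def by (rule subspace_orthogonal_to_vectors)
  moreover have "dim V' = 2"
    using dim_subspace_orthogonal_to_vectors[OF V_sub subspace_UNIV] dim dim_V
    by (simp add: V'_def)
  ultimately obtain p2 p3 where p': "p2 \<bullet> p2 = 1" "p3 \<bullet> p3 = 1" "p2 \<bullet> p3 = 0" "p2 \<in> V'" "p3 \<in> V'"
    using ex2 by blast
  have pp: "p0 \<bullet> p2 = 0" "p0 \<bullet> p3 = 0" "p1 \<bullet> p2 = 0" "p1 \<bullet> p3 = 0"
    using p p' by (auto simp: V'_def orthogonal_def)
  \<comment> \<open>A linear functional on a plane has a unit vector in its kernel; applied to the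
    trace of the action on \<open>V\<close>.\<close>
  have rot: "\<exists>c s. c * c + s * s = 1 \<and> c * A + s * B = 0" for A B :: real
  proof (cases "A = 0 \<and> B = 0")
    case True
    then have "1 * 1 + 0 * 0 = (1::real) \<and> 1 * A + 0 * B = 0" by simp
    then show ?thesis by blast
  next
    case False
    define m where "m = sqrt (A\<^sup>2 + B\<^sup>2)"
    have "m \<noteq> 0" "m * m = A * A + B * B"
      using False by (simp_all add: m_def sum_power2_eq_zero_iff) (simp add: power2_eq_square)
    then have "B / m * (B / m) + - A / m * (- A / m) = 1 \<and> B / m * A + - A / m * B = 0"
      using False by (simp add: add_divide_distrib[symmetric] add.commute)
    then show ?thesis by blast
  qed
  define tr where "tr x = br x p0 \<bullet> p0 + br x p1 \<bullet> p1" for x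
  obtain c s where cs: "c * c + s * s = 1" "c * tr p2 + s * tr p3 = 0" using rot by blast
  define u3 where "u3 = c *\<^sub>R p2 + s *\<^sub>R p3"
  define u2 where "u2 = c *\<^sub>R p3 - s *\<^sub>R p2"
  have tr_u3: "tr u3 = 0"
    using cs(2) by (simp add: tr_def u3_def br_simps inner_add_left algebra_simps)
  text \<open>The quadratic form of a traceless operator on a plane vanishes in some direction.\<close>
  define Q where "Q \<theta> = cos \<theta> * cos \<theta> * (br u3 p0 \<bullet> p0) + cos \<theta> * sin \<theta> * (br u3 p0 \<bullet> p1 + br u3 p1 \<bullet> p0)
    + sin \<theta> * sin \<theta> * (br u3 p1 \<bullet> p1)" for \<theta>
  have Q_cont: "continuous_on {0..pi/2} Q" unfolding Q_def by (intro continuous_intros)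
  have "Q 0 = - Q (pi/2)" using tr_u3 by (simp add: Q_def tr_def)
  then have "Q 0 \<le> 0 \<and> 0 \<le> Q (pi/2) \<or> Q (pi/2) \<le> 0 \<and> 0 \<le> Q 0" by linarith
  then obtain \<theta> where \<theta>: "Q \<theta> = 0"
    using IVT'[of Q 0 0 "pi/2"] IVT2'[of Q "pi/2" 0 0] Q_cont pi_half_ge_zero by blast
  define u0 where "u0 = cos \<theta> *\<^sub>R p0 + sin \<theta> *\<^sub>R p1"
  define u1 where "u1 = cos \<theta> *\<^sub>R p1 - sin \<theta> *\<^sub>R p0"
  have c2: "cos \<theta> * cos \<theta> + sin \<theta> * sin \<theta> = 1"
    using sin_cos_squared_add2[of \<theta>] by (simp add: power2_eq_square)
  have q0: "br u3 u0 \<bullet> u0 = 0"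
    using \<theta> by (simp add: u0_def Q_def br_simps inner_add_left inner_add_right algebra_simps)
  have "br u3 u0 \<bullet> u0 + br u3 u1 \<bullet> u1 = cos \<theta> * cos \<theta> * tr u3 + sin \<theta> * sin \<theta> * tr u3"
    by (simp add: u0_def u1_def tr_def br_simps inner_add_left inner_add_right inner_diff_left
        inner_diff_right algebra_simps)
  then have q1: "br u3 u1 \<bullet> u1 = 0" using q0 tr_u3 by simp
  have uV: "u0 \<in> V" "u1 \<in> V"
    using p V_sub by (simp_all add: u0_def u1_def subspace_add subspace_diff subspace_scale)
  define u where "u i = [u0, u1, u2, u3] ! i" for i
  have ui: "u 0 = u0" "u 1 = u1" "u 2 = u2" "u 3 = u3" by (simp_all add: u_def)
  have sc: "p1 \<bullet> p0 = 0" "p3 \<bullet> p2 = 0" "p2 \<bullet> p0 = 0" "p3 \<bullet> p0 = 0" "p2 \<bullet> p1 = 0" "p3 \<bullet> p1 = 0"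
    using p p' pp by (simp_all add: inner_commute)
  have on: "orthonormal_family 4 u"
    unfolding orthonormal_family_def all_less_4 ui
    using cs(1) c2
    by (simp add: u0_def u1_def u2_def u3_def p p' pp sc inner_add_left inner_add_right
        inner_diff_left inner_diff_right algebra_simps)
  have V'': "u2 \<in> V'" "u3 \<in> V'"
    using p' \<open>subspace V'\<close> by (simp_all add: u2_def u3_def subspace_add subspace_diff subspace_scale)
  have exp4: "v = (v \<bullet> u0) *\<^sub>R u0 + (v \<bullet> u1) *\<^sub>R u1 + (v \<bullet> u2) *\<^sub>R u2 + (v \<bullet> u3) *\<^sub>R u3" for v
    using orthonormal_expansion[of u v] on dim by (simp add: sum_lessThan_4 ui del: One_nat_def)
  have expV: "v = (v \<bullet> u0) *\<^sub>R u0 + (v \<bullet> u1) *\<^sub>R u1" if "v \<in> V" for v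
    using exp4[of v] that V'' by (auto simp: V'_def orthogonal_def)
  define q where "q = br u3 u0 \<bullet> u1"
  define p where "p = br u3 u1 \<bullet> u0"
  have b30: "br u3 u0 = q *\<^sub>R u1" and b31: "br u3 u1 = p *\<^sub>R u0"
    using expV[OF br_V[of u3 u0]] expV[OF br_V[of u3 u1]] q0 q1 by (simp_all add: q_def p_def)
  \<comment> \<open>Only the part of \<open>\<Phi> d\<close> orthogonal to \<open>V\<close> acts on
    \<open>V\<close>, because \<open>V\<close> is abelian.\<close>
  define \<delta> where "\<delta> = \<Phi> d \<bullet> u2"
  define \<epsilon> where "\<epsilon> = \<Phi> d \<bullet> u3"
  have bd: "\<delta> *\<^sub>R br u2 v + \<epsilon> *\<^sub>R br u3 v = v" if "v \<in> V" for v
    using V_id[OF that] V_ab[OF uV(1) that] V_ab[OF uV(2) that]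
    by (subst (asm) exp4[of "\<Phi> d"]) (simp add: br_simps \<delta>_def \<epsilon>_def)
  have uu: "u0 \<bullet> u0 = 1" "u1 \<bullet> u0 = 0"
    using on by (simp_all add: orthonormal_family_def all_less_4 ui del: One_nat_def)
  \<comment> \<open>Otherwise a multiple of the action of \<open>u3\<close> would be the identity on
    \<open>V\<close>, against its zero diagonal.\<close>
  have \<delta>: "\<delta> \<noteq> 0"
  proof
    assume "\<delta> = 0"
    then have "(\<epsilon> * q) *\<^sub>R u1 = u0" using bd[OF uV(1)] by (simp add: b30)
    then have "((\<epsilon> * q) *\<^sub>R u1) \<bullet> u0 = u0 \<bullet> u0" by simp
    then show False by (simp add: uu)
  qed
  have b2: "br u2 v = (1 / \<delta>) *\<^sub>R v + (- \<epsilon> / \<delta>) *\<^sub>R br u3 v" if "v \<in> V" for v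
  proof -
    have "br u2 v = (1 / \<delta>) *\<^sub>R (\<delta> *\<^sub>R br u2 v)" using \<delta> by simp
    also have "\<delta> *\<^sub>R br u2 v = v - \<epsilon> *\<^sub>R br u3 v" using bd[OF that] by (metis add_diff_cancel_right')
    finally show ?thesis by (simp add: algebra_simps)
  qed
  have "br (u 2) (u 0) = (1 / \<delta>) *\<^sub>R u 0 + (- \<epsilon> / \<delta> * q) *\<^sub>R u 1"
    "br (u 2) (u 1) = (- \<epsilon> / \<delta> * p) *\<^sub>R u 0 + (1 / \<delta>) *\<^sub>R u 1"
    using b2[OF uV(1)] b2[OF uV(2)] unfolding ui b30 b31 by simp_all
  then show ?thesis
    using solvable_parallel[OF dim on, of "1 / \<delta>" "- \<epsilon> / \<delta>" q p "br u2 u3 \<bullet> u0" "br u2 u3 \<bullet> u1"]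
      \<delta> b30 b31 expV[OF br_V[of u2 u3]] V_ab[OF uV] codazzi
    by (simp add: ui del: One_nat_def)
qed

end

text \<open>First variation of the Rayleigh quotient at a maximum: if \<open>q u w\<close> were
  nonzero, a small step along \<open>w\<close> would increase it.\<close>

lemma rayleigh_critical:
  fixes q :: "'a::real_inner \<Rightarrow> 'a \<Rightarrow> real"
  assumes q: "bilinear q" and sym: "\<And>x y. q x y = q y x"
    and u: "u \<bullet> u = 1" "u \<bullet> w = 0"
    and max: "\<And>t. q (u + t *\<^sub>R w) (u + t *\<^sub>R w) \<le> q u u * ((u + t *\<^sub>R w) \<bullet> (u + t *\<^sub>R w))"
  shows "q u w = 0"
proof (rule ccontr)
  assume nz: "q u w \<noteq> 0"
  define \<gamma> where "\<gamma> = q w w - q u u * (w \<bullet> w)"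
  have *: "2 * t * q u w + t * t * \<gamma> \<le> 0" for t
    using max[of t] u sym[of w u]
    by (simp add: \<gamma>_def bilinear_ladd[OF q] bilinear_radd[OF q] bilinear_lmul[OF q] bilinear_rmul[OF q]
        inner_add_left inner_add_right inner_commute[of w u] algebra_simps)
  \<comment> \<open>Exceeds the second-order coefficient in absolute value, so for the step
    \<open>t = q u w / s\<close> the first-order term wins.\<close>
  define s where "s = \<bar>\<gamma>\<bar> + 1"
  have s: "s > 0" "\<bar>\<gamma>\<bar> < s" by (simp_all add: s_def)
  have "(q u w)\<^sup>2 / s * (2 + \<gamma> / s) \<le> 0"
    using *[of "q u w / s"] s by (simp add: power2_eq_square algebra_simps add_divide_distrib)
  moreover have "2 + \<gamma> / s > 0" using s by (simp add: field_simps)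
  moreover have "(q u w)\<^sup>2 / s > 0" using nz s by simp
  ultimately show False by (metis mult_pos_pos not_le)
qed

text \<open>Principal axes of \<open>q\<close>: \<open>f1\<close> maximises it on the sphere,
  \<open>f2\<close> on the unit circle orthogonal to \<open>f1\<close>. Taking \<open>f3\<close> as
  their cross product fixes the orientation, so the relations of \<open>su(2)\<close> keep their
  standard form; this is Milnor's basis up to scaling.\<close>

lemma orthogonal_cross_basis:
  fixes q :: "real^3 \<Rightarrow> real^3 \<Rightarrow> real"
  assumes q: "bilinear q" and sym: "\<And>x y. q x y = q y x"
  obtains f1 f2 f3 where "f1 \<bullet> f1 = 1" "f2 \<bullet> f2 = 1" "f3 \<bullet> f3 = 1" "f1 \<bullet> f2 = 0" "f1 \<bullet> f3 = 0" "f2 \<bullet> f3 = 0"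
    "cross3 f1 f2 = f3" "cross3 f2 f3 = f1" "cross3 f3 f1 = f2" "q f1 f2 = 0" "q f1 f3 = 0" "q f2 f3 = 0"
proof -
  have cont: "continuous_on S (\<lambda>x. q x x)" for S
    using bounded_bilinear.continuous_on[of q S "\<lambda>x. x" "\<lambda>x. x"] q
    by (simp add: bilinear_conv_bounded_bilinear)
  have scale: "q v v \<le> M * (v \<bullet> v)"
    if "subspace T" "v \<in> T" "\<And>x. x \<in> T \<Longrightarrow> norm x = 1 \<Longrightarrow> q x x \<le> M" for M T v
  proof (cases "v = 0")
    case True
    then show ?thesis by (simp add: bilinear_lzero[OF q])
  next
    case False
    then have "q (v /\<^sub>R norm v) (v /\<^sub>R norm v) \<le> M"
      using that by (intro that(3)) (auto simp: subspace_scale)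
    then have "q v v / (norm v * norm v) \<le> M"
      by (simp add: bilinear_lmul[OF q] bilinear_rmul[OF q] field_simps)
    then show ?thesis using False by (simp add: dot_square_norm power2_eq_square field_simps)
  qed
  have "compact (sphere (0::real^3) 1)" "sphere (0::real^3) 1 \<noteq> {}" by auto
  then obtain f1 where f1: "f1 \<in> sphere 0 1" "\<And>x. x \<in> sphere 0 1 \<Longrightarrow> q x x \<le> q f1 f1"
    using continuous_attains_sup[OF _ _ cont] by metis
  then have n1: "f1 \<bullet> f1 = 1" by (simp add: norm_eq_1)
  define T where "T = {x. f1 \<bullet> x = 0}"
  have T: "subspace T" unfolding T_def by (rule subspace_hyperplane)
  have "closed T" unfolding T_def by (rule closed_hyperplane)
  then have "compact (sphere 0 1 \<inter> T)" by (intro compact_Int_closed) auto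
  moreover obtain e where "e \<bullet> e = 1" "f1 \<bullet> e = 0"
  proof -
    have "dim {f1} < DIM(real^3)" by (rule le_less_trans[OF dim_le_card[of _ "{f1}"]]) (auto intro: span_base)
    then show thesis using unit_orthogonal_exists[of "{f1}"] that by blast
  qed
  then have "sphere 0 1 \<inter> T \<noteq> {}" by (auto simp: T_def norm_eq_1)
  ultimately obtain f2 where f2: "f2 \<in> sphere 0 1 \<inter> T" "\<And>x. x \<in> sphere 0 1 \<inter> T \<Longrightarrow> q x x \<le> q f2 f2"
    using continuous_attains_sup[OF _ _ cont] by metis
  then have n2: "f2 \<bullet> f2 = 1" and o12: "f1 \<bullet> f2 = 0" by (auto simp: norm_eq_1 T_def)
  define f3 where "f3 = cross3 f1 f2"
  have o: "f1 \<bullet> f3 = 0" "f2 \<bullet> f3 = 0" by (simp_all add: f3_def dot_cross_self)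
  have n3: "f3 \<bullet> f3 = 1"
    using n1 n2 o12 by (simp add: f3_def dot_cross)
  have c23: "cross3 f2 f3 = f1" and c31: "cross3 f3 f1 = f2"
    using n1 n2 o12 cross_skew[of f3 f1]
    by (simp_all add: f3_def Lagrange inner_commute)
  have q1: "q f1 w = 0" if "f1 \<bullet> w = 0" for w
    using rayleigh_critical[OF q sym n1 that] scale[of UNIV _ "q f1 f1"] f1(2) by simp
  have q23: "q f2 f3 = 0"
  proof (rule rayleigh_critical[OF q sym n2 o(2)])
    fix t
    have "f2 + t *\<^sub>R f3 \<in> T" using o o12 by (simp add: T_def inner_add_right)
    then show "q (f2 + t *\<^sub>R f3) (f2 + t *\<^sub>R f3) \<le> q f2 f2 * ((f2 + t *\<^sub>R f3) \<bullet> (f2 + t *\<^sub>R f3))"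
      using scale[OF T] f2(2) by simp
  qed
  show thesis
    by (rule that[OF n1 n2 n3 o12 o f3_def[symmetric] c23 c31 q1[OF o12] q1[OF o(1)] q23])
qed

lemma orthonormal_extension:
  fixes p q r :: "'e::euclidean_space"
  assumes dim: "DIM('e) = 4" and on: "p \<bullet> p = 1" "q \<bullet> q = 1" "r \<bullet> r = 1" "p \<bullet> q = 0" "p \<bullet> r = 0" "q \<bullet> r = 0"
  obtains u where "orthonormal_family 4 u" "u 1 = p" "u 2 = q" "u 3 = r"
proof -
  have "dim {p, q, r} \<le> card {p, q, r}" by (rule dim_le_card') simp
  also have "\<dots> \<le> 3" by (simp add: card_insert_if)
  finally have "dim {p, q, r} < DIM('e)" using dim by simp
  then obtain e where e: "e \<bullet> e = 1" "\<And>x. x \<in> {p, q, r} \<Longrightarrow> x \<bullet> e = 0"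
    using unit_orthogonal_exists by blast
  define u where "u i = [e, p, q, r] ! i" for i
  have u: "u 0 = e" "u 1 = p" "u 2 = q" "u 3 = r" by (simp_all add: u_def)
  have "orthonormal_family 4 u"
    unfolding orthonormal_family_def all_less_4 u
    using e(1) e(2)[of p] e(2)[of q] e(2)[of r] on by (simp add: inner_commute)
  then show thesis using that u by blast
qed

lemma su2_model:
  fixes nab :: "'e::euclidean_space \<Rightarrow> 'e \<Rightarrow> 'e" and \<Phi> :: "(real^3) \<times> real \<Rightarrow> 'e"
  assumes model: "euclidean_lie_algebra_model nab \<Phi> (bracket_sum A3_9 A1)" and dim: "DIM('e) = 4"
  shows "nabla_curv nab w x y z = 0"
proof -
  interpret euclidean_lie_algebra_model nab \<Phi> "bracket_sum A3_9 A1" by (rule model)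
  define F where "F v = \<Phi> (v, 0)" for v
  have F_lin: "linear F"
  proof (rule linearI)
    show "F (v + w) = F v + F w" for v w
      using linear_add[OF \<Phi>_linear, of "(v, 0)" "(w, 0)"] by (simp add: F_def)
    show "F (c *\<^sub>R v) = c *\<^sub>R F v" for c v
      using linear_cmul[OF \<Phi>_linear, of c "(v, 0)"] by (simp add: F_def)
  qed
  have F_br: "br (\<Phi> (k, s)) (F v) = F (cross3 k v)" for k s v
    unfolding F_def \<Phi>_bracket[symmetric] by (simp add: bracket_sum_def A3_9_apply A1_def)
  have F_br': "br (F k) (F v) = F (cross3 k v)" for k v
    using F_br[of k 0 v] by (simp add: F_def)
  have F_nz: "F v \<noteq> 0" if "v \<noteq> 0" for v
  proof
    assume "F v = 0"
    then have "\<Phi> (v, 0) = \<Phi> 0" by (simp add: F_def linear_0[OF \<Phi>_linear])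
    then have "(v, 0) = (0 :: (real^3) \<times> real)" using \<Phi>_bij by (metis bij_pointE)
    then show False using that by (simp add: zero_prod_def)
  qed
  have bil: "bilinear (\<lambda>v w. F v \<bullet> F w)"
    by (auto simp: bilinear_def linear_add[OF F_lin] linear_cmul[OF F_lin] inner_add_left inner_add_right
        intro!: linearI)
  obtain f1 f2 f3 where f: "f1 \<bullet> f1 = 1" "f2 \<bullet> f2 = 1" "f3 \<bullet> f3 = 1" "f1 \<bullet> f2 = 0" "f1 \<bullet> f3 = 0" "f2 \<bullet> f3 = 0"
    and cr: "cross3 f1 f2 = f3" "cross3 f2 f3 = f1" "cross3 f3 f1 = f2"
    and o: "F f1 \<bullet> F f2 = 0" "F f1 \<bullet> F f3 = 0" "F f2 \<bullet> F f3 = 0"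
    by (rule orthogonal_cross_basis[OF bil inner_commute])
  have cr': "cross3 f2 f1 = - f3" "cross3 f3 f2 = - f1" "cross3 f1 f3 = - f2"
    using cr cross_skew[of f2 f1] cross_skew[of f3 f2] cross_skew[of f1 f3] by simp_all
  define n1 where "n1 = norm (F f1)"
  define n2 where "n2 = norm (F f2)"
  define n3 where "n3 = norm (F f3)"
  have "f1 \<noteq> 0" "f2 \<noteq> 0" "f3 \<noteq> 0" using f by auto
  then have n: "n1 > 0" "n2 > 0" "n3 > 0" by (simp_all add: n1_def n2_def n3_def F_nz)
  obtain u where u: "orthonormal_family 4 u" "u 1 = (1 / n1) *\<^sub>R F f1" "u 2 = (1 / n2) *\<^sub>R F f2"
    "u 3 = (1 / n3) *\<^sub>R F f3"
  proof (rule orthonormal_extension[OF dim, of "(1 / n1) *\<^sub>R F f1" "(1 / n2) *\<^sub>R F f2" "(1 / n3) *\<^sub>R F f3"])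
  qed (use n o in \<open>simp_all add: n1_def n2_def n3_def dot_square_norm power2_eq_square\<close>)
  have Fu: "F f1 = n1 *\<^sub>R u 1" "F f2 = n2 *\<^sub>R u 2" "F f3 = n3 *\<^sub>R u 3"
    using n by (simp_all add: u del: One_nat_def)
  \<comment> \<open>The component \<open>s\<close> is central, so \<open>u 0\<close> acts on
    \<open>su(2)\<close> as \<open>k\<close> does; this is the inner derivation encoded in
    \<open>su2_const\<close>.\<close>
  obtain k s where ks: "u 0 = \<Phi> (k, s)" by (metis \<Phi>_surj surj_pair)
  define h1 where "h1 = k \<bullet> f1"
  define h2 where "h2 = k \<bullet> f2"
  define h3 where "h3 = k \<bullet> f3"
  have k: "k = h1 *\<^sub>R f1 + h2 *\<^sub>R f2 + h3 *\<^sub>R f3"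
  proof -
    have "orthonormal_family DIM(real^3) (\<lambda>i. [f1, f2, f3] ! i)"
      using f by (auto simp: orthonormal_family_def eval_nat_numeral less_Suc_eq inner_commute)
    from orthonormal_expansion[OF this, of k] show ?thesis
      by (simp add: eval_nat_numeral h1_def h2_def h3_def)
  qed
  note br_u = u(2-4) ks br_simps(7,8) F_br F_br' k cross_add_left cross_mult_left cr cr' cross_refl
    linear_add[OF F_lin] linear_cmul[OF F_lin] linear_neg[OF F_lin] linear_0[OF F_lin]
  \<comment> \<open>The bracket of \<open>u 2\<close> and \<open>u 3\<close> is \<open>F f1\<close>
    divided by \<open>n2 * n3\<close>, that is \<open>n1 / (n2 * n3)\<close> times
    \<open>u 1\<close>, and cyclically. The coordinates of \<open>F k\<close> along
    \<open>u 1, u 2, u 3\<close> are \<open>h1 * n1\<close>, \<open>h2 * n2\<close>,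
    \<open>h3 * n3\<close>.\<close>
  show ?thesis
  proof (rule su2_parallel[OF dim u(1), of "n1 / (n2 * n3)" "n2 / (n3 * n1)" "n3 / (n1 * n2)"
        "h3 * n3" "h2 * n2" "h1 * n1"])
    show "br (u 1) (u 2) = (n3 / (n1 * n2)) *\<^sub>R u 3" "br (u 2) (u 3) = (n1 / (n2 * n3)) *\<^sub>R u 1"
      "br (u 3) (u 1) = (n2 / (n3 * n1)) *\<^sub>R u 2"
      unfolding u(2-4) br_simps F_br' cr using n by simp_all
    show "br (u 0) (u 1) = (h3 * n3 * (n2 / (n3 * n1))) *\<^sub>R u 2 - (h2 * n2 * (n3 / (n1 * n2))) *\<^sub>R u 3"
      "br (u 0) (u 2) = (h1 * n1 * (n3 / (n1 * n2))) *\<^sub>R u 3 - (h3 * n3 * (n1 / (n2 * n3))) *\<^sub>R u 1"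
      "br (u 0) (u 3) = (h2 * n2 * (n1 / (n2 * n3))) *\<^sub>R u 1 - (h1 * n1 * (n2 / (n3 * n1))) *\<^sub>R u 2"
      using n by (simp_all only: br_u) (simp_all add: algebra_simps)
  qed (use n codazzi in simp_all)
qed

section \<open>Left invariant frames\<close>

context smooth_manifold
begin

lemma vector_field_apply_diff:
  assumes "X \<in> vector_fields charts" "smooth_fun charts f" "smooth_fun charts h"
  shows "X p (\<lambda>q. f q - h q) = X p f - X p h"
proof -
  obtain c where c: "c \<in> charts" "p \<in> fst c" by (rule chart_at)
  obtain \<xi> where \<xi>: "X p = coord_tangent charts c p (\<xi> (snd c p))"
    using vector_field_chart[OF assms(1) c(1)] c(2) by metis
  let ?i = "inv_into (fst c) (snd c)"
  have "smooth_fun charts (\<lambda>q. f q + (-1) * h q)"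
    by (intro smooth_fun_add smooth_fun_mult smooth_fun_const assms)
  then have "smooth_fun charts (\<lambda>q. f q - h q)" by simp
  moreover have "frechet_derivative (\<lambda>x. (f \<circ> ?i) x - (h \<circ> ?i) x) (at (snd c p)) v =
    frechet_derivative (f \<circ> ?i) (at (snd c p)) v - frechet_derivative (h \<circ> ?i) (at (snd c p)) v" for v
  proof -
    have "(u \<circ> ?i has_derivative frechet_derivative (u \<circ> ?i) (at (snd c p))) (at (snd c p))"
      if "smooth_fun charts u" for u
      using smooth_on_differentiable[OF smooth_fun_chart[OF that c(1)]] c(2)
      by (simp add: frechet_derivative_works)
    from fun_cong[OF frechet_derivative_at[OF has_derivative_diff[OF this[OF assms(2)]
          this[OF assms(3)]]], of v]
    show ?thesis by simp
  qed
  ultimately show ?thesis using assms by (simp add: \<xi> coord_tangent_def o_def)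
qed

text \<open>The Jacobi identity of operator commutators. Differences of functions are split with
  \<open>vector_field_apply_diff\<close>, whose smoothness hypotheses force the case distinction on
  \<open>f\<close>.\<close>

lemma vf_bracket_jacobi:
  assumes "X \<in> vector_fields charts" "Y \<in> vector_fields charts" "Z \<in> vector_fields charts"
  shows "vf_bracket (vf_bracket X Y) Z + vf_bracket (vf_bracket Y Z) X
    + vf_bracket (vf_bracket Z X) Y = 0"
proof -
  have sm: "smooth_fun charts (vf_apply V (vf_apply W f))"
    if "V \<in> vector_fields charts" "W \<in> vector_fields charts" "smooth_fun charts f" for V W f
    using that by (intro smooth_vf_apply)
  have ns: "V p f = 0" if "V \<in> vector_fields charts" "\<not> smooth_fun charts f" for V p f
  proof -
    obtain c where c: "c \<in> charts" "p \<in> fst c" by (rule chart_at)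
    then show ?thesis
      using vector_field_chart[OF that(1) c(1)] that(2) c(2) by (metis coord_tangent_def)
  qed
  have z: "V p (\<lambda>_. 0) = 0" if "V \<in> vector_fields charts" for V p
    using vf_apply_const[OF that, of 0] by (metis vf_apply_def)
  have br: "vf_apply (vf_bracket V W) f = (\<lambda>q. vf_apply V (vf_apply W f) q - vf_apply W (vf_apply V f) q)"
    for V W f by (simp add: vf_bracket_def vf_apply_def)
  have "(vf_bracket (vf_bracket X Y) Z + vf_bracket (vf_bracket Y Z) X
    + vf_bracket (vf_bracket Z X) Y) p f = 0" for p f
  proof (cases "smooth_fun charts f")
    case True
    have 1: "vf_bracket (vf_bracket V W) U p f = V p (vf_apply W (vf_apply U f))
        - W p (vf_apply V (vf_apply U f)) - (U p (vf_apply V (vf_apply W f)) - U p (vf_apply W (vf_apply V f)))"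
      if "V \<in> vector_fields charts" "W \<in> vector_fields charts" "U \<in> vector_fields charts" for U V W
      using vector_field_apply_diff[OF that(3) sm[OF that(1,2) True] sm[OF that(2,1) True]]
      by (subst vf_bracket_def, subst br) (simp add: vf_bracket_def vf_apply_def)
    show ?thesis using assms by (simp add: 1)
  next
    case False
    \<comment> \<open>Tangent vectors take the conventional value 0 on functions that are not
      smooth.\<close>
    then have "vf_apply V f = (\<lambda>_. 0)" if "V \<in> vector_fields charts" for V
      using ns[OF that] by (simp add: vf_apply_def)
    then show ?thesis
      using assms by (simp add: vf_bracket_def vf_apply_def z)
  qed
  then show ?thesis by (simp add: fun_eq_iff)
qed

end

text \<open>Frames are indexed by \<open>nat\<close>, while traces on \<open>'e\<close> are sums
  over \<open>Basis\<close>; this enumeration translates between them.\<close>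

definition basis_enum :: "nat \<Rightarrow> 'e::euclidean_space" where
  "basis_enum = (SOME \<beta>. bij_betw \<beta> {..<DIM('e)} Basis)"

lemma bij_basis_enum: "bij_betw (basis_enum :: nat \<Rightarrow> 'e::euclidean_space) {..<DIM('e)} Basis"
proof -
  have "\<exists>\<beta>::nat \<Rightarrow> 'e. bij_betw \<beta> {..<DIM('e)} Basis"
    using ex_bij_betw_nat_finite[OF finite_Basis[where 'a='e]] by (simp add: lessThan_atLeast0)
  then show ?thesis unfolding basis_enum_def by (rule someI_ex)
qed

lemma sum_basis_enum: "(\<Sum>i<DIM('e). f (basis_enum i)) = (\<Sum>b\<in>Basis. f (b :: 'e::euclidean_space))"
  by (rule sum.reindex_bij_betw[OF bij_basis_enum])

lemma orthonormal_basis_enum: "orthonormal_family DIM('e) (basis_enum :: nat \<Rightarrow> 'e::euclidean_space)"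
  unfolding orthonormal_family_def
proof (intro allI impI)
  fix i j assume ij: "i < DIM('e)" "j < DIM('e)"
  then have "basis_enum i \<in> (Basis :: 'e set)" "basis_enum j \<in> (Basis :: 'e set)"
    using bij_betwE[OF bij_basis_enum] by auto
  moreover have "basis_enum i = (basis_enum j :: 'e) \<longleftrightarrow> i = j"
    using bij_betw_imp_inj_on[OF bij_basis_enum[where 'e='e]] ij by (simp add: inj_on_eq_iff)
  ultimately show "basis_enum i \<bullet> (basis_enum j :: 'e) = (if i = j then 1 else 0)"
    by (simp add: inner_Basis)
qed

locale invariant_frame = orthonormal_frame charts g D E
  for charts :: "('g::topological_space, 'e::euclidean_space) chart set" and g D E +
  fixes \<gg> :: "'g vfield set"
  assumes frame_span: "\<gg> = {\<Sum>i<DIM('e). vf_scale (\<lambda>_. c i) (E i) | c. True}"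
    and bracket_closed: "X \<in> \<gg> \<Longrightarrow> Y \<in> \<gg> \<Longrightarrow> vf_bracket X Y \<in> \<gg>"
begin

text \<open>An isometry of the model space onto the Lie algebra taking the standard basis to the
  frame. Here \<open>'e\<close> serves for its dimension and inner product, not as a coordinate
  space.\<close>

definition L :: "'e \<Rightarrow> 'g vfield" where
  "L x = (\<Sum>i<DIM('e). vf_scale (\<lambda>_. x \<bullet> basis_enum i) (E i))"

lemma L_in: "L x \<in> VF"
  unfolding L_def by (intro vector_field_sum vector_field_scale smooth_fun_const frame_in) simp

lemma L_apply: "L x p f = (\<Sum>i<DIM('e). (x \<bullet> basis_enum i) * E i p f)"
  by (simp add: L_def vfield_sum_apply vf_scale_def)

lemma L_add: "L (x + y) = L x + L y" and L_diff: "L (x - y) = L x - L y"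
  and L_scale: "L (a *\<^sub>R x) = vf_scale (\<lambda>_. a) (L x)" and L_zero: "L 0 = 0"
  by (simp_all add: fun_eq_iff L_apply vf_scale_def algebra_simps sum.distrib sum_subtractf
      sum_distrib_left)

lemma metric_L: "metric_apply g (L x) (L y) = (\<lambda>p. x \<bullet> y)"
proof -
  have 1: "metric_apply g (L x) Z = (\<lambda>p. \<Sum>i<DIM('e). (x \<bullet> basis_enum i) * metric_apply g (E i) Z p)"
    if "Z \<in> VF" for x Z
    unfolding L_def using that
    by (subst metric_apply_sum) (auto simp: metric_apply_scale frame_in intro: vector_field_scale smooth_fun_const)
  have 2: "metric_apply g (E i) (L y) = (\<lambda>p. y \<bullet> basis_enum i)" if i: "i < DIM('e)" for i
  proof -
    have "metric_apply g (L y) (E i) p = (\<Sum>j<DIM('e). if j = i then y \<bullet> basis_enum j else 0)" for p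
      unfolding 1[OF frame_in[OF i]] by (rule sum.cong) (use i frame_orthonormal in auto)
    then show ?thesis
      using i metric_apply_sym[OF frame_in[OF i] L_in] by (simp add: fun_eq_iff)
  qed
  show ?thesis
    unfolding 1[OF L_in] inner_orthonormal[OF orthonormal_basis_enum, of x y] by (simp add: 2)
qed

lemma L_inj: "L x = L y \<Longrightarrow> x = y"
proof -
  assume "L x = L y"
  then have "x \<bullet> (x - y) = y \<bullet> (x - y)"
    using metric_L[of x "x - y"] metric_L[of y "x - y"] by metis
  then show "x = y" by (metis inner_diff_left inner_eq_zero_iff right_minus_eq)
qed

lemma E_eq_L: "i < DIM('e) \<Longrightarrow> E i = L (basis_enum i)"
proof -
  assume i: "i < DIM('e)"
  have "(basis_enum i \<bullet> (basis_enum j :: 'e)) * E j p f = (if i = j then E j p f else 0)"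
    if "j < DIM('e)" for j p f
    using orthonormal_basis_enum[where 'e='e] i that by (simp add: orthonormal_family_def)
  then have "L (basis_enum i) p f = (\<Sum>j<DIM('e). if i = j then E j p f else 0)" for p f
    unfolding L_apply by (intro sum.cong) auto
  then show ?thesis using i by (simp add: fun_eq_iff)
qed

lemma L_combination:
  "(\<Sum>i<DIM('e). vf_scale (\<lambda>_. c i) (E i)) = L (\<Sum>i<DIM('e). c i *\<^sub>R basis_enum i)"
proof -
  have "L (\<Sum>i\<in>I. c i *\<^sub>R basis_enum i) = (\<Sum>i\<in>I. vf_scale (\<lambda>_. c i) (L (basis_enum i)))"
    for I :: "nat set"
    by (induction I rule: infinite_finite_induct) (simp_all add: L_zero L_add L_scale)
  then show ?thesis by (simp add: E_eq_L)
qed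

lemma range_L: "range L = \<gg>"
  unfolding frame_span using L_combination by (auto simp: L_def)

lemma L_if_constant_coefficients:
  assumes "Z \<in> VF" "\<And>k. k < DIM('e) \<Longrightarrow> metric_apply g Z (E k) = (\<lambda>_. a k)"
  shows "Z = L (\<Sum>i<DIM('e). a i *\<^sub>R basis_enum i)"
  using frame_expansion[OF assms(1)] assms(2) L_combination[of a] by simp

lemma bracket_L_ex: "\<exists>z. vf_bracket (L x) (L y) = L z"
  using bracket_closed[of "L x" "L y"] by (metis range_L rangeE rangeI)

text \<open>In Koszul's formula the derivatives of the constant inner products drop out. The frame
  coefficients of \<open>D (L x) (L y)\<close> are therefore constants, and the field lies in the
  image of \<open>L\<close> again.\<close>

lemma D_L_ex: "\<exists>z. D (L x) (L y) = L z"
proof -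
  obtain b where b: "\<And>x y. vf_bracket (L x) (L y) = L (b x y)"
    using bracket_L_ex by metis
  have compat: "metric_apply g (D (L x) (L y)) (L z) p = - metric_apply g (D (L x) (L z)) (L y) p"
    for x y z p
    using fun_cong[OF metric_compatible[OF L_in L_in L_in, of x y z], of p] L_in
    by (simp add: metric_L vf_apply_const metric_apply_sym[OF L_in D_in[OF L_in L_in]])
  have tor: "metric_apply g (D (L x) (L y)) (L z) p - metric_apply g (D (L y) (L x)) (L z) p = b x y \<bullet> z"
    for x y z p
  proof -
    have "D (L x) (L y) = L (b x y) + D (L y) (L x)"
      using b[of x y] bracket_eq[OF L_in L_in, of x y] by (simp add: algebra_simps)
    then show ?thesis by (simp add: metric_apply_add L_in D_in metric_L)
  qed
  have "metric_apply g (D (L x) (L y)) (L z) = (\<lambda>_. (b x y \<bullet> z - b y z \<bullet> x + b z x \<bullet> y) / 2)" for z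
  proof
    fix p
    show "metric_apply g (D (L x) (L y)) (L z) p = (b x y \<bullet> z - b y z \<bullet> x + b z x \<bullet> y) / 2"
      using tor[of x y z p] tor[of y z x p] tor[of z x y p] compat[of x y z p] compat[of y z x p]
        compat[of z x y p] by simp
  qed
  then have "D (L x) (L y) = L (\<Sum>i<DIM('e). ((b x y \<bullet> basis_enum i - b y (basis_enum i) \<bullet> x
      + b (basis_enum i) x \<bullet> y) / 2) *\<^sub>R basis_enum i)"
    by (intro L_if_constant_coefficients D_in L_in) (simp add: E_eq_L)
  then show ?thesis by blast
qed

definition nab :: "'e \<Rightarrow> 'e \<Rightarrow> 'e" where
  "nab x y = (SOME z. D (L x) (L y) = L z)"

lemma D_L: "D (L x) (L y) = L (nab x y)"
  unfolding nab_def by (rule someI_ex) (rule D_L_ex)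

lemma bracket_L: "vf_bracket (L x) (L y) = L (bracket_of nab x y)"
  by (simp add: bracket_eq L_in D_L bracket_of_def L_diff)

lemma curvature_L: "curvature D (L x) (L y) (L z) = L (curv nab x y z)"
  by (simp add: curvature_def curv_def bracket_L D_L L_add L_diff)

lemma nabla_curvature_L: "nabla_curvature (L w) (L x) (L y) (L z) = L (nabla_curv nab w x y z)"
  by (simp add: nabla_curvature_def nabla_curv_def curvature_L D_L L_diff)

sublocale euclidean_lie_algebra nab
proof
  show "bilinear nab"
    unfolding bilinear_def
  proof (intro conjI allI linearI)
    fix x y z a
    show "nab x (y + z) = nab x y + nab x z"
      by (rule L_inj) (simp add: D_L[symmetric] L_add D_add_right L_in)
    show "nab (y + z) x = nab y x + nab z x"
      by (rule L_inj) (simp add: D_L[symmetric] L_add D_add_left L_in)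
    show "nab x (a *\<^sub>R y) = a *\<^sub>R nab x y"
      by (rule L_inj) (simp add: D_L[symmetric] L_scale D_const_right L_in)
    show "nab (a *\<^sub>R y) x = a *\<^sub>R nab y x"
      by (rule L_inj) (simp add: D_L[symmetric] L_scale D_scale_left L_in smooth_fun_const)
  qed
  show "nab x y \<bullet> z = - (y \<bullet> nab x z)" for x y z
    using fun_cong[OF metric_compatible[OF L_in L_in L_in, of x y z]] L_in
    by (simp add: metric_L vf_apply_const D_L)
  show "bracket_of nab (bracket_of nab x y) z + bracket_of nab (bracket_of nab y z) x
      + bracket_of nab (bracket_of nab z x) y = 0" for x y z
    using vf_bracket_jacobi[OF L_in L_in L_in, of x y z]
    by (intro L_inj) (simp add: bracket_L L_add L_zero)
qed

lemma locally_symmetric_if_parallel: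
  assumes "\<And>w x y z. nabla_curv nab w x y z = 0"
  shows "locally_symmetric charts D"
  by (rule locally_symmetric_frame) (simp add: E_eq_L nabla_curvature_L assms L_zero)

lemma ricci_L: "ricci g D DIM('e) E (L x) (L y) = (\<lambda>p. ric nab x y)"
proof -
  have "metric_apply g (curvature D (L x) (E i) (L y)) (E i) = (\<lambda>p. curv nab x (basis_enum i) y \<bullet> basis_enum i)"
    if "i < DIM('e)" for i
    using that by (simp add: E_eq_L curvature_L metric_L)
  then show ?thesis
    by (simp add: ricci_def ric_def sum_basis_enum[symmetric])
qed

lemma scalar_curvature_L: "scalar_curvature g D DIM('e) E = (\<lambda>p. \<Sum>b\<in>Basis. ric nab b b)"
  by (simp add: scalar_curvature_def sum_basis_enum[symmetric] E_eq_L ricci_L)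

lemma weyl_L: "weyl g D DIM('e) E (L x) (L y) (L u) (L v) = (\<lambda>p. weyl_form nab x y u v)"
  by (simp add: weyl_def weyl_form_def curvature_L metric_L kulkarni_nomizu_def schouten_def
      schouten_form_def ricci_L scalar_curvature_L)

lemma div_weyl_L:
  "(\<Sum>i<DIM('e). nabla_tensor4 D (weyl g D DIM('e) E) (E i) (E i) (L x) (L y) (L z) p)
    = (\<Sum>b\<in>Basis. nabla_form4 nab (weyl_form nab) b b x y z)"
proof -
  have "nabla_tensor4 D (weyl g D DIM('e) E) (L w) (L w') (L x) (L y) (L z) p
    = nabla_form4 nab (weyl_form nab) w w' x y z" for w w'
    by (simp add: nabla_tensor4_def nabla_form4_def D_L weyl_L vf_apply_const L_in)
  then show ?thesis by (simp add: sum_basis_enum[symmetric] E_eq_L)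
qed

end

text \<open>Orthonormality is given at \<open>idt\<close> only; left translation by \<open>p\<close>
  carries it from \<open>idt\<close> to \<open>p\<close>.\<close>

lemma metric_apply_left_invariant:
  assumes "riemannian_lie_group mul idt inver charts g" "X \<in> lie_algebra mul charts" "Y \<in> lie_algebra mul charts"
  shows "metric_apply g X Y p = metric_apply g X Y idt"
proof -
  interpret group mul idt inver
    using assms(1) by (simp add: riemannian_lie_group_def lie_group_def)
  have Z: "Z p = push_forward (mul p) (Z idt)" "Z idt \<in> tangent_space charts idt"
    if "Z \<in> lie_algebra mul charts" for Z
  proof -
    have "Z (mul p idt) = push_forward (mul p) (Z idt)"
      using that unfolding lie_algebra_def by blast
    then show "Z p = push_forward (mul p) (Z idt)" by simp
    show "Z idt \<in> tangent_space charts idt"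
      using that by (simp add: lie_algebra_def vector_fields_def)
  qed
  have "left_invariant_metric mul charts g"
    using assms(1) by (simp add: riemannian_lie_group_def)
  then have "g (mul p idt) (push_forward (mul p) (X idt)) (push_forward (mul p) (Y idt)) = g idt (X idt) (Y idt)"
    using Z(2) assms(2,3) unfolding left_invariant_metric_def by blast
  then show ?thesis
    by (simp add: metric_apply_def Z(1)[OF assms(2)] Z(1)[OF assms(3)])
qed

text \<open>Joins the two halves: the geometry supplies \<open>nab\<close> with the Codazzi
  equation, and \<open>parallel\<close> is the algebraic claim left for each bracket table.
  \<open>\<Phi>\<close> is the given isomorphism \<open>F\<close> read through \<open>L\<close>, and
  its bijectivity yields the dimension of \<open>'e\<close>.\<close>

lemma locally_symmetric_if_model:
  fixes charts :: "('g::{t2_space, second_countable_topology}, 'e::euclidean_space) chart set"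
    and b :: "'v::euclidean_space \<Rightarrow> 'v \<Rightarrow> 'v"
  assumes group: "riemannian_lie_group mul idt inver charts g"
    and lc: "levi_civita charts g D"
    and weyl: "harmonic_weyl mul idt charts g D"
    and iso: "isomorphic_to (lie_algebra mul charts) b"
    and dim: "DIM('v) = 4"
    and parallel: "\<And>(nab :: 'e \<Rightarrow> 'e \<Rightarrow> 'e) \<Phi> w x y z. euclidean_lie_algebra_model nab \<Phi> b \<Longrightarrow>
      DIM('e) = 4 \<Longrightarrow> nabla_curv nab w x y z = 0"
  shows "locally_symmetric charts D"
proof -
  let ?\<gg> = "lie_algebra mul charts"
  obtain E where E: "orthonormal_basis ?\<gg> idt g DIM('e) E"
    and div: "\<And>x y z p. x \<in> ?\<gg> \<Longrightarrow> y \<in> ?\<gg> \<Longrightarrow> z \<in> ?\<gg> \<Longrightarrow>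
      (\<Sum>i<DIM('e). nabla_tensor4 D (weyl g D DIM('e) E) (E i) (E i) x y z p) = 0"
    using weyl unfolding harmonic_weyl_def by blast
  obtain F where F: "bij_betw F UNIV ?\<gg>" and F_add: "\<And>x y. F (x + y) = F x + F y"
    and F_scale: "\<And>a x. F (a *\<^sub>R x) = vf_scale (\<lambda>_. a) (F x)"
    and F_br: "\<And>x y. F (b x y) = vf_bracket (F x) (F y)"
    using iso unfolding isomorphic_to_def by blast
  have E_in: "E i \<in> ?\<gg>" if "i < DIM('e)" for i
    using E that by (simp add: orthonormal_basis_def)
  have F_range: "X \<in> ?\<gg> \<longleftrightarrow> (\<exists>x. X = F x)" for X
    using F by (auto simp: bij_betw_def)
  have closed: "X + Y \<in> ?\<gg>" "vf_scale (\<lambda>_. a) X \<in> ?\<gg>" "vf_bracket X Y \<in> ?\<gg>"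
    if "X \<in> ?\<gg>" "Y \<in> ?\<gg>" for X Y a
    using that unfolding F_range by (metis F_add, metis F_scale, metis F_br)
  interpret invariant_frame charts g D E ?\<gg>
  proof
    show "smooth_atlas charts" "riemannian_metric charts g" "levi_civita charts g D"
      using group lc by (simp_all add: riemannian_lie_group_def lie_group_def)
    show "E i \<in> vector_fields charts" if "i < DIM('e)" for i
      using E_in[OF that] by (simp add: lie_algebra_def)
    show "metric_apply g (E i) (E j) p = (if i = j then 1 else 0)" if "i < DIM('e)" "j < DIM('e)" for i j p
      using metric_apply_left_invariant[OF group E_in[OF that(1)] E_in[OF that(2)]] E that
      by (simp add: orthonormal_basis_def)
    show "?\<gg> = {\<Sum>i<DIM('e). vf_scale (\<lambda>_. c i) (E i) | c. True}"
    proof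
      show "?\<gg> \<subseteq> {\<Sum>i<DIM('e). vf_scale (\<lambda>_. c i) (E i) | c. True}"
        using E by (auto simp: orthonormal_basis_def)
      have "0 \<in> ?\<gg>" using closed(2)[of "E 0" "E 0" 0] E_in[of 0] by (simp add: vf_scale_def zero_fun_def)
      then have "(\<Sum>i\<in>I. vf_scale (\<lambda>_. c i) (E i)) \<in> ?\<gg>" if "I \<subseteq> {..<DIM('e)}" for I c
        using that by (induction I rule: infinite_finite_induct) (auto intro: closed E_in)
      then show "{\<Sum>i<DIM('e). vf_scale (\<lambda>_. c i) (E i) | c. True} \<subseteq> ?\<gg>" by blast
    qed
    show "vf_bracket X Y \<in> ?\<gg>" if "X \<in> ?\<gg>" "Y \<in> ?\<gg>" for X Y by (rule closed(3)[OF that])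
  qed
  have "\<exists>x. L x = F v" for v using range_L F_range by (metis rangeE)
  then obtain \<Phi> where \<Phi>: "\<And>v. L (\<Phi> v) = F v" by metis
  have lin: "linear \<Phi>"
    by (rule linearI; rule L_inj) (simp_all add: \<Phi> L_add L_scale F_add F_scale)
  have bij: "bij \<Phi>"
  proof (rule bijI)
    show "inj \<Phi>" by (rule injI) (metis \<Phi> F bij_betw_imp_inj_on injD)
    show "surj \<Phi>" unfolding surj_def by (metis \<Phi> F_range L_inj range_L rangeI)
  qed
  have br: "\<Phi> (b x y) = bracket_of nab (\<Phi> x) (\<Phi> y)" for x y
    by (rule L_inj) (simp add: \<Phi> F_br bracket_L[symmetric])
  have "dim (range \<Phi>) = DIM('v)"
    using dim_image_eq[OF lin, of UNIV] bij by (simp add: bij_is_inj)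
  then have dim_e: "DIM('e) = 4" using bij dim by (simp add: bij_is_surj)
  have "nabla_ric nab y x z = nabla_ric nab z x y" for x y z
  proof (rule codazzi)
    show "3 < DIM('e)" using dim_e by simp
    show "(\<Sum>b\<in>Basis. nabla_form4 nab (weyl_form nab) b b x y z) = 0" for x y z
      using div[of "L x" "L y" "L z"] range_L div_weyl_L[of x y z] by auto
  qed
  then have cod: "nabla_ric nab x y z = nabla_ric nab y x z" for x y z
    using Nr_sym by metis
  have "euclidean_lie_algebra_model nab \<Phi> b"
    by (intro euclidean_lie_algebra_model.intro euclidean_lie_algebra_axioms
        euclidean_lie_algebra_model_axioms.intro lin bij br cod)
  then show ?thesis using locally_symmetric_if_parallel parallel dim_e by blast
qed

theorem theorem1p3:
  fixes mul :: "'g::{t2_space, second_countable_topology} \<Rightarrow> 'g \<Rightarrow> 'g"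
    and idt :: 'g and inver :: "'g \<Rightarrow> 'g"
    and charts :: "('g, 'e::euclidean_space) chart set"
    and g :: "'g metric"
    and D :: "'g vfield \<Rightarrow> 'g vfield \<Rightarrow> 'g vfield"
  assumes "riemannian_lie_group mul idt inver charts g"
    and "connected (UNIV :: 'g set)"
    and "levi_civita charts g D"
    and "harmonic_weyl mul idt charts g D"
    and "isomorphic_to (lie_algebra mul charts) (bracket_sum A2 A2) \<or>
         (\<exists>\<alpha> \<beta>. \<alpha> \<noteq> 0 \<and> \<beta> \<ge> 0 \<and> \<alpha> \<noteq> 1 \<and>
            isomorphic_to (lie_algebra mul charts) (A4_6 \<alpha> \<beta>)) \<or>
         isomorphic_to (lie_algebra mul charts) (bracket_sum A3_9 A1) \<or>
         (\<exists>\<alpha>>0. isomorphic_to (lie_algebra mul charts) (bracket_sum (A3_7 \<alpha>) A1)) \<or>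
         isomorphic_to (lie_algebra mul charts) A4_12"
  shows "locally_symmetric charts D"
proof -
  note if_model = locally_symmetric_if_model[OF assms(1,3,4)]
  have 1: ?thesis if "isomorphic_to (lie_algebra mul charts) (bracket_sum A2 A2)"
  proof (rule if_model[OF that])
    fix nab :: "'e \<Rightarrow> 'e \<Rightarrow> 'e" and \<Phi> w x y z
    assume model: "euclidean_lie_algebra_model nab \<Phi> (bracket_sum A2 A2)" and dim: "DIM('e) = 4"
    interpret euclidean_lie_algebra_model nab \<Phi> "bracket_sum A2 A2" by (rule model)
    \<comment> \<open>In each factor the first basis vector acts as the identity on the second, so
      \<open>(bv 1, bv 1)\<close> does so on the whole derived algebra.\<close>
    show "nabla_curv nab w x y z = 0"
    proof (rule solvable_model[OF dim, of "(bv 2, 0)" "(0, bv 2)" "(bv 1, bv 1)"])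
      show "bracket_sum A2 A2 x y \<in> span {(bv 2, 0), (0, bv 2)}" for x y
      proof -
        have "bracket_sum A2 A2 x y = (A2 (fst x) (fst y) $ 2) *\<^sub>R (bv 2, 0) + (A2 (snd x) (snd y) $ 2) *\<^sub>R (0, bv 2)"
          by (simp add: bracket_sum_def A2_apply)
        also have "\<dots> \<in> span {(bv 2, 0), (0, bv 2)}"
          by (intro span_add span_scale span_base) simp_all
        finally show ?thesis .
      qed
    qed (auto simp: bracket_sum_def A2_apply zero_prod_def axis_def vec_eq_iff forall_2)
  qed simp
  have 2: ?thesis if "isomorphic_to (lie_algebra mul charts) (A4_6 \<alpha> \<beta>)" for \<alpha> \<beta>
  proof (rule if_model[OF that])
    fix nab :: "'e \<Rightarrow> 'e \<Rightarrow> 'e" and \<Phi> w x y z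
    assume model: "euclidean_lie_algebra_model nab \<Phi> (A4_6 \<alpha> \<beta>)"
    interpret euclidean_lie_algebra_model nab \<Phi> "A4_6 \<alpha> \<beta>" by (rule model)
    show "nabla_curv nab w x y z = 0"
      by (rule almost_abelian_model[of "\<lambda>x. x $ 4" "bv 4"])
        (auto simp: A4_6_apply axis_def intro!: linearI)
  qed simp
  have 3: ?thesis if "isomorphic_to (lie_algebra mul charts) (bracket_sum A3_9 A1)"
    by (rule if_model[OF that _ su2_model]) simp
  have 4: ?thesis if "isomorphic_to (lie_algebra mul charts) (bracket_sum (A3_7 \<alpha>) A1)" for \<alpha>
  proof (rule if_model[OF that])
    fix nab :: "'e \<Rightarrow> 'e \<Rightarrow> 'e" and \<Phi> w x y z
    assume model: "euclidean_lie_algebra_model nab \<Phi> (bracket_sum (A3_7 \<alpha>) A1)"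
    interpret euclidean_lie_algebra_model nab \<Phi> "bracket_sum (A3_7 \<alpha>) A1" by (rule model)
    \<comment> \<open>The abelian ideal is spanned by \<open>f1\<close>, \<open>f2\<close> and the
      central line \<open>A1\<close>.\<close>
    show "nabla_curv nab w x y z = 0"
      by (rule almost_abelian_model[of "\<lambda>x. fst x $ 3" "(bv 3, 0)"])
        (auto simp: bracket_sum_def A3_7_apply A1_def zero_prod_def axis_def intro!: linearI)
  qed simp
  have 5: ?thesis if "isomorphic_to (lie_algebra mul charts) A4_12"
  proof (rule if_model[OF that])
    fix nab :: "'e \<Rightarrow> 'e \<Rightarrow> 'e" and \<Phi> w x y z
    assume model: "euclidean_lie_algebra_model nab \<Phi> A4_12" and dim: "DIM('e) = 4"
    interpret euclidean_lie_algebra_model nab \<Phi> A4_12 by (rule model)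
    \<comment> \<open>The table has \<open>[f1, f3] = f1\<close> and \<open>[f2, f3] = f2\<close>,
      so it is \<open>- f3\<close> that acts as the identity on the derived algebra.\<close>
    show "nabla_curv nab w x y z = 0"
    proof (rule solvable_model[OF dim, of "bv 1" "bv 2" "- bv 3"])
      show "A4_12 x y \<in> span {bv 1, bv 2}" for x y
        unfolding A4_12_apply by (intro span_add span_diff span_scale span_base) auto
    qed (auto simp: A4_12_apply axis_def vec_eq_iff forall_4)
  qed simp
  show ?thesis using assms(5) 1 2 3 4 5 by blast
qed

end
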